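(* Let $S$ be a spray on a smooth manifold $M$ with canonical connection $\Gamma_S$, and let $\nabla$ be a lift of $\Gamma_S$ whose torsion satisfies ${\rm T}(S,Y)=0$ for all $Y\in\mathfrak{X}(TM\setminus 0)$. Let $\mathcal{O}\subseteq M$ be open and let $W\in\mathfrak{X}(\mathcal{O})$ be nowhere null and such that its integral curve through some point $x_0\in\mathcal{O}$ is a geodesic of $S$. Then, at $x_0$, the curvature endomorphism in the direction $W$ of the affine connection $D^W$ coincides with ${\bf R}_W$; that is, for every $U\in\mathfrak{X}(\mathcal{O})$, at $x_0$, $$D^W_UD^W_WW-D^W_WD^W_UW+D^W_{[W,U]}W={\bf R}_W(U).$$
   Context: Let $\pi:TM\setminus 0\to M$ be the tangent bundle with the zero section removed, $\mathscr{V}TM=\ker({\rm d}\pi)\subset T(TM\setminus 0)$ the vertical bundle, regarded as a vector bundle over $TM\setminus 0$. For $w\in TM\setminus 0$, $i_w:T_{\pi(w)}M\to\mathscr{V}_wTM$, $i_w(u)=\frac{d}{dt}|_{t=0}(w+tu)$. The canonical vector field is $C(w)=i_w(w)$, and $\mathscr{J}(X)=i_w({\rm d}\pi(X))$ for $X\in T_w(TM\setminus 0)$. A spray is a smooth vector field $S$ on $TM\setminus 0$ with $\mathscr{J}(S)=C$ and $[C,S]=S$; its geodesics are the curves $\gamma$ in $M$ such that $t\mapsto\dot\gamma(t)$ is an integral curve of $S$. Its canonical connection is $\Gamma_S=-[S,\mathscr{J}]$, i.e. $\Gamma_S(Y)=\mathscr{J}[S,Y]-[S,\mathscr{J}(Y)]$;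 it satisfies $\Gamma_S^2={\bf I}$ and $\ker(\Gamma_S+{\bf I})=\mathscr{V}TM$. With $\mathscr{H}TM=\ker(\Gamma_S-{\bf I})$ (horizontal vectors) one has $T(TM\setminus 0)=\mathscr{H}TM\oplus\mathscr{V}TM$, with projections denoted $\mathscr{H},\mathscr{V}$; $S$ is horizontal. $u^{\mathfrak h}$ denotes the horizontal lift at $w$ of $u\in T_{\pi(w)}M$. A linear connection $\nabla$ on the vector bundle $\mathscr{V}TM\to TM\setminus 0$ is a lift of $\Gamma_S$ if $\nabla_XC=\mathscr{V}X$ for all $X\in T(TM\setminus 0)$. Its torsion is ${\rm T}(X,Y)=\nabla_X\mathscr{J}(Y)-\nabla_Y\mathscr{J}(X)-\mathscr{J}[X,Y]$, and its curvature is $\mathcal{R}(X,Y)\mathscr{J}(Z)=\nabla_{[X,Y]}\mathscr{J}(Z)-[\nabla_X,\nabla_Y]\mathscr{J}(Z)$. The curvature endomorphism in the direction $w$ is ${\bf R}_w:T_{\pi(w)}M\to T_{\pi(w)}M$, ${\bf R}_w(u)=i_w^{-1}\mathcal{R}(S,u^{\mathfrak h})C$ (evaluated at $w$). Affine connections: for $w\in T_xM\setminus 0$, $u\in T_xM$, and $V$ a vector field near $x$, $D^w_uV=i_w^{-1}\nabla_{u^{\mathfrak h}}V^{\mathfrak v}$, where $V^{\mathfrak v}(z)=i_z(V(\pi(z)))$. For a nowhere null $W\in\mathfrak{X}(\mathcal{O})$, $D^W$ is the affine connection on $\mathcal{O}$ given by $(D^W_UV)(x)=D^{W(x)}_{U(x)}V$.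 *)

theory Defs
  imports "HOL-Analysis.Analysis"
begin

section \<open>Smooth maps between open subsets of Euclidean spaces\<close>

text \<open>Only used with an open \<open>U\<close> in a Euclidean space, where \<open>Ck_on k U f\<close> is the usual
  \<open>C^k\<close> condition (all iterated directional derivatives up to order \<open>k\<close> exist and are
  continuous).\<close>

primrec Ck_on :: "nat \<Rightarrow> 'a::real_normed_vector set \<Rightarrow> ('a \<Rightarrow> 'b::real_normed_vector) \<Rightarrow> bool"
  where
    "Ck_on 0 U f \<longleftrightarrow> continuous_on U f"
  | "Ck_on (Suc k) U f \<longleftrightarrow>
       (\<forall>x\<in>U. f differentiable (at x)) \<and>
       (\<forall>v. Ck_on k U (\<lambda>x. frechet_derivative f (at x) v))"

definition smooth_on :: "'a::real_normed_vector set \<Rightarrow> ('a \<Rightarrow> 'b::real_normed_vector) \<Rightarrow> bool"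
  where "smooth_on U f \<longleftrightarrow> (\<forall>k. Ck_on k U f)"


section \<open>Smooth manifolds\<close>

text \<open>A chart is a pair of its domain and a (total) coordinate map; the values of the latter
  outside the domain are irrelevant.  A manifold is given by an atlas, which need not be maximal;
  its points are the points covered by the charts, and it carries the topology in which the chart
  domains are open and the charts are homeomorphisms onto their images.\<close>

type_synonym ('a, 'e) chart = "'a set \<times> ('a \<Rightarrow> 'e)"

type_synonym ('a, 'e) atlas = "('a, 'e) chart set"

definition carrier_of :: "('a, 'e) atlas \<Rightarrow> 'a set"
  where "carrier_of B = (\<Union>c\<in>B. fst c)"

definition mtop :: "('a, 'e::topological_space) atlas \<Rightarrow> 'a topology"
  where "mtop B = topology_generated_by {fst c \<inter> snd c -` V | c V. c \<in> B \<and> open V}"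

definition chart_inv :: "('a, 'e) chart \<Rightarrow> 'e \<Rightarrow> 'a"
  where "chart_inv c = inv_into (fst c) (snd c)"

locale smooth_manifold =
  fixes B :: "('a, 'e::euclidean_space) atlas"
  assumes chart_inj: "\<And>c. c \<in> B \<Longrightarrow> inj_on (snd c) (fst c)"
    and chart_open: "\<And>c d. c \<in> B \<Longrightarrow> d \<in> B \<Longrightarrow> open (snd c ` (fst c \<inter> fst d))"
    and transition_smooth: "\<And>c d. c \<in> B \<Longrightarrow> d \<in> B \<Longrightarrow>
      smooth_on (snd c ` (fst c \<inter> fst d)) (snd d \<circ> chart_inv c)"
    and Hausdorff: "Hausdorff_space (mtop B)"
    and second_countable: "\<exists>\<U>. countable \<U> \<and> (\<forall>V\<in>\<U>. openin (mtop B) V) \<and>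
      (\<forall>V x. openin (mtop B) V \<and> x \<in> V \<longrightarrow> (\<exists>N\<in>\<U>. x \<in> N \<and> N \<subseteq> V))"

definition chart_at :: "('a, 'e) atlas \<Rightarrow> 'a \<Rightarrow> ('a, 'e) chart"
  where "chart_at B p = (SOME c. c \<in> B \<and> p \<in> fst c)"

definition smooth_fun ::
  "('a, 'e::euclidean_space) atlas \<Rightarrow> 'a set \<Rightarrow> ('a \<Rightarrow> real) \<Rightarrow> bool"
  where "smooth_fun B D f \<longleftrightarrow> (\<forall>c\<in>B. smooth_on (snd c ` (D \<inter> fst c)) (f \<circ> chart_inv c))"


section \<open>Tangent vectors and vector fields\<close>

text \<open>A tangent vector is its base point together with its components with respect to all the
  charts around that point, related by the derivatives of the coordinate changes.  The components
  with respect to anything that is not a chart around the base point are set to \<open>0\<close>, so that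
  equality is equality of tangent vectors.\<close>

type_synonym ('a, 'e) tvec = "'a \<times> (('a, 'e) chart \<Rightarrow> 'e)"

definition tangent_space :: "('a, 'e::euclidean_space) atlas \<Rightarrow> 'a \<Rightarrow> ('a, 'e) tvec set"
  where "tangent_space B p = {v. fst v = p \<and>
     (\<forall>c. c \<notin> B \<or> p \<notin> fst c \<longrightarrow> snd v c = 0) \<and>
     (\<forall>c\<in>B. \<forall>d\<in>B. p \<in> fst c \<longrightarrow> p \<in> fst d \<longrightarrow>
        snd v d = frechet_derivative (snd d \<circ> chart_inv c) (at (snd c p)) (snd v c))}"

definition tzero :: "'a \<Rightarrow> ('a, 'e::real_vector) tvec"
  where "tzero p = (p, \<lambda>_. 0)"

definition tadd ::
  "('a, 'e::real_vector) tvec \<Rightarrow> ('a, 'e) tvec \<Rightarrow> ('a, 'e) tvec" (infixl "+\<^sub>T" 65)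
  where "v +\<^sub>T w = (fst v, \<lambda>c. snd v c + snd w c)"

definition tdiff ::
  "('a, 'e::real_vector) tvec \<Rightarrow> ('a, 'e) tvec \<Rightarrow> ('a, 'e) tvec" (infixl "-\<^sub>T" 65)
  where "v -\<^sub>T w = (fst v, \<lambda>c. snd v c - snd w c)"

definition tscale :: "real \<Rightarrow> ('a, 'e::real_vector) tvec \<Rightarrow> ('a, 'e) tvec" (infixr "*\<^sub>T" 75)
  where "r *\<^sub>T v = (fst v, \<lambda>c. r *\<^sub>R snd v c)"

definition tangent_map ::
  "('a, 'e::euclidean_space) atlas \<Rightarrow> ('b, 'f::euclidean_space) atlas \<Rightarrow> ('a \<Rightarrow> 'b) \<Rightarrow>
   ('a, 'e) tvec \<Rightarrow> ('b, 'f) tvec"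
  where "tangent_map B B' F v =
    (F (fst v), \<lambda>d. if d \<in> B' \<and> F (fst v) \<in> fst d
       then let c = chart_at B (fst v)
            in frechet_derivative (snd d \<circ> F \<circ> chart_inv c) (at (snd c (fst v))) (snd v c)
       else 0)"

definition dir_deriv ::
  "('a, 'e::euclidean_space) atlas \<Rightarrow> ('a, 'e) tvec \<Rightarrow> ('a \<Rightarrow> real) \<Rightarrow> real"
  where "dir_deriv B v f = (let c = chart_at B (fst v)
     in frechet_derivative (f \<circ> chart_inv c) (at (snd c (fst v))) (snd v c))"

definition velocity ::
  "('a, 'e::euclidean_space) atlas \<Rightarrow> (real \<Rightarrow> 'a) \<Rightarrow> real \<Rightarrow> ('a, 'e) tvec"
  where "velocity B \<gamma> t =
    (\<gamma> t, \<lambda>c. if c \<in> B \<and> \<gamma> t \<in> fst c then vector_derivative (snd c \<circ> \<gamma>) (at t) else 0)"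

definition smooth_curve ::
  "('a, 'e::euclidean_space) atlas \<Rightarrow> real set \<Rightarrow> (real \<Rightarrow> 'a) \<Rightarrow> bool"
  where "smooth_curve B J \<gamma> \<longleftrightarrow> continuous_map (top_of_set J) (mtop B) \<gamma> \<and>
    (\<forall>c\<in>B. smooth_on {t \<in> J. \<gamma> t \<in> fst c} (snd c \<circ> \<gamma>))"

definition vf_rep ::
  "('a, 'e) chart \<Rightarrow> ('a \<Rightarrow> ('a, 'e) tvec) \<Rightarrow> 'e \<Rightarrow> 'e"
  where "vf_rep c X = (\<lambda>x. snd (X (chart_inv c x)) c)"

text \<open>\<open>X \<in> \<XX>(D)\<close> for an open set \<open>D\<close>; values outside \<open>D\<close> are irrelevant.\<close>

definition smooth_vf ::
  "('a, 'e::euclidean_space) atlas \<Rightarrow> 'a set \<Rightarrow> ('a \<Rightarrow> ('a, 'e) tvec) \<Rightarrow> bool"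
  where "smooth_vf B D X \<longleftrightarrow> (\<forall>p\<in>D. X p \<in> tangent_space B p) \<and>
    (\<forall>c\<in>B. smooth_on (snd c ` (D \<inter> fst c)) (vf_rep c X))"

definition integral_curve ::
  "('a, 'e::euclidean_space) atlas \<Rightarrow> 'a set \<Rightarrow> ('a \<Rightarrow> ('a, 'e) tvec) \<Rightarrow> real set \<Rightarrow>
   (real \<Rightarrow> 'a) \<Rightarrow> bool"
  where "integral_curve B D X J \<gamma> \<longleftrightarrow> smooth_curve B J \<gamma> \<and>
    (\<forall>t\<in>J. \<gamma> t \<in> D \<and> velocity B \<gamma> t = X (\<gamma> t))"

definition lie_bracket ::
  "('a, 'e::euclidean_space) atlas \<Rightarrow> ('a \<Rightarrow> ('a, 'e) tvec) \<Rightarrow> ('a \<Rightarrow> ('a, 'e) tvec) \<Rightarrow>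
   'a \<Rightarrow> ('a, 'e) tvec"
  where "lie_bracket B X Y p = (p, \<lambda>c. if c \<in> B \<and> p \<in> fst c
     then frechet_derivative (vf_rep c Y) (at (snd c p)) (snd (X p) c)
        - frechet_derivative (vf_rep c X) (at (snd c p)) (snd (Y p) c)
     else 0)"

text \<open>A vector field, smooth near the base point of \<open>v\<close>, that extends \<open>v\<close>.  It is used to
  evaluate tensorial expressions on a single tangent vector.\<close>

definition local_ext ::
  "('a, 'e::euclidean_space) atlas \<Rightarrow> ('a, 'e) tvec \<Rightarrow> 'a \<Rightarrow> ('a, 'e) tvec"
  where "local_ext B v = (SOME Y. Y (fst v) = v \<and>
     (\<exists>D. openin (mtop B) D \<and> fst v \<in> D \<and> smooth_vf B D Y))"


section \<open>The slit tangent bundle and its vertical bundle\<close>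

definition slit :: "('a, 'e::euclidean_space) atlas \<Rightarrow> ('a, 'e) tvec set"
  where "slit A = (\<Union>p\<in>carrier_of A. tangent_space A p - {tzero p})"

definition slit_chart ::
  "('a, 'e::euclidean_space) atlas \<Rightarrow> ('a, 'e) chart \<Rightarrow> (('a, 'e) tvec, 'e \<times> 'e) chart"
  where "slit_chart A c = ({w \<in> slit A. fst w \<in> fst c}, \<lambda>w. (snd c (fst w), snd w c))"

definition slit_atlas ::
  "('a, 'e::euclidean_space) atlas \<Rightarrow> (('a, 'e) tvec, 'e \<times> 'e) atlas"
  where "slit_atlas A = slit_chart A ` A"

type_synonym ('a, 'e) ttvec = "(('a, 'e) tvec, 'e \<times> 'e) tvec"

definition dpi :: "('a, 'e::euclidean_space) atlas \<Rightarrow> ('a, 'e) ttvec \<Rightarrow> ('a, 'e) tvec"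
  where "dpi A = tangent_map (slit_atlas A) A fst"

definition vertical_space ::
  "('a, 'e::euclidean_space) atlas \<Rightarrow> ('a, 'e) tvec \<Rightarrow> ('a, 'e) ttvec set"
  where "vertical_space A w = {\<xi> \<in> tangent_space (slit_atlas A) w. dpi A \<xi> = tzero (fst w)}"

definition vsmooth ::
  "('a, 'e::euclidean_space) atlas \<Rightarrow> ('a, 'e) tvec set \<Rightarrow>
   (('a, 'e) tvec \<Rightarrow> ('a, 'e) ttvec) \<Rightarrow> bool"
  where "vsmooth A D s \<longleftrightarrow> smooth_vf (slit_atlas A) D s \<and> (\<forall>w\<in>D. s w \<in> vertical_space A w)"

text \<open>\<open>ilift A w\<close> is the isomorphism \<open>i\<^sub>w\<close> from the tangent space at the base point of \<open>w\<close> onto the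
  vertical space at \<open>w\<close>, and \<open>vendo\<close> below is the vertical endomorphism \<open>J\<close>.\<close>

definition ilift ::
  "('a, 'e::euclidean_space) atlas \<Rightarrow> ('a, 'e) tvec \<Rightarrow> ('a, 'e) tvec \<Rightarrow> ('a, 'e) ttvec"
  where "ilift A w u = velocity (slit_atlas A) (\<lambda>t. w +\<^sub>T t *\<^sub>T u) 0"

definition ilift_inv ::
  "('a, 'e::euclidean_space) atlas \<Rightarrow> ('a, 'e) tvec \<Rightarrow> ('a, 'e) ttvec \<Rightarrow> ('a, 'e) tvec"
  where "ilift_inv A w = inv_into (tangent_space A (fst w)) (ilift A w)"

definition canonical_vf ::
  "('a, 'e::euclidean_space) atlas \<Rightarrow> ('a, 'e) tvec \<Rightarrow> ('a, 'e) ttvec"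
  where "canonical_vf A w = ilift A w w"

definition vendo :: "('a, 'e::euclidean_space) atlas \<Rightarrow> ('a, 'e) ttvec \<Rightarrow> ('a, 'e) ttvec"
  where "vendo A \<xi> = ilift A (fst \<xi>) (dpi A \<xi>)"


section \<open>Sprays\<close>

type_synonym ('a, 'e) tfield = "('a, 'e) tvec \<Rightarrow> ('a, 'e) ttvec"

definition spray :: "('a, 'e::euclidean_space) atlas \<Rightarrow> ('a, 'e) tfield \<Rightarrow> bool"
  where "spray A S \<longleftrightarrow> smooth_vf (slit_atlas A) (slit A) S \<and>
    (\<forall>w\<in>slit A. vendo A (S w) = canonical_vf A w \<and>
                lie_bracket (slit_atlas A) (canonical_vf A) S w = S w)"

definition geodesic ::
  "('a, 'e::euclidean_space) atlas \<Rightarrow> ('a, 'e) tfield \<Rightarrow> real set \<Rightarrow> (real \<Rightarrow> 'a) \<Rightarrow> bool"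
  where "geodesic A S J \<gamma> \<longleftrightarrow> smooth_curve A J \<gamma> \<and>
    integral_curve (slit_atlas A) (slit A) S J (velocity A \<gamma>)"

text \<open>The canonical connection \<open>Y \<mapsto> J[S, Y] - [S, J Y]\<close> is tensorial; its value at a tangent
  vector is obtained through a local extension.\<close>

definition canonical_connection ::
  "('a, 'e::euclidean_space) atlas \<Rightarrow> ('a, 'e) tfield \<Rightarrow> ('a, 'e) ttvec \<Rightarrow> ('a, 'e) ttvec"
  where "canonical_connection A S \<xi> =
    (let Y = local_ext (slit_atlas A) \<xi>
     in vendo A (lie_bracket (slit_atlas A) S Y (fst \<xi>))
        -\<^sub>T lie_bracket (slit_atlas A) S (\<lambda>z. vendo A (Y z)) (fst \<xi>))"

definition horizontal_space ::
  "('a, 'e::euclidean_space) atlas \<Rightarrow> ('a, 'e) tfield \<Rightarrow> ('a, 'e) tvec \<Rightarrow> ('a, 'e) ttvec set"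
  where "horizontal_space A S w =
    {\<xi> \<in> tangent_space (slit_atlas A) w. canonical_connection A S \<xi> = \<xi>}"

definition vertical_part ::
  "('a, 'e::euclidean_space) atlas \<Rightarrow> ('a, 'e) tfield \<Rightarrow> ('a, 'e) ttvec \<Rightarrow> ('a, 'e) ttvec"
  where "vertical_part A S \<xi> = (THE \<eta>. \<eta> \<in> vertical_space A (fst \<xi>) \<and>
     \<xi> -\<^sub>T \<eta> \<in> horizontal_space A S (fst \<xi>))"

definition hlift ::
  "('a, 'e::euclidean_space) atlas \<Rightarrow> ('a, 'e) tfield \<Rightarrow> ('a, 'e) tvec \<Rightarrow> ('a, 'e) tvec \<Rightarrow>
   ('a, 'e) ttvec"
  where "hlift A S w = inv_into (horizontal_space A S w) (dpi A)"


section \<open>Linear connections on the vertical bundle\<close>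

text \<open>\<open>nabla \<xi> s\<close> is the covariant derivative in the direction of the single tangent vector \<open>\<xi>\<close> to the
  slit tangent bundle of a section \<open>s\<close> of the vertical bundle that is defined and smooth near the
  base point of \<open>\<xi>\<close>; it depends only on the germ of \<open>s\<close> there.\<close>

locale vertical_linear_connection =
  fixes A :: "('a, 'e::euclidean_space) atlas"
    and nabla :: "('a, 'e) ttvec \<Rightarrow> ('a, 'e) tfield \<Rightarrow> ('a, 'e) ttvec"
  assumes nabla_vertical:
    "\<And>D w \<xi> s. \<lbrakk>openin (mtop (slit_atlas A)) D; w \<in> D; vsmooth A D s;
        \<xi> \<in> tangent_space (slit_atlas A) w\<rbrakk> \<Longrightarrow> nabla \<xi> s \<in> vertical_space A w"
  and nabla_cong:
    "\<And>D w \<xi> s s'. \<lbrakk>openin (mtop (slit_atlas A)) D; w \<in> D; vsmooth A D s;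
        \<xi> \<in> tangent_space (slit_atlas A) w; \<And>z. z \<in> D \<Longrightarrow> s' z = s z\<rbrakk> \<Longrightarrow> nabla \<xi> s' = nabla \<xi> s"
  and nabla_add_dir:
    "\<And>D w \<xi> \<eta> s. \<lbrakk>openin (mtop (slit_atlas A)) D; w \<in> D; vsmooth A D s;
        \<xi> \<in> tangent_space (slit_atlas A) w; \<eta> \<in> tangent_space (slit_atlas A) w\<rbrakk> \<Longrightarrow>
      nabla (\<xi> +\<^sub>T \<eta>) s = nabla \<xi> s +\<^sub>T nabla \<eta> s"
  and nabla_scale_dir:
    "\<And>D w \<xi> r s. \<lbrakk>openin (mtop (slit_atlas A)) D; w \<in> D; vsmooth A D s;
        \<xi> \<in> tangent_space (slit_atlas A) w\<rbrakk> \<Longrightarrow> nabla (r *\<^sub>T \<xi>) s = r *\<^sub>T nabla \<xi> s"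
  and nabla_add:
    "\<And>D w \<xi> s s'. \<lbrakk>openin (mtop (slit_atlas A)) D; w \<in> D; vsmooth A D s; vsmooth A D s';
        \<xi> \<in> tangent_space (slit_atlas A) w\<rbrakk> \<Longrightarrow>
      nabla \<xi> (\<lambda>z. s z +\<^sub>T s' z) = nabla \<xi> s +\<^sub>T nabla \<xi> s'"
  and nabla_Leibniz:
    "\<And>D w \<xi> f s. \<lbrakk>openin (mtop (slit_atlas A)) D; w \<in> D; vsmooth A D s;
        smooth_fun (slit_atlas A) D f; \<xi> \<in> tangent_space (slit_atlas A) w\<rbrakk> \<Longrightarrow>
      nabla \<xi> (\<lambda>z. f z *\<^sub>T s z) = dir_deriv (slit_atlas A) \<xi> f *\<^sub>T s w +\<^sub>T f w *\<^sub>T nabla \<xi> s"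
  and nabla_smooth:
    "\<And>D X s. \<lbrakk>openin (mtop (slit_atlas A)) D; smooth_vf (slit_atlas A) D X; vsmooth A D s\<rbrakk> \<Longrightarrow>
      vsmooth A D (\<lambda>z. nabla (X z) s)"

type_synonym ('a, 'e) vconn = "('a, 'e) ttvec \<Rightarrow> ('a, 'e) tfield \<Rightarrow> ('a, 'e) ttvec"

definition lift_of ::
  "('a, 'e::euclidean_space) atlas \<Rightarrow> ('a, 'e) tfield \<Rightarrow> ('a, 'e) vconn \<Rightarrow> bool"
  where "lift_of A S nabla \<longleftrightarrow> vertical_linear_connection A nabla \<and>
    (\<forall>w\<in>slit A. \<forall>\<xi>\<in>tangent_space (slit_atlas A) w.
       nabla \<xi> (canonical_vf A) = vertical_part A S \<xi>)"

definition torsion ::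
  "('a, 'e::euclidean_space) atlas \<Rightarrow> ('a, 'e) vconn \<Rightarrow> ('a, 'e) tfield \<Rightarrow> ('a, 'e) tfield \<Rightarrow>
   ('a, 'e) tfield"
  where "torsion A nabla X Y w =
    nabla (X w) (\<lambda>z. vendo A (Y z)) -\<^sub>T nabla (Y w) (\<lambda>z. vendo A (X z))
    -\<^sub>T vendo A (lie_bracket (slit_atlas A) X Y w)"

definition curvature ::
  "('a, 'e::euclidean_space) atlas \<Rightarrow> ('a, 'e) vconn \<Rightarrow> ('a, 'e) tfield \<Rightarrow> ('a, 'e) tfield \<Rightarrow>
   ('a, 'e) tfield \<Rightarrow> ('a, 'e) tfield"
  where "curvature A nabla X Y s w =
    nabla (lie_bracket (slit_atlas A) X Y w) s
    -\<^sub>T (nabla (X w) (\<lambda>z. nabla (Y z) s) -\<^sub>T nabla (Y w) (\<lambda>z. nabla (X z) s))"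

text \<open>The curvature is tensorial, so \<open>u\<^sup>h\<close> may be replaced by a field extending it.\<close>

definition curvature_endo ::
  "('a, 'e::euclidean_space) atlas \<Rightarrow> ('a, 'e) tfield \<Rightarrow> ('a, 'e) vconn \<Rightarrow> ('a, 'e) tvec \<Rightarrow>
   ('a, 'e) tvec \<Rightarrow> ('a, 'e) tvec"
  where "curvature_endo A S nabla w u =
    ilift_inv A w (curvature A nabla S (local_ext (slit_atlas A) (hlift A S w u)) (canonical_vf A) w)"

definition vlift ::
  "('a, 'e::euclidean_space) atlas \<Rightarrow> ('a \<Rightarrow> ('a, 'e) tvec) \<Rightarrow> ('a, 'e) tfield"
  where "vlift A V z = ilift A z (V (fst z))"

definition dir_affine ::
  "('a, 'e::euclidean_space) atlas \<Rightarrow> ('a, 'e) tfield \<Rightarrow> ('a, 'e) vconn \<Rightarrow> ('a, 'e) tvec \<Rightarrow>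
   ('a, 'e) tvec \<Rightarrow> ('a \<Rightarrow> ('a, 'e) tvec) \<Rightarrow> ('a, 'e) tvec"
  where "dir_affine A S nabla w u V = ilift_inv A w (nabla (hlift A S w u) (vlift A V))"

definition affine_conn ::
  "('a, 'e::euclidean_space) atlas \<Rightarrow> ('a, 'e) tfield \<Rightarrow> ('a, 'e) vconn \<Rightarrow>
   ('a \<Rightarrow> ('a, 'e) tvec) \<Rightarrow> ('a \<Rightarrow> ('a, 'e) tvec) \<Rightarrow> ('a \<Rightarrow> ('a, 'e) tvec) \<Rightarrow>
   'a \<Rightarrow> ('a, 'e) tvec"
  where "affine_conn A S nabla W U V x = dir_affine A S nabla (W x) (U x) V"

end

theory Submission
  imports Defs
begin

text \<open>In the chart of the slit tangent bundle induced by a chart of \<open>M\<close>, the spray is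
  \<open>S(x, y) = (y, s(x, y))\<close>; with \<open>G(x, y)u = D s(x, y)(0, u) / 2\<close> the horizontal vectors are the
  pairs \<open>(u, G u)\<close>, and \<open>\<nabla>\<close> is \<open>D\<close> plus a connection form \<open>\<Lambda>\<close>.  Being a lift means
  \<open>\<Lambda>(\<xi>) y = - G \<xi>\<^sub>1\<close>, and the torsion condition amounts to \<open>\<Lambda>(S) u = - G u\<close>.  Hence
  \<open>D\<^sup>W\<^sub>U W = DW(U) - G U\<close> and \<open>D\<^sup>W\<^sub>W V = DV(W) - G V\<close>.  The remaining values of \<open>\<Lambda>\<close> enter the left-hand
  side only through \<open>D\<^sup>W\<^sub>U (D\<^sup>W\<^sub>W W)\<close>, where they are applied to \<open>D\<^sup>W\<^sub>W W\<close>, which vanishes at \<open>x\<^sub>0\<close> by the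
  geodesic equation.  By the symmetry of second derivatives both sides become
  \<open>DG(S) u - D s(u, 0) - G G u\<close>.\<close>

section \<open>Calculus of smooth maps\<close>

text \<open>The two conditions on \<open>nabla\<close> fix complementary parts of its connection
  form: being a lift fixes it on the position vector \<open>y\<close> in every direction, and the
  torsion condition fixes it in the direction \<open>S\<close> on every vector. Euler's relation
  \<open>G y = s\<close> makes \<open>S(w)\<close> the horizontal lift of \<open>w\<close>, so
  differentiating by D^W along \<open>W\<close> means using the direction \<open>S\<close>, while
  differentiating \<open>W\<close> itself means applying the form to \<open>y\<close>. All terms but
  one fall under one of these cases.

  The geodesic equation holds only along the integral curve. At the given point the value of D^W_W W
  vanishes, but its derivative in the direction \<open>U\<close> survives; the exceptional term
  contains only the value.

  Two difficulties come from the setting. Some tensorial objects are defined through arbitrarily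
  chosen extensions, so the computation must show that every derivative of the extension cancels.
  And the axioms of \<open>nabla\<close> apply to smooth sections only, so D^W_W W and D^W_U W must
  first be shown to be smooth fields; this is read off from coordinate formulas valid on a whole
  neighbourhood.\<close>

abbreviation FD :: "('a::real_normed_vector \<Rightarrow> 'b::real_normed_vector) \<Rightarrow> 'a \<Rightarrow> 'a \<Rightarrow> 'b"
  where "FD f x \<equiv> frechet_derivative f (at x)"

lemma FD_eqI: "(f has_derivative f') (at x) \<Longrightarrow> FD f x = f'"
  using frechet_derivative_at by metis

text \<open>No differentiability is assumed: \<open>frechet_derivative\<close> is a choice among the
  derivatives of a function at a point, and two functions that agree near the point have the same
  ones.\<close>

lemma FD_cong:
  assumes "open U" "x \<in> U" "\<And>y. y \<in> U \<Longrightarrow> f y = g y"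
  shows "FD f x = FD g x"
proof -
  have "(f has_derivative D) (at x) = (g has_derivative D) (at x)" for D
    using assms has_derivative_transform_within_open[of f D x UNIV U g]
      has_derivative_transform_within_open[of g D x UNIV U f] by auto
  then show ?thesis by (simp add: frechet_derivative_def)
qed

lemma differentiable_cong_open:
  assumes "open U" "x \<in> U" "\<And>y. y \<in> U \<Longrightarrow> f y = g y" "f differentiable at x"
  shows "g differentiable at x"
  using assms has_derivative_transform_within_open[of f _ x UNIV U g]
  unfolding differentiable_def by auto

lemma FD_linear: "f differentiable at x \<Longrightarrow> linear (FD f x)"
  using linear_frechet_derivative by blast

text \<open>\<open>Ck_on\<close> speaks only of derivatives in fixed directions. This expansion
  turns a derivative in a direction that moves with the point into a finite sum over fixed basis
  directions.\<close>

lemma linear_euclidean_expand: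
  fixes v :: "'a::euclidean_space"
  assumes "linear L" shows "L v = (\<Sum>b\<in>Basis. (v \<bullet> b) *\<^sub>R L b)"
proof -
  have "L v = L (\<Sum>b\<in>Basis. (v \<bullet> b) *\<^sub>R b)" by (simp add: euclidean_representation)
  also have "\<dots> = (\<Sum>b\<in>Basis. (v \<bullet> b) *\<^sub>R L b)"
    using assms by (simp add: linear_sum linear_scale)
  finally show ?thesis .
qed

section \<open>Closure properties of C^k and smooth maps\<close>

lemma Ck_on_cong:
  assumes "open U" "\<And>x. x \<in> U \<Longrightarrow> f x = g x"
  shows "Ck_on k U f \<longleftrightarrow> Ck_on k U g"
  using assms(2)
proof (induction k arbitrary: f g)
  case 0 then show ?case using continuous_on_cong by force
next
  case (Suc k)
  have "Ck_on k U (\<lambda>x. FD f x v) = Ck_on k U (\<lambda>x. FD g x v)" for v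
    using FD_cong[OF assms(1) _ Suc.prems] by (intro Suc.IH) auto
  moreover have "f differentiable at x \<longleftrightarrow> g differentiable at x" if "x \<in> U" for x
    using differentiable_cong_open[OF assms(1) that, of f g]
      differentiable_cong_open[OF assms(1) that, of g f] Suc.prems by auto
  ultimately show ?case by simp
qed

lemma Ck_on_subset: "Ck_on k U f \<Longrightarrow> V \<subseteq> U \<Longrightarrow> Ck_on k V f"
  by (induction k arbitrary: f) (auto intro: continuous_on_subset)

text \<open>Product and chain rule bring back undifferentiated factors; the inductions below need
  these at the lower order.\<close>

lemma Ck_on_SucD: "Ck_on (Suc k) U f \<Longrightarrow> Ck_on k U f"
proof (induction k arbitrary: f)
  case 0
  then show ?case by (auto intro!: continuous_at_imp_continuous_on differentiable_imp_continuous_within)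
next
  case (Suc k) then show ?case by (metis Ck_on.simps(2))
qed

lemma Ck_on_UN:
  assumes "\<And>i. i \<in> I \<Longrightarrow> open (V i)" "\<And>i. i \<in> I \<Longrightarrow> Ck_on k (V i) f"
  shows "Ck_on k (\<Union>i\<in>I. V i) f"
  using assms(2)
proof (induction k arbitrary: f)
  case 0 then show ?case using assms(1) by (auto intro!: continuous_on_open_UN)
next
  case (Suc k) then show ?case by (metis Ck_on.simps(2) UN_E)
qed

lemma Ck_on_const: "Ck_on k U (\<lambda>x. c)"
  by (induction k arbitrary: c) (auto simp: frechet_derivative_const)

lemma Ck_on_bounded_linear:
  assumes "bounded_linear L" shows "Ck_on k U L"
proof (cases k)
  case 0 then show ?thesis using assms
    by (simp add: bounded_linear.linear linear_continuous_on)
next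
  case (Suc n)
  have *: "(L has_derivative L) (at x)" for x
    using assms bounded_linear_imp_has_derivative by blast
  then have "L differentiable at x" "FD L x = L" for x
    using differentiable_def FD_eqI by blast+
  then show ?thesis using Suc by (simp add: Ck_on_const)
qed

lemma Ck_on_add: "Ck_on k U f \<Longrightarrow> Ck_on k U g \<Longrightarrow> open U \<Longrightarrow> Ck_on k U (\<lambda>x. f x + g x)"
proof (induction k arbitrary: f g)
  case 0 then show ?case by (auto intro: continuous_intros)
next
  case (Suc k)
  have "FD (\<lambda>x. f x + g x) x v = FD f x v + FD g x v" if "x \<in> U" for x v
    using that Suc.prems
    by (intro fun_cong[OF FD_eqI, THEN trans])
       (auto intro!: derivative_eq_intros simp: frechet_derivative_works)
  then have "Ck_on k U (\<lambda>x. FD (\<lambda>x. f x + g x) x v) = Ck_on k U (\<lambda>x. FD f x v + FD g x v)" for v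
    using Suc.prems by (intro Ck_on_cong) auto
  then show ?case using Suc by auto
qed

lemma Ck_on_sum:
  "(\<And>i. i \<in> I \<Longrightarrow> Ck_on k U (f i)) \<Longrightarrow> open U \<Longrightarrow> Ck_on k U (\<lambda>x. \<Sum>i\<in>I. f i x)"
  by (induction I rule: infinite_finite_induct) (auto simp: Ck_on_const Ck_on_add)

lemma Ck_on_scaleR:
  "Ck_on k U f \<Longrightarrow> Ck_on k U g \<Longrightarrow> open U \<Longrightarrow> Ck_on k U (\<lambda>x. f x *\<^sub>R g x)"
proof (induction k arbitrary: f g)
  case 0 then show ?case by (auto intro: continuous_intros)
next
  case (Suc k)
  have "FD (\<lambda>x. f x *\<^sub>R g x) x v = f x *\<^sub>R FD g x v + FD f x v *\<^sub>R g x" if "x \<in> U" for x v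
    using that Suc.prems
    by (intro fun_cong[OF FD_eqI, THEN trans])
       (auto intro!: derivative_eq_intros simp: frechet_derivative_works)
  then have "Ck_on k U (\<lambda>x. FD (\<lambda>x. f x *\<^sub>R g x) x v)
      = Ck_on k U (\<lambda>x. f x *\<^sub>R FD g x v + FD f x v *\<^sub>R g x)" for v
    using Suc.prems by (intro Ck_on_cong) auto
  moreover have "Ck_on k U (\<lambda>x. f x *\<^sub>R FD g x v + FD f x v *\<^sub>R g x)" for v
    using Suc.prems Ck_on_SucD[OF Suc.prems(1)] Ck_on_SucD[OF Suc.prems(2)]
    by (intro Ck_on_add Suc.IH) auto
  ultimately show ?case using Suc.prems by auto
qed

text \<open>By the chain rule the derivative of the composite is \<open>FD g\<close> at
  \<open>f x\<close> in the moving direction \<open>FD f x v\<close>. Expanded in the basis it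
  becomes a sum of products, where the induction hypothesis applies to the maps
  \<open>FD g _ b\<close> in place of \<open>g\<close>.\<close>

lemma Ck_on_compose:
  fixes f :: "'a::real_normed_vector \<Rightarrow> 'b::euclidean_space"
  shows "Ck_on k U f \<Longrightarrow> Ck_on k V g \<Longrightarrow> open U \<Longrightarrow> f ` U \<subseteq> V \<Longrightarrow> Ck_on k U (\<lambda>x. g (f x))"
proof (induction k arbitrary: g)
  case 0 then show ?case by (auto intro: continuous_on_compose2)
next
  case (Suc k)
  have D: "((\<lambda>x. g (f x)) has_derivative (\<lambda>v. FD g (f x) (FD f x v))) (at x)" if "x \<in> U" for x
    using that Suc.prems
    by (intro has_derivative_compose[of f _ x UNIV g]) (auto simp: frechet_derivative_works[symmetric])
  have lin: "linear (FD g (f x))" if "x \<in> U" for x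
    using that Suc.prems by (intro FD_linear) auto
  have "FD (\<lambda>x. g (f x)) x v = (\<Sum>b\<in>Basis. (FD f x v \<bullet> b) *\<^sub>R FD g (f x) b)" if "x \<in> U" for x v
    using FD_eqI[OF D[OF that]] linear_euclidean_expand[OF lin[OF that]] by metis
  then have "Ck_on k U (\<lambda>x. FD (\<lambda>x. g (f x)) x v)
      = Ck_on k U (\<lambda>x. \<Sum>b\<in>Basis. (FD f x v \<bullet> b) *\<^sub>R FD g (f x) b)" for v
    using Suc.prems by (intro Ck_on_cong) auto
  moreover have "Ck_on k U (\<lambda>x. \<Sum>b\<in>Basis. (FD f x v \<bullet> b) *\<^sub>R FD g (f x) b)" for v
  proof (intro Ck_on_sum Ck_on_scaleR Suc.prems(3))
    fix b :: 'b
    show "Ck_on k U (\<lambda>x. FD g (f x) b)"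
      using Suc.prems Ck_on_SucD[OF Suc.prems(1)] by (intro Suc.IH) auto
    \<comment> \<open>Taking the inner product with a fixed vector is itself a composition, hence an
      instance of the lemma being proved; it gets a separate induction.\<close>
    have inn: "Ck_on k U h \<Longrightarrow> Ck_on k U (\<lambda>x. h x \<bullet> b)" for h :: "'a \<Rightarrow> 'b" and k
    proof (induction k arbitrary: h)
      case 0 then show ?case by (auto intro: continuous_intros)
    next
      case (Suc k)
      have "FD (\<lambda>x. h x \<bullet> b) x v = FD h x v \<bullet> b" if "x \<in> U" for x v
        using that Suc.prems
        by (intro fun_cong[OF FD_eqI, THEN trans])
          (auto intro!: derivative_eq_intros simp: frechet_derivative_works)
      then have "Ck_on k U (\<lambda>x. FD (\<lambda>x. h x \<bullet> b) x v) = Ck_on k U (\<lambda>x. FD h x v \<bullet> b)" for v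
        using \<open>open U\<close> by (intro Ck_on_cong) auto
      then show ?case using Suc by auto
    qed
    show "Ck_on k U (\<lambda>x. FD f x v \<bullet> b)"
      using Suc.prems by (intro inn) auto
  qed
  moreover have "\<forall>x\<in>U. (\<lambda>x. g (f x)) differentiable at x"
    using D unfolding differentiable_def by blast
  ultimately show ?case by auto
qed

lemma smooth_on_cong: "open U \<Longrightarrow> (\<And>x. x \<in> U \<Longrightarrow> f x = g x) \<Longrightarrow> smooth_on U f \<longleftrightarrow> smooth_on U g"
  unfolding smooth_on_def using Ck_on_cong by blast

lemma smooth_on_subset: "smooth_on U f \<Longrightarrow> V \<subseteq> U \<Longrightarrow> smooth_on V f"
  unfolding smooth_on_def using Ck_on_subset by blast

lemma smooth_on_Un:
  assumes "open U" "open V" "smooth_on U f" "smooth_on V f"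
  shows "smooth_on (U \<union> V) f"
  using assms Ck_on_UN[of "{U,V}" "\<lambda>x. x" _ f] unfolding smooth_on_def by auto

lemma smooth_on_const[simp]: "smooth_on U (\<lambda>x. c)"
  by (simp add: smooth_on_def Ck_on_const)

lemma smooth_on_bounded_linear: "bounded_linear L \<Longrightarrow> smooth_on U L"
  by (simp add: smooth_on_def Ck_on_bounded_linear)

lemma smooth_on_compose:
  fixes f :: "'a::real_normed_vector \<Rightarrow> 'b::euclidean_space"
  shows "smooth_on U f \<Longrightarrow> smooth_on V g \<Longrightarrow> open U \<Longrightarrow> f ` U \<subseteq> V \<Longrightarrow> smooth_on U (\<lambda>x. g (f x))"
  unfolding smooth_on_def using Ck_on_compose by blast

lemma smooth_on_linear_compose:
  fixes f :: "'a::real_normed_vector \<Rightarrow> 'b::euclidean_space"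
  shows "smooth_on U f \<Longrightarrow> bounded_linear L \<Longrightarrow> open U \<Longrightarrow> smooth_on U (\<lambda>x. L (f x))"
  using smooth_on_compose[OF _ smooth_on_bounded_linear[of L UNIV]] by blast

lemma smooth_on_add: "smooth_on U f \<Longrightarrow> smooth_on U g \<Longrightarrow> open U \<Longrightarrow> smooth_on U (\<lambda>x. f x + g x)"
  unfolding smooth_on_def using Ck_on_add by blast

lemma smooth_on_scaleR:
  "smooth_on U f \<Longrightarrow> smooth_on U g \<Longrightarrow> open U \<Longrightarrow> smooth_on U (\<lambda>x. f x *\<^sub>R g x)"
  unfolding smooth_on_def using Ck_on_scaleR by blast

lemma smooth_on_diff:
  assumes "smooth_on U f" "smooth_on U g" "open U" shows "smooth_on U (\<lambda>x. f x - g x)"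
  using smooth_on_add[OF assms(1) smooth_on_scaleR[OF smooth_on_const[of U "-1"] assms(2,3)] assms(3)]
  by simp

lemma smooth_on_sum:
  "(\<And>i. i \<in> I \<Longrightarrow> smooth_on U (f i)) \<Longrightarrow> open U \<Longrightarrow> smooth_on U (\<lambda>x. \<Sum>i\<in>I. f i x)"
  unfolding smooth_on_def using Ck_on_sum[of I _ U f] by blast

lemma smooth_on_Pair:
  fixes f :: "'a::real_normed_vector \<Rightarrow> 'b::euclidean_space" and g :: "'a \<Rightarrow> 'c::euclidean_space"
  assumes "smooth_on U f" "smooth_on U g" "open U" shows "smooth_on U (\<lambda>x. (f x, g x))"
proof -
  have "bounded_linear (\<lambda>x::'b. (x, 0::'c))" "bounded_linear (\<lambda>y::'c. (0::'b, y))"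
    by (auto intro!: bounded_linear_Pair bounded_linear_ident)
  from smooth_on_add[OF smooth_on_linear_compose[OF assms(1) this(1) assms(3)]
      smooth_on_linear_compose[OF assms(2) this(2) assms(3)] assms(3)]
  show ?thesis by simp
qed

lemma smooth_on_fst:
  fixes f :: "'a::real_normed_vector \<Rightarrow> 'b::euclidean_space \<times> 'c::euclidean_space"
  shows "smooth_on U f \<Longrightarrow> open U \<Longrightarrow> smooth_on U (\<lambda>x. fst (f x))"
  using smooth_on_linear_compose[OF _ bounded_linear_fst] by blast

lemma smooth_on_snd:
  fixes f :: "'a::real_normed_vector \<Rightarrow> 'b::euclidean_space \<times> 'c::euclidean_space"
  shows "smooth_on U f \<Longrightarrow> open U \<Longrightarrow> smooth_on U (\<lambda>x. snd (f x))"
  using smooth_on_linear_compose[OF _ bounded_linear_snd] by blast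

lemma smooth_on_inner:
  fixes f :: "'a::real_normed_vector \<Rightarrow> 'b::euclidean_space"
  shows "smooth_on U f \<Longrightarrow> open U \<Longrightarrow> smooth_on U (\<lambda>x. f x \<bullet> b)"
  using smooth_on_linear_compose[OF _ bounded_linear_inner_left] by blast

lemma smooth_on_ident: "smooth_on U (\<lambda>x. x)"
  by (rule smooth_on_bounded_linear[OF bounded_linear_ident])

lemma smooth_on_differentiable: "smooth_on U f \<Longrightarrow> x \<in> U \<Longrightarrow> f differentiable at x"
  unfolding smooth_on_def using Ck_on.simps(2) by blast

lemma smooth_on_has_derivative: "smooth_on U f \<Longrightarrow> x \<in> U \<Longrightarrow> (f has_derivative FD f x) (at x)"
  using smooth_on_differentiable frechet_derivative_works by blast

lemma smooth_on_FD: "smooth_on U f \<Longrightarrow> smooth_on U (\<lambda>x. FD f x v)"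
  unfolding smooth_on_def using Ck_on.simps(2) by blast

lemma smooth_on_continuous: "smooth_on U f \<Longrightarrow> continuous_on U f"
  unfolding smooth_on_def by (meson Ck_on.simps(1))

text \<open>The form in which smoothness is used for geometry: components of a vector field in
  another chart, and coordinate changes of the tangent bundle, are derivatives along a moving
  direction.\<close>

lemma smooth_on_FD_compose:
  fixes f :: "'a::euclidean_space \<Rightarrow> 'b::euclidean_space"
    and g :: "'c::real_normed_vector \<Rightarrow> 'a"
  assumes "smooth_on U f" "smooth_on V g" "g ` V \<subseteq> U" "smooth_on V X" "open V"
  shows "smooth_on V (\<lambda>x. FD f (g x) (X x))"
proof -
  have *: "FD f (g x) (X x) = (\<Sum>b\<in>Basis. (X x \<bullet> b) *\<^sub>R FD f (g x) b)" if "x \<in> V" for x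
    using that assms smooth_on_differentiable
    by (intro linear_euclidean_expand FD_linear) blast
  have "smooth_on V (\<lambda>x. \<Sum>b\<in>Basis. (X x \<bullet> b) *\<^sub>R FD f (g x) b)"
    using assms smooth_on_compose[OF assms(2) smooth_on_FD[OF assms(1)]]
    by (intro smooth_on_sum smooth_on_scaleR smooth_on_inner) auto
  moreover have "smooth_on V (\<lambda>x. FD f (g x) (X x)) =
      smooth_on V (\<lambda>x. \<Sum>b\<in>Basis. (X x \<bullet> b) *\<^sub>R FD f (g x) b)"
    by (rule smooth_on_cong[OF assms(5) *])
  ultimately show ?thesis by blast
qed

text \<open>The product rule for \<open>FD f\<close> as a function of base point and direction, with
  the direction frozen at \<open>X x\<close> in the first summand. It is proved by differentiating
  the basis expansion and collecting the terms again.\<close>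

lemma has_derivative_FD_compose:
  fixes f :: "'a::euclidean_space \<Rightarrow> 'b::euclidean_space"
    and g :: "'c::real_normed_vector \<Rightarrow> 'a"
  assumes f: "smooth_on U f" "g x \<in> U" and g: "(g has_derivative g') (at x)"
    and X: "(X has_derivative X') (at x)" and U: "open U"
  shows "((\<lambda>x. FD f (g x) (X x)) has_derivative
     (\<lambda>h. FD (\<lambda>y. FD f y (X x)) (g x) (g' h) + FD f (g x) (X' h))) (at x)"
proof -
  have lin: "linear (FD f y)" if "y \<in> U" for y
    using that f smooth_on_differentiable by (intro FD_linear) blast
  have D: "((\<lambda>y. FD f y b) has_derivative FD (\<lambda>y. FD f y b) (g x)) (at (g x))" for b
    using f smooth_on_FD smooth_on_has_derivative by blast
  have Dg: "((\<lambda>x. FD f (g x) b) has_derivative (\<lambda>h. FD (\<lambda>y. FD f y b) (g x) (g' h))) (at x)" for b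
    using has_derivative_compose[OF g D] by simp
  have 1: "((\<lambda>x. \<Sum>b\<in>Basis. (X x \<bullet> b) *\<^sub>R FD f (g x) b) has_derivative
      (\<lambda>h. \<Sum>b\<in>Basis. (X x \<bullet> b) *\<^sub>R FD (\<lambda>y. FD f y b) (g x) (g' h) + (X' h \<bullet> b) *\<^sub>R FD f (g x) b)) (at x)"
    by (intro derivative_intros Dg X)
  have 2: "((\<lambda>y. \<Sum>b\<in>Basis. (X x \<bullet> b) *\<^sub>R FD f y b) has_derivative
      (\<lambda>h. \<Sum>b\<in>Basis. (X x \<bullet> b) *\<^sub>R FD (\<lambda>y. FD f y b) (g x) h)) (at (g x))"
    by (intro has_derivative_sum bounded_linear.has_derivative[OF bounded_linear_scaleR_right] D)
  have "FD (\<lambda>y. FD f y (X x)) (g x) = FD (\<lambda>y. \<Sum>b\<in>Basis. (X x \<bullet> b) *\<^sub>R FD f y b) (g x)"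
    by (rule FD_cong[OF U f(2)]) (rule linear_euclidean_expand[OF lin])
  also have "\<dots> = (\<lambda>h. \<Sum>b\<in>Basis. (X x \<bullet> b) *\<^sub>R FD (\<lambda>y. FD f y b) (g x) h)"
    using 2 by (rule FD_eqI)
  finally have 3: "FD (\<lambda>y. FD f y (X x)) (g x) =
      (\<lambda>h. \<Sum>b\<in>Basis. (X x \<bullet> b) *\<^sub>R FD (\<lambda>y. FD f y b) (g x) h)" .
  have 4: "(\<lambda>h. \<Sum>b\<in>Basis. (X x \<bullet> b) *\<^sub>R FD (\<lambda>y. FD f y b) (g x) (g' h) + (X' h \<bullet> b) *\<^sub>R FD f (g x) b)
     = (\<lambda>h. FD (\<lambda>y. FD f y (X x)) (g x) (g' h) + FD f (g x) (X' h))"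
    using linear_euclidean_expand[OF lin[OF f(2)], of "X' _"] by (simp add: 3 sum.distrib fun_eq_iff)
  \<comment> \<open>The basis expansion is available only where \<open>FD f\<close> is linear, that
    is on \<open>U\<close>; continuity keeps \<open>g\<close> in \<open>U\<close> near
    \<open>x\<close>.\<close>
  obtain e where "e > 0" "ball (g x) e \<subseteq> U" using U f(2) openE by blast
  moreover have "continuous (at x) g" using g has_derivative_continuous by blast
  ultimately obtain d where d: "d > 0" "\<And>z. dist z x < d \<Longrightarrow> g z \<in> U"
    unfolding continuous_at_eps_delta by (metis dist_commute in_mono mem_ball)
  show ?thesis
    using d linear_euclidean_expand[OF lin]
    by (intro has_derivative_transform_within[OF 1[unfolded 4], of d]) auto
qed

section \<open>Symmetry of second derivatives\<close>

text \<open>The second difference of \<open>f\<close> along \<open>u\<close> and \<open>v\<close> is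
  symmetric in the two vectors. Two applications of the mean value theorem, in either order, express
  it as the square of the step times one or the other mixed derivative at a point near
  \<open>x\<close>; continuity of both at \<open>x\<close> then contradicts a gap between
  them.\<close>

lemma second_derivative_symmetric_real:
  fixes f :: "'a::euclidean_space \<Rightarrow> real"
  assumes f: "smooth_on U f" and U: "open U" and x: "x \<in> U"
  shows "FD (\<lambda>y. FD f y u) x v = FD (\<lambda>y. FD f y v) x u"
proof (rule ccontr)
  assume ne: "\<not> ?thesis"
  have sym: "\<exists>y. norm (y - x) < d \<and>
      f (x + h *\<^sub>R u + h *\<^sub>R v) - f (x + h *\<^sub>R u) - f (x + h *\<^sub>R v) + f x
        = h\<^sup>2 * FD (\<lambda>y. FD f y u) y v"
    if h: "h > 0" "h * (norm u + norm v) < d" "ball x d \<subseteq> U" for u v h d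
  proof -
    have near: "norm (s *\<^sub>R u + t *\<^sub>R v) < d" if "0 \<le> s" "s \<le> h" "0 \<le> t" "t \<le> h" for s t
    proof -
      have "norm (s *\<^sub>R u + t *\<^sub>R v) \<le> s * norm u + t * norm v"
        using that norm_triangle_ineq[of "s *\<^sub>R u" "t *\<^sub>R v"] by simp
      also have "\<dots> \<le> h * norm u + h * norm v"
        using that by (intro add_mono mult_right_mono) auto
      finally show ?thesis using h by (simp add: algebra_simps)
    qed
    then have inU: "x + s *\<^sub>R u + t *\<^sub>R v \<in> U" if "0 \<le> s" "s \<le> h" "0 \<le> t" "t \<le> h" for s t
      using h(3) near[OF that] by (auto simp: subset_iff dist_norm norm_minus_commute add.assoc)
    \<comment> \<open>The difference in direction \<open>v\<close> alone, as a function of the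
      displacement along \<open>u\<close>. The summand \<open>0 *\<^sub>R v\<close> makes both terms
      instances of \<open>Df\<close>.\<close>
    define g where "g s = f (x + s *\<^sub>R u + h *\<^sub>R v) - f (x + s *\<^sub>R u + 0 *\<^sub>R v)" for s
    have Df: "((\<lambda>s. f (x + s *\<^sub>R u + t *\<^sub>R v)) has_derivative (\<lambda>r. r * FD f (x + s *\<^sub>R u + t *\<^sub>R v) u)) (at s)"
      if "0 \<le> s" "s \<le> h" "0 \<le> t" "t \<le> h" for s t
    proof -
      have "((\<lambda>s. f (x + s *\<^sub>R u + t *\<^sub>R v)) has_derivative (\<lambda>r. FD f (x + s *\<^sub>R u + t *\<^sub>R v) (r *\<^sub>R u))) (at s)"
        by (rule has_derivative_compose[where g=f and f="\<lambda>s. x + s *\<^sub>R u + t *\<^sub>R v", OF _ smooth_on_has_derivative[OF f inU[OF that]]])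
           (rule has_derivative_eq_rhs[OF has_derivative_add[OF has_derivative_add[OF has_derivative_const has_derivative_scaleR_left[OF has_derivative_ident]] has_derivative_const]], simp)
      then show ?thesis
        by (simp add: linear_scale[OF FD_linear[OF smooth_on_differentiable[OF f inU[OF that]]]])
    qed
    have "(g has_derivative (\<lambda>r. r * (FD f (x + s *\<^sub>R u + h *\<^sub>R v) u - FD f (x + s *\<^sub>R u + 0 *\<^sub>R v) u))) (at s)"
      if "0 \<le> s" "s \<le> h" for s
    proof -
      have "0 \<le> h" using h(1) by simp
      from has_derivative_diff[OF Df[OF that this order_refl] Df[OF that order_refl this]]
      show ?thesis unfolding g_def by (simp add: right_diff_distrib)
    qed
    note Dg = this
    have "\<exists>s\<in>{0<..<h}. g h - g 0 = (h - 0) * (FD f (x + s *\<^sub>R u + h *\<^sub>R v) u - FD f (x + s *\<^sub>R u + 0 *\<^sub>R v) u)"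
      by (rule mvt_simple[OF h(1) has_derivative_at_withinI[OF Dg]]) auto
    then obtain s where s: "0 < s" "s < h"
      and gs: "g h - g 0 = h * (FD f (x + s *\<^sub>R u + h *\<^sub>R v) u - FD f (x + s *\<^sub>R u + 0 *\<^sub>R v) u)"
      by auto
    let ?F = "\<lambda>y. FD f y u"
    have DF: "((\<lambda>t. ?F (x + s *\<^sub>R u + t *\<^sub>R v)) has_derivative (\<lambda>r. r * FD ?F (x + s *\<^sub>R u + t *\<^sub>R v) v)) (at t)"
      if "0 \<le> t" "t \<le> h" for t
    proof -
      have i: "x + s *\<^sub>R u + t *\<^sub>R v \<in> U" using s that by (intro inU) auto
      have "((\<lambda>t. ?F (x + s *\<^sub>R u + t *\<^sub>R v)) has_derivative (\<lambda>r. FD ?F (x + s *\<^sub>R u + t *\<^sub>R v) (r *\<^sub>R v))) (at t)"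
        by (rule has_derivative_compose[where g="?F" and f="\<lambda>t. x + s *\<^sub>R u + t *\<^sub>R v", OF _ smooth_on_has_derivative[OF smooth_on_FD[OF f] i]])
           (rule has_derivative_eq_rhs[OF has_derivative_add[OF has_derivative_const has_derivative_scaleR_left[OF has_derivative_ident]]], simp)
      then show ?thesis
        by (simp add: linear_scale[OF FD_linear[OF smooth_on_differentiable[OF smooth_on_FD[OF f] i]]])
    qed
    have "\<exists>t\<in>{0<..<h}. ?F (x + s *\<^sub>R u + h *\<^sub>R v) - ?F (x + s *\<^sub>R u + 0 *\<^sub>R v)
       = (h - 0) * FD ?F (x + s *\<^sub>R u + t *\<^sub>R v) v"
      by (rule mvt_simple[OF h(1) has_derivative_at_withinI[OF DF]]) auto
    then obtain t where t: "0 < t" "t < h" "?F (x + s *\<^sub>R u + h *\<^sub>R v) - ?F (x + s *\<^sub>R u + 0 *\<^sub>R v)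
       = h * FD ?F (x + s *\<^sub>R u + t *\<^sub>R v) v" by auto
    have "f (x + h *\<^sub>R u + h *\<^sub>R v) - f (x + h *\<^sub>R u) - f (x + h *\<^sub>R v) + f x = g h - g 0"
      by (simp add: g_def)
    also have "\<dots> = h\<^sup>2 * FD ?F (x + s *\<^sub>R u + t *\<^sub>R v) v"
      unfolding gs t(3) by (simp add: power2_eq_square)
    finally show ?thesis
      using near[of s t] s t by (intro exI[of _ "x + s *\<^sub>R u + t *\<^sub>R v"]) (auto simp: add.assoc)
  qed
  let ?a = "\<lambda>y. FD (\<lambda>y. FD f y u) y v" and ?b = "\<lambda>y. FD (\<lambda>y. FD f y v) y u"
  \<comment> \<open>Half of the assumed gap: two errors below \<open>e\<close> cannot bridge
    it.\<close>
  define e where "e = \<bar>?a x - ?b x\<bar> / 2"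
  have e: "e > 0" using ne by (simp add: e_def)
  have "continuous (at x) ?a" "continuous (at x) ?b"
    using U x smooth_on_continuous[OF smooth_on_FD[OF smooth_on_FD[OF f]]]
    by (auto simp: continuous_on_eq_continuous_at)
  then have "\<exists>d>0. \<forall>y. dist y x < d \<longrightarrow> dist (?a y) (?a x) < e"
    "\<exists>d>0. \<forall>y. dist y x < d \<longrightarrow> dist (?b y) (?b x) < e"
    using e unfolding continuous_at_eps_delta by blast+
  then obtain d1 d2 where d12: "d1 > 0" "d2 > 0" "\<And>y. dist y x < d1 \<Longrightarrow> dist (?a y) (?a x) < e"
     "\<And>y. dist y x < d2 \<Longrightarrow> dist (?b y) (?b x) < e"
    by blast
  obtain d3 where d3: "d3 > 0" "ball x d3 \<subseteq> U" using U x openE by blast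
  define d where "d = min d1 (min d2 d3)"
  have d: "d > 0" "ball x d \<subseteq> U" using d12 d3 by (auto simp: d_def)
  \<comment> \<open>The summand 1 keeps the denominator positive even for zero vectors and makes the
    bound on the displacement strict.\<close>
  define h where "h = d / (norm u + norm v + 1)"
  have np: "norm u + norm v + 1 > 0" by (smt (verit) norm_ge_zero)
  then have h: "h > 0" using d by (simp add: h_def)
  have "h * (norm u + norm v) < h * (norm u + norm v + 1)" using h by (intro mult_strict_left_mono) auto
  also have "\<dots> = d" using np by (simp add: h_def)
  finally have hd: "h * (norm u + norm v) < d" "h * (norm v + norm u) < d" by (auto simp: add.commute)
  obtain y where y: "norm (y - x) < d"
    "f (x + h *\<^sub>R u + h *\<^sub>R v) - f (x + h *\<^sub>R u) - f (x + h *\<^sub>R v) + f x = h\<^sup>2 * ?a y"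
    using sym[OF h hd(1) d(2)] by blast
  obtain z where z: "norm (z - x) < d"
    "f (x + h *\<^sub>R v + h *\<^sub>R u) - f (x + h *\<^sub>R v) - f (x + h *\<^sub>R u) + f x = h\<^sup>2 * ?b z"
    using sym[OF h hd(2) d(2)] by blast
  have "h\<^sup>2 * ?a y = h\<^sup>2 * ?b z" using y(2) z(2) by (simp add: algebra_simps)
  then have "?a y = ?b z" using h by simp
  moreover have "\<bar>?a y - ?a x\<bar> < e" "\<bar>?b z - ?b x\<bar> < e"
    using d12(3)[of y] d12(4)[of z] y z by (auto simp: d_def dist_norm)
  moreover have "\<bar>p - q\<bar> \<le> \<bar>r - p\<bar> + \<bar>r - q\<bar>" for p q r :: real by linarith
  from this[of "?a x" "?b x" "?a y"] have "2 * e \<le> \<bar>?a y - ?a x\<bar> + \<bar>?a y - ?b x\<bar>"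
    by (simp add: e_def)
  ultimately show False by simp
qed

lemma second_derivative_symmetric:
  fixes f :: "'a::euclidean_space \<Rightarrow> 'b::euclidean_space"
  assumes f: "smooth_on U f" and U: "open U" and x: "x \<in> U"
  shows "FD (\<lambda>y. FD f y u) x v = FD (\<lambda>y. FD f y v) x u"
proof (rule euclidean_eqI)
  fix b :: 'b
  have 1: "FD (\<lambda>y. f y \<bullet> b) y u = FD f y u \<bullet> b" if "y \<in> U" for y u
    by (intro fun_cong[OF FD_eqI, THEN trans])
       (auto intro!: derivative_eq_intros smooth_on_has_derivative[OF f that])
  have 2: "FD (\<lambda>y. FD (\<lambda>y. f y \<bullet> b) y u) x v = FD (\<lambda>y. FD f y u) x v \<bullet> b" for u v
  proof -
    have "FD (\<lambda>y. FD (\<lambda>y. f y \<bullet> b) y u) x v = FD (\<lambda>y. FD f y u \<bullet> b) x v"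
      using 1 by (intro fun_cong[OF FD_cong[OF U x]]) auto
    also have "\<dots> = FD (\<lambda>y. FD f y u) x v \<bullet> b"
      by (intro fun_cong[OF FD_eqI, THEN trans])
         (auto intro!: derivative_eq_intros smooth_on_has_derivative[OF smooth_on_FD[OF f] x])
    finally show ?thesis .
  qed
  show "FD (\<lambda>y. FD f y u) x v \<bullet> b = FD (\<lambda>y. FD f y v) x u \<bullet> b"
    using second_derivative_symmetric_real[OF smooth_on_inner[OF f U, of b] U x, of u v] by (simp add: 2)
qed

section \<open>Flat functions and bump functions\<close>

text \<open>For \<open>n = 0\<close> this is the classical function exp(-1/t), extended by 0. The
  powers of 1/t are included because the linear span of the whole family is closed under
  differentiation.\<close>

definition flat :: "nat \<Rightarrow> real \<Rightarrow> real"
  where "flat n t = (if t > 0 then inverse t ^ n * exp (- inverse t) else 0)"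

text \<open>With s = 1/t this is the convergence of s^n / exp s to 0 at infinity.\<close>

lemma flat_tendsto_0: "(flat n \<longlongrightarrow> 0) (at_right 0)"
proof -
  have "((\<lambda>t. inverse t ^ n / exp (inverse t)) \<longlongrightarrow> 0) (at_right (0::real))"
    using filterlim_compose[OF tendsto_power_div_exp_0 filterlim_inverse_at_top_right] by simp
  then show ?thesis
    by (rule Lim_transform_eventually)
       (simp add: eventually_at_filter flat_def exp_minus divide_inverse)
qed

lemma flat_has_field_derivative:
  "(flat n has_field_derivative flat (n + 2) t - real n * flat (n + 1) t) (at t)"
proof -
  consider "t > 0" | "t < 0" | "t = 0" by linarith
  then show ?thesis
  proof cases
    case 1
    have "((\<lambda>t. inverse t ^ n) has_field_derivative - (real n * inverse t ^ (n + 1))) (at t)"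
      by (rule DERIV_cong[OF DERIV_power[OF DERIV_inverse]]) (use 1 in \<open>cases n; simp\<close>)+
    moreover have "((\<lambda>t. exp (- inverse t)) has_field_derivative exp (- inverse t) * inverse t ^ 2) (at t)"
      by (rule DERIV_cong[OF DERIV_fun_exp[OF DERIV_minus[OF DERIV_inverse]]])
         (use 1 in \<open>simp_all add: power2_eq_square\<close>)
    ultimately have "((\<lambda>t. inverse t ^ n * exp (- inverse t)) has_field_derivative
        inverse t ^ (n+2) * exp (- inverse t) - real n * (inverse t ^ (n+1) * exp (- inverse t))) (at t)"
      by (rule DERIV_cong[OF DERIV_mult]) (simp add: power_add power2_eq_square)
    then have "(flat n has_field_derivative
        inverse t ^ (n+2) * exp (- inverse t) - real n * (inverse t ^ (n+1) * exp (- inverse t))) (at t)"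
      by (rule has_field_derivative_transform_within_open[OF _ open_greaterThan[of 0]])
         (use 1 in \<open>simp_all add: flat_def\<close>)
    then show ?thesis using 1 by (simp add: flat_def)
  next
    case 2
    have "(flat n has_field_derivative 0) (at t)"
      by (rule has_field_derivative_transform_within_open[OF DERIV_const[of 0] open_lessThan[of 0]])
         (use 2 in \<open>simp_all add: flat_def\<close>)
    then show ?thesis using 2 by (simp add: flat_def)
  next
    \<comment> \<open>At the origin the difference quotient is itself a member of the family: from
      the right \<open>flat n h / h\<close> equals \<open>flat (n + 1) h\<close>, and from the left
      it is 0.\<close>
    case 3
    have "\<forall>\<^sub>F h in at_right 0. flat (n + 1) h = flat n h / h"
      unfolding eventually_at_filter by (rule always_eventually) (simp add: flat_def divide_inverse)
    then have r: "((\<lambda>h. flat n h / h) \<longlongrightarrow> 0) (at_right 0)"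
      by (rule Lim_transform_eventually[OF flat_tendsto_0])
    have "\<forall>\<^sub>F h in at_left 0. 0 = flat n h / h"
      unfolding eventually_at_filter by (rule always_eventually) (simp add: flat_def)
    then have l: "((\<lambda>h. flat n h / h) \<longlongrightarrow> 0) (at_left 0)"
      by (rule Lim_transform_eventually[OF tendsto_const])
    have "((\<lambda>h. flat n h / h) \<longlongrightarrow> 0) (at 0)"
      by (rule filterlim_split_at[OF l r])
    moreover have "flat m 0 = 0" for m by (simp add: flat_def)
    ultimately show ?thesis unfolding 3 by (simp add: DERIV_def)
  qed
qed

text \<open>The induction must cover all \<open>n\<close> at once, since the derivative of
  \<open>flat n\<close> involves the indices \<open>n + 1\<close> and \<open>n + 2\<close>.\<close>

lemma Ck_on_flat: "Ck_on k UNIV (flat n)"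
proof (induction k arbitrary: n)
  case 0 then show ?case
    using DERIV_isCont[OF flat_has_field_derivative] by (simp add: continuous_at_imp_continuous_on)
next
  case (Suc k)
  have D: "(flat n has_derivative (\<lambda>v. v *\<^sub>R (flat (n + 2) t + (- real n) *\<^sub>R flat (n + 1) t))) (at t)" for t
    using flat_has_field_derivative[of n t] by (simp add: has_field_derivative_def mult_commute_abs)
  have "Ck_on k UNIV (\<lambda>x. FD (flat n) x v)" for v
    unfolding FD_eqI[OF D]
    by (rule Ck_on_scaleR[OF Ck_on_const Ck_on_add[OF Suc.IH
          Ck_on_scaleR[OF Ck_on_const Suc.IH open_UNIV] open_UNIV] open_UNIV])
  moreover have "flat n differentiable at x" for x
    using D unfolding differentiable_def by blast
  ultimately show ?case by simp
qed

lemma smooth_on_flat: "smooth_on UNIV (flat n)"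
  by (simp add: smooth_on_def Ck_on_flat)

lemma smooth_bump:
  fixes a :: "'a::euclidean_space"
  assumes "r > 0"
  obtains f :: "'a \<Rightarrow> real" where "smooth_on UNIV f" "f a \<noteq> 0" "\<And>x. x \<notin> cball a r \<Longrightarrow> f x = 0"
proof
  \<comment> \<open>The squared distance is smooth also at the centre, unlike the distance; its
    smoothness is read off from the sum of squared coordinates.\<close>
  let ?f = "\<lambda>x. flat 0 (r\<^sup>2 - (x - a) \<bullet> (x - a))"
  have sm: "smooth_on UNIV (\<lambda>x. x - a)"
    by (rule smooth_on_diff[OF smooth_on_ident smooth_on_const open_UNIV])
  have "smooth_on UNIV (\<lambda>x. \<Sum>b\<in>Basis. ((x - a) \<bullet> b) *\<^sub>R ((x - a) \<bullet> b))"
    by (intro smooth_on_sum smooth_on_scaleR smooth_on_inner sm open_UNIV)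
  then have "smooth_on UNIV (\<lambda>x. (x - a) \<bullet> (x - a))"
    using euclidean_inner[of "x - a" "x - a" for x] by simp
  then have "smooth_on UNIV (\<lambda>x. r\<^sup>2 - (x - a) \<bullet> (x - a))"
    by (rule smooth_on_diff[OF smooth_on_const _ open_UNIV])
  then show "smooth_on UNIV ?f"
    by (rule smooth_on_compose[OF _ smooth_on_flat]) auto
  show "?f a \<noteq> 0" using assms by (simp add: flat_def)
  fix x assume "x \<notin> cball a r"
  then have "r < norm (x - a)" by (simp add: dist_norm norm_minus_commute)
  then have "r\<^sup>2 \<le> (norm (x - a))\<^sup>2" using assms by (intro power_mono) auto
  then show "?f x = 0" by (simp add: flat_def power2_norm_eq_inner)
qed

section \<open>Charts, tangent vectors and vector fields\<close>

text \<open>A smooth atlas without the separation and countability axioms: the slit tangent bundle is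
  only needed in this generality.\<close>

locale smooth_atlas =
  fixes B :: "('a, 'e::euclidean_space) atlas"
  assumes chart_inj: "\<And>c. c \<in> B \<Longrightarrow> inj_on (snd c) (fst c)"
    and chart_open: "\<And>c d. c \<in> B \<Longrightarrow> d \<in> B \<Longrightarrow> open (snd c ` (fst c \<inter> fst d))"
    and transition_smooth: "\<And>c d. c \<in> B \<Longrightarrow> d \<in> B \<Longrightarrow>
      smooth_on (snd c ` (fst c \<inter> fst d)) (snd d \<circ> chart_inv c)"

lemma fst_tadd[simp]: "fst (v +\<^sub>T w) = fst v" by (simp add: tadd_def)
lemma snd_tadd[simp]: "snd (v +\<^sub>T w) c = snd v c + snd w c" by (simp add: tadd_def)
lemma fst_tdiff[simp]: "fst (v -\<^sub>T w) = fst v" by (simp add: tdiff_def)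
lemma snd_tdiff[simp]: "snd (v -\<^sub>T w) c = snd v c - snd w c" by (simp add: tdiff_def)
lemma fst_tscale[simp]: "fst (r *\<^sub>T v) = fst v" by (simp add: tscale_def)
lemma snd_tscale[simp]: "snd (r *\<^sub>T v) c = r *\<^sub>R snd v c" by (simp add: tscale_def)
lemma fst_tzero[simp]: "fst (tzero p) = p" by (simp add: tzero_def)
lemma snd_tzero[simp]: "snd (tzero p) c = 0" by (simp add: tzero_def)
lemma fst_lie_bracket[simp]: "fst (lie_bracket B X Y p) = p" by (simp add: lie_bracket_def)

text \<open>The inverse of reading off the components in the chart \<open>c\<close>. The value 0
  away from the charts around \<open>p\<close> is the normalization required by
  \<open>tangent_space\<close>.\<close>

definition tvec_of :: "('a, 'e::euclidean_space) atlas \<Rightarrow> ('a, 'e) chart \<Rightarrow> 'a \<Rightarrow> 'e \<Rightarrow> ('a, 'e) tvec"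
  where "tvec_of B c p a =
    (p, \<lambda>d. if d \<in> B \<and> p \<in> fst d then FD (snd d \<circ> chart_inv c) (snd c p) a else 0)"

lemma fst_tvec_of[simp]: "fst (tvec_of B c p a) = p" by (simp add: tvec_of_def)

context smooth_atlas
begin

lemma chart_inv_left[simp]: "c \<in> B \<Longrightarrow> p \<in> fst c \<Longrightarrow> chart_inv c (snd c p) = p"
  unfolding chart_inv_def using chart_inj by simp

lemma chart_inv_mem: "c \<in> B \<Longrightarrow> y \<in> snd c ` D \<Longrightarrow> D \<subseteq> fst c \<Longrightarrow> chart_inv c y \<in> D"
  by (auto simp: subset_iff)

lemma chart_inv_right: "c \<in> B \<Longrightarrow> y \<in> snd c ` D \<Longrightarrow> D \<subseteq> fst c \<Longrightarrow> snd c (chart_inv c y) = y"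
  by (auto simp: subset_iff)

lemma image_Int_chart:
  "c \<in> B \<Longrightarrow> D \<subseteq> fst c \<Longrightarrow> D' \<subseteq> fst c \<Longrightarrow> snd c ` (D \<inter> D') = snd c ` D \<inter> snd c ` D'"
  by (rule inj_on_image_Int[OF chart_inj])

text \<open>The manifold topology is known only through generating sets, hence an induction over its
  generation. Intersections use injectivity of the chart; generating sets use continuity of the
  coordinate changes.\<close>

lemma open_image:
  assumes "openin (mtop B) D" and c: "c \<in> B" shows "open (snd c ` (D \<inter> fst c))"
proof -
  have "generate_topology_on {fst c \<inter> snd c -` V | c V. c \<in> B \<and> open V} D"
    using assms by (simp add: mtop_def openin_topology_generated_by_iff)
  then show ?thesis
  proof induction
    case (Int a b)
    have "snd c ` (a \<inter> b \<inter> fst c) = snd c ` ((a \<inter> fst c) \<inter> (b \<inter> fst c))" by (auto intro!: arg_cong[where f="image (snd c)"])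
    also have "\<dots> = snd c ` (a \<inter> fst c) \<inter> snd c ` (b \<inter> fst c)"
      using c by (intro image_Int_chart) auto
    finally show ?case using Int by auto
  next
    case (UN K)
    have "snd c ` (\<Union> K \<inter> fst c) = (\<Union>k\<in>K. snd c ` (k \<inter> fst c))" by auto
    then show ?case using UN by auto
  next
    case (Basis s)
    then obtain k V where k: "s = fst k \<inter> snd k -` V" "k \<in> B" "open V" by auto
    have "snd c ` (s \<inter> fst c) = snd c ` (fst c \<inter> fst k) \<inter> (snd k \<circ> chart_inv c) -` V"
      using c k(1) by (auto simp: image_iff)
    moreover have "open \<dots>"
      using c k chart_open transition_smooth smooth_on_continuous continuous_open_preimage
      by blast
    ultimately show ?case by simp
  qed auto
qed

lemma openin_chartI:
  assumes "c \<in> B" "D \<subseteq> fst c" "open (snd c ` D)" shows "openin (mtop B) D"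
proof -
  have "fst c \<inter> snd c -` (snd c ` D) = D"
    using assms(2) by (auto dest!: inj_onD[OF chart_inj[OF assms(1)]])
  then have "D \<in> {fst c \<inter> snd c -` V | c V. c \<in> B \<and> open V}"
    using assms(1,3) by (intro CollectI exI[of _ c] exI[of _ "snd c ` D"]) simp
  then show ?thesis unfolding mtop_def by (rule topology_generated_by_Basis)
qed

lemma open_chart_image: "c \<in> B \<Longrightarrow> open (snd c ` fst c)"
  using chart_open[of c c] by simp

lemma openin_chart: "c \<in> B \<Longrightarrow> openin (mtop B) (fst c)"
  by (rule openin_chartI[OF _ order_refl open_chart_image])

lemma transition_differentiable:
  "c \<in> B \<Longrightarrow> d \<in> B \<Longrightarrow> p \<in> fst c \<Longrightarrow> p \<in> fst d \<Longrightarrow> (snd d \<circ> chart_inv c) differentiable at (snd c p)"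
  using transition_smooth smooth_on_differentiable by blast

text \<open>The chain rule on the triple overlap. It is what makes the family of components in
  \<open>tvec_of\<close> consistent.\<close>

lemma transition_cocycle:
  assumes "c \<in> B" "d \<in> B" "k \<in> B" "p \<in> fst c" "p \<in> fst d" "p \<in> fst k"
  shows "FD (snd k \<circ> chart_inv d) (snd d p) (FD (snd d \<circ> chart_inv c) (snd c p) v)
    = FD (snd k \<circ> chart_inv c) (snd c p) v"
proof -
  let ?U = "snd c ` (fst c \<inter> fst d \<inter> (fst c \<inter> fst k))"
  have "open (snd c ` (fst c \<inter> fst d) \<inter> snd c ` (fst c \<inter> fst k))"
    using chart_open[OF assms(1,2)] chart_open[OF assms(1,3)] by (rule open_Int)
  then have U: "open ?U" using image_Int_chart[OF assms(1), of "fst c \<inter> fst d" "fst c \<inter> fst k"] by simp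
  have "((snd k \<circ> chart_inv d) has_derivative FD (snd k \<circ> chart_inv d) (snd d p))
     (at ((snd d \<circ> chart_inv c) (snd c p)))"
    using assms transition_differentiable[of d k p] by (simp add: frechet_derivative_works)
  moreover have "((snd d \<circ> chart_inv c) has_derivative FD (snd d \<circ> chart_inv c) (snd c p)) (at (snd c p))"
    using assms transition_differentiable[of c d p] by (simp add: frechet_derivative_works)
  ultimately have "((\<lambda>x. (snd k \<circ> chart_inv d) ((snd d \<circ> chart_inv c) x)) has_derivative
      (\<lambda>v. FD (snd k \<circ> chart_inv d) (snd d p) (FD (snd d \<circ> chart_inv c) (snd c p) v))) (at (snd c p))"
    by (rule has_derivative_compose[rotated])
  then have "((snd k \<circ> chart_inv c) has_derivative
      (\<lambda>v. FD (snd k \<circ> chart_inv d) (snd d p) (FD (snd d \<circ> chart_inv c) (snd c p) v))) (at (snd c p))"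
    by (rule has_derivative_transform_within_open[OF _ U]) (use assms in auto)
  from FD_eqI[OF this] show ?thesis by simp
qed

lemma transition_self:
  assumes "c \<in> B" "p \<in> fst c" shows "FD (snd c \<circ> chart_inv c) (snd c p) v = v"
proof -
  have "FD (snd c \<circ> chart_inv c) (snd c p) = FD (\<lambda>x. x) (snd c p)"
    using assms by (intro FD_cong[OF open_chart_image]) auto
  then show ?thesis by simp
qed

lemma tangent_transition:
  assumes "v \<in> tangent_space B p" "c \<in> B" "d \<in> B" "p \<in> fst c" "p \<in> fst d"
  shows "snd v d = FD (snd d \<circ> chart_inv c) (snd c p) (snd v c)"
  using assms unfolding tangent_space_def by blast

lemma tangent_zero_chart: "v \<in> tangent_space B p \<Longrightarrow> c \<notin> B \<or> p \<notin> fst c \<Longrightarrow> snd v c = 0"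
  unfolding tangent_space_def by blast

lemma tangentI:
  assumes "fst v = p" "\<And>c. c \<notin> B \<or> p \<notin> fst c \<Longrightarrow> snd v c = 0"
    "\<And>c d. c \<in> B \<Longrightarrow> d \<in> B \<Longrightarrow> p \<in> fst c \<Longrightarrow> p \<in> fst d \<Longrightarrow>
      snd v d = FD (snd d \<circ> chart_inv c) (snd c p) (snd v c)"
  shows "v \<in> tangent_space B p"
  using assms unfolding tangent_space_def by blast

lemma tvec_of_in: "c \<in> B \<Longrightarrow> p \<in> fst c \<Longrightarrow> tvec_of B c p a \<in> tangent_space B p"
  by (rule tangentI) (auto simp: tvec_of_def transition_cocycle)

lemma snd_tvec_of[simp]: "c \<in> B \<Longrightarrow> p \<in> fst c \<Longrightarrow> snd (tvec_of B c p a) c = a"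
  by (simp add: tvec_of_def transition_self)

text \<open>This reduces every later identity of tangent vectors to one computation in one chart:
  the other components are determined by the coordinate changes or are 0 by convention.\<close>

lemma tangent_eqI:
  assumes "v \<in> tangent_space B p" "w \<in> tangent_space B p" "c \<in> B" "p \<in> fst c" "snd v c = snd w c"
  shows "v = w"
proof -
  have "snd v d = snd w d" for d
  proof (cases "d \<in> B \<and> p \<in> fst d")
    case True then show ?thesis
      using tangent_transition[of v p c d] tangent_transition[of w p c d] assms by simp
  next
    case False then show ?thesis
      using tangent_zero_chart[OF assms(1)] tangent_zero_chart[OF assms(2)] by metis
  qed
  moreover have "fst v = fst w" using assms(1,2) unfolding tangent_space_def by auto
  ultimately show ?thesis by (simp add: prod_eq_iff fun_eq_iff)
qed

lemma transition_linear:
  "c \<in> B \<Longrightarrow> d \<in> B \<Longrightarrow> p \<in> fst c \<Longrightarrow> p \<in> fst d \<Longrightarrow> linear (FD (snd d \<circ> chart_inv c) (snd c p))"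
  using transition_differentiable FD_linear by blast

lemma fst_tangent: "v \<in> tangent_space B p \<Longrightarrow> fst v = p"
  unfolding tangent_space_def by auto

lemma tadd_in:
  assumes v: "v \<in> tangent_space B p" and w: "w \<in> tangent_space B p"
  shows "v +\<^sub>T w \<in> tangent_space B p"
proof (rule tangentI)
  show "snd (v +\<^sub>T w) c = 0" if "c \<notin> B \<or> p \<notin> fst c" for c
    using tangent_zero_chart[OF v that] tangent_zero_chart[OF w that] by simp
  show "snd (v +\<^sub>T w) d = FD (snd d \<circ> chart_inv c) (snd c p) (snd (v +\<^sub>T w) c)"
    if "c \<in> B" "d \<in> B" "p \<in> fst c" "p \<in> fst d" for c d
    using tangent_transition[OF v that] tangent_transition[OF w that]
      linear_add[OF transition_linear[OF that]] by simp
qed (simp add: fst_tangent[OF v])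

lemma tscale_in:
  assumes v: "v \<in> tangent_space B p" shows "r *\<^sub>T v \<in> tangent_space B p"
proof (rule tangentI)
  show "snd (r *\<^sub>T v) c = 0" if "c \<notin> B \<or> p \<notin> fst c" for c
    using tangent_zero_chart[OF v that] by simp
  show "snd (r *\<^sub>T v) d = FD (snd d \<circ> chart_inv c) (snd c p) (snd (r *\<^sub>T v) c)"
    if "c \<in> B" "d \<in> B" "p \<in> fst c" "p \<in> fst d" for c d
    using tangent_transition[OF v that] linear_scale[OF transition_linear[OF that]] by simp
qed (simp add: fst_tangent[OF v])

lemma tdiff_in:
  assumes v: "v \<in> tangent_space B p" and w: "w \<in> tangent_space B p"
  shows "v -\<^sub>T w \<in> tangent_space B p"
proof -
  have "v -\<^sub>T w = v +\<^sub>T (-1) *\<^sub>T w" by (simp add: prod_eq_iff fun_eq_iff)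
  then show ?thesis using tadd_in[OF v tscale_in[OF w]] by simp
qed

lemma tzero_in: "tzero p \<in> tangent_space B p"
proof (rule tangentI)
  show "snd (tzero p) d = FD (snd d \<circ> chart_inv c) (snd c p) (snd (tzero p) c)"
    if "c \<in> B" "d \<in> B" "p \<in> fst c" "p \<in> fst d" for c d
    using linear_0[OF transition_linear[OF that]] by simp
qed simp_all

section \<open>Chart independence\<close>

lemma chart_at_props: "c \<in> B \<Longrightarrow> p \<in> fst c \<Longrightarrow> chart_at B p \<in> B \<and> p \<in> fst (chart_at B p)"
  unfolding chart_at_def by (rule someI2[of _ c]) auto

text \<open>\<open>dir_deriv\<close> and \<open>tangent_map\<close> are evaluated in the arbitrary
  chart picked by \<open>chart_at\<close>. The coordinate change between the charts is absorbed by
  the transformation rule of the tangent vector, so any convenient chart may be used.\<close>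

lemma FD_change_chart:
  assumes v: "v \<in> tangent_space B p" and c: "c \<in> B" "p \<in> fst c" and k: "k \<in> B" "p \<in> fst k"
    and D: "(f \<circ> chart_inv c) differentiable at (snd c p)"
  shows "FD (f \<circ> chart_inv k) (snd k p) (snd v k) = FD (f \<circ> chart_inv c) (snd c p) (snd v c)"
proof -
  have "((f \<circ> chart_inv c) has_derivative FD (f \<circ> chart_inv c) (snd c p))
     (at ((snd c \<circ> chart_inv k) (snd k p)))"
    using c k D by (simp add: frechet_derivative_works)
  moreover have "((snd c \<circ> chart_inv k) has_derivative FD (snd c \<circ> chart_inv k) (snd k p)) (at (snd k p))"
    using c k transition_differentiable[of k c p] by (simp add: frechet_derivative_works)
  ultimately have "((\<lambda>x. (f \<circ> chart_inv c) ((snd c \<circ> chart_inv k) x)) has_derivative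
      (\<lambda>v. FD (f \<circ> chart_inv c) (snd c p) (FD (snd c \<circ> chart_inv k) (snd k p) v))) (at (snd k p))"
    by (rule has_derivative_compose[rotated])
  then have "((f \<circ> chart_inv k) has_derivative
      (\<lambda>v. FD (f \<circ> chart_inv c) (snd c p) (FD (snd c \<circ> chart_inv k) (snd k p) v))) (at (snd k p))"
    by (rule has_derivative_transform_within_open[OF _ chart_open[OF k(1) c(1)]]) (use c k in auto)
  from FD_eqI[OF this] show ?thesis using tangent_transition[OF v k(1) c(1) k(2) c(2)] by simp
qed

lemma dir_deriv_chart:
  assumes v: "v \<in> tangent_space B p" and c: "c \<in> B" "p \<in> fst c"
    and D: "(f \<circ> chart_inv c) differentiable at (snd c p)"
  shows "dir_deriv B v f = FD (f \<circ> chart_inv c) (snd c p) (snd v c)"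
  using FD_change_chart[OF v c _ _ D] chart_at_props[OF c]
  by (simp add: dir_deriv_def Let_def fst_tangent[OF v])

text \<open>One chart containing \<open>D\<close> suffices, because the components in any other
  chart arise by applying the derivative of the smooth coordinate change.\<close>

lemma smooth_vf_chartI:
  assumes c: "c \<in> B" and D: "D \<subseteq> fst c" "open (snd c ` D)"
    and X: "\<And>p. p \<in> D \<Longrightarrow> X p \<in> tangent_space B p" "smooth_on (snd c ` D) (vf_rep c X)"
  shows "smooth_vf B D X"
  unfolding smooth_vf_def
proof (intro conjI ballI X(1))
  fix d assume d: "d \<in> B"
  let ?V = "snd d ` (D \<inter> fst d)"
  have oV: "open ?V" using open_image[OF openin_chartI[OF c D] d] .
  have tr: "smooth_on ?V (snd c \<circ> chart_inv d)"
    by (rule smooth_on_subset[OF transition_smooth[OF d c]]) (use D in auto)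
  have im: "(snd c \<circ> chart_inv d) ` ?V \<subseteq> snd c ` D"
    using d by auto
  have "smooth_on ?V (\<lambda>y. FD (snd d \<circ> chart_inv c) ((snd c \<circ> chart_inv d) y) (vf_rep c X ((snd c \<circ> chart_inv d) y)))"
    by (rule smooth_on_FD_compose[OF transition_smooth[OF c d] tr _
          smooth_on_compose[OF tr X(2) oV im] oV]) (use d D in auto)
  moreover have "vf_rep d X y = FD (snd d \<circ> chart_inv c) ((snd c \<circ> chart_inv d) y) (vf_rep c X ((snd c \<circ> chart_inv d) y))"
    if y: "y \<in> ?V" for y
  proof -
    obtain p where p: "p \<in> D" "p \<in> fst d" "y = snd d p" using y by auto
    then show ?thesis
      using tangent_transition[OF X(1), of p c d] c d D by (auto simp: vf_rep_def)
  qed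
  ultimately show "smooth_on ?V (vf_rep d X)"
    using smooth_on_cong[OF oV] by (metis (no_types, lifting))
qed auto

lemma smooth_vf_rep: "smooth_vf B D X \<Longrightarrow> c \<in> B \<Longrightarrow> smooth_on (snd c ` (D \<inter> fst c)) (vf_rep c X)"
  unfolding smooth_vf_def by blast

lemma smooth_vf_in: "smooth_vf B D X \<Longrightarrow> p \<in> D \<Longrightarrow> X p \<in> tangent_space B p"
  unfolding smooth_vf_def by blast

lemma smooth_vf_subset: "smooth_vf B D X \<Longrightarrow> D' \<subseteq> D \<Longrightarrow> smooth_vf B D' X"
  unfolding smooth_vf_def by (meson Int_mono image_mono order_refl smooth_on_subset subsetD)

lemma smooth_fun_chartI:
  assumes c: "c \<in> B" and D: "D \<subseteq> fst c" "open (snd c ` D)"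
    and f: "smooth_on (snd c ` D) (f \<circ> chart_inv c)"
  shows "smooth_fun B D f"
  unfolding smooth_fun_def
proof
  fix d assume d: "d \<in> B"
  let ?V = "snd d ` (D \<inter> fst d)"
  have oV: "open ?V" using open_image[OF openin_chartI[OF c D] d] .
  have tr: "smooth_on ?V (snd c \<circ> chart_inv d)"
    by (rule smooth_on_subset[OF transition_smooth[OF d c]]) (use D in auto)
  have "smooth_on ?V (\<lambda>y. (f \<circ> chart_inv c) ((snd c \<circ> chart_inv d) y))"
    by (rule smooth_on_compose[OF tr f oV]) (use d in auto)
  moreover have "(f \<circ> chart_inv d) y = (f \<circ> chart_inv c) ((snd c \<circ> chart_inv d) y)" if "y \<in> ?V" for y
    using that c d D by auto
  ultimately show "smooth_on ?V (f \<circ> chart_inv d)"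
    using smooth_on_cong[OF oV] by (metis (no_types, lifting))
qed

lemma tvec_of_smooth:
  assumes "c \<in> B" shows "smooth_vf B (fst c) (\<lambda>p. tvec_of B c p a)"
proof (rule smooth_vf_chartI[OF assms order_refl open_chart_image[OF assms] tvec_of_in[OF assms]])
  show "smooth_on (snd c ` fst c) (vf_rep c (\<lambda>p. tvec_of B c p a))"
    using assms by (subst smooth_on_cong[OF open_chart_image, of _ _ "\<lambda>x. a"]) (auto simp: vf_rep_def)
qed

text \<open>The field with constant components in a chart witnesses that the choice in
  \<open>local_ext\<close> succeeds. Only the properties listed here are used of the chosen
  field.\<close>

lemma local_ext_props:
  assumes "v \<in> tangent_space B p" "c \<in> B" "p \<in> fst c"
  obtains D where "openin (mtop B) D" "p \<in> D" "smooth_vf B D (local_ext B v)" "local_ext B v p = v"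
proof -
  have "tvec_of B c p (snd v c) = v"
    using assms by (intro tangent_eqI[OF tvec_of_in]) auto
  then have "\<exists>Y. Y (fst v) = v \<and> (\<exists>D. openin (mtop B) D \<and> fst v \<in> D \<and> smooth_vf B D Y)"
    using openin_chart[OF assms(2)] tvec_of_smooth[OF assms(2)] fst_tangent[OF assms(1)] assms(3)
    by (intro exI[of _ "\<lambda>q. tvec_of B c q (snd v c)"] conjI exI[of _ "fst c"]) simp_all
  from someI_ex[OF this] have "local_ext B v p = v \<and>
      (\<exists>D. openin (mtop B) D \<and> p \<in> D \<and> smooth_vf B D (local_ext B v))"
    by (simp add: local_ext_def fst_tangent[OF assms(1)])
  then show ?thesis using that by blast
qed

section \<open>The Lie bracket\<close>

text \<open>Differentiating the transformation rule of a field produces a term with the second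
  derivative of the coordinate change. In the bracket two such terms occur with the roles of
  \<open>X\<close> and \<open>Y\<close> exchanged, and they cancel by symmetry.\<close>

lemma lie_bracket_in:
  assumes oD: "openin (mtop B) D" and X: "smooth_vf B D X" and Y: "smooth_vf B D Y" and p: "p \<in> D"
  shows "lie_bracket B X Y p \<in> tangent_space B p"
proof -
  have main: "FD (vf_rep d Y) (snd d p) (snd (X p) d) =
      FD (\<lambda>y. FD (snd d \<circ> chart_inv c) y (snd (Y p) c)) (snd c p) (snd (X p) c)
      + FD (snd d \<circ> chart_inv c) (snd c p) (FD (vf_rep c Y) (snd c p) (snd (X p) c))"
    if c: "c \<in> B" "p \<in> fst c" and d: "d \<in> B" "p \<in> fst d"
      and X: "smooth_vf B D X" and Y: "smooth_vf B D Y" for c d X Y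
  proof -
    let ?\<tau> = "snd d \<circ> chart_inv c" and ?x = "snd c p"
    let ?O = "snd c ` ((D \<inter> fst c) \<inter> (fst c \<inter> fst d))"
    have oO: "open ?O"
      unfolding image_Int_chart[OF c(1) Int_lower2 Int_lower1]
      by (rule open_Int[OF open_image[OF oD c(1)] chart_open[OF c(1) d(1)]])
    have x: "?x \<in> ?O" using c d p by simp
    have D\<tau>: "(?\<tau> has_derivative FD ?\<tau> ?x) (at ?x)"
      using transition_differentiable[OF c(1) d(1) c(2) d(2)] by (simp add: frechet_derivative_works)
    have DY: "(vf_rep c Y has_derivative FD (vf_rep c Y) ?x) (at ?x)"
      using c p by (intro smooth_on_has_derivative[OF smooth_vf_rep[OF Y c(1)]]) simp
    have DYd: "(vf_rep d Y has_derivative FD (vf_rep d Y) (snd d p)) (at (?\<tau> ?x))"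
    proof -
      have "snd d p \<in> snd d ` (D \<inter> fst d)" using d p by simp
      from smooth_on_has_derivative[OF smooth_vf_rep[OF Y d(1)] this] show ?thesis using c by simp
    qed
    have 1: "((\<lambda>x. vf_rep d Y (?\<tau> x)) has_derivative (\<lambda>h. FD (vf_rep d Y) (snd d p) (FD ?\<tau> ?x h))) (at ?x)"
      by (rule has_derivative_compose[OF D\<tau> DYd])
    have 2: "((\<lambda>x. FD ?\<tau> x (vf_rep c Y x)) has_derivative
       (\<lambda>h. FD (\<lambda>y. FD ?\<tau> y (vf_rep c Y ?x)) ?x h + FD ?\<tau> ?x (FD (vf_rep c Y) ?x h))) (at ?x)"
      by (rule has_derivative_FD_compose[OF transition_smooth[OF c(1) d(1)] _ has_derivative_ident DY chart_open[OF c(1) d(1)]])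
         (use c d in simp)
    have 3: "vf_rep d Y (?\<tau> x) = FD ?\<tau> x (vf_rep c Y x)" if xO: "x \<in> ?O" for x
    proof -
      obtain q where q: "q \<in> D" "q \<in> fst c" "q \<in> fst d" "x = snd c q" using xO by auto
      then show ?thesis
        using tangent_transition[OF smooth_vf_in[OF Y q(1)] c(1) d(1) q(2,3)] c d
        by (simp add: vf_rep_def)
    qed
    have "(\<lambda>h. FD (vf_rep d Y) (snd d p) (FD ?\<tau> ?x h)) =
       (\<lambda>h. FD (\<lambda>y. FD ?\<tau> y (vf_rep c Y ?x)) ?x h + FD ?\<tau> ?x (FD (vf_rep c Y) ?x h))"
      by (rule has_derivative_unique[OF has_derivative_transform_within_open[OF 1 oO x 3] 2])
    from fun_cong[OF this, of "snd (X p) c"] show ?thesis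
      using tangent_transition[OF smooth_vf_in[OF X p] c(1) d(1) c(2) d(2)] c
      by (simp add: vf_rep_def)
  qed
  have "snd (lie_bracket B X Y p) d = FD (snd d \<circ> chart_inv c) (snd c p) (snd (lie_bracket B X Y p) c)"
    if c: "c \<in> B" "p \<in> fst c" and d: "d \<in> B" "p \<in> fst d" for c d
  proof -
    have sym: "FD (\<lambda>y. FD (snd d \<circ> chart_inv c) y (snd (Y p) c)) (snd c p) (snd (X p) c)
       = FD (\<lambda>y. FD (snd d \<circ> chart_inv c) y (snd (X p) c)) (snd c p) (snd (Y p) c)"
      by (rule second_derivative_symmetric[OF transition_smooth[OF c(1) d(1)] chart_open[OF c(1) d(1)]])
         (use c d in simp)
    have "snd (lie_bracket B X Y p) d = FD (vf_rep d Y) (snd d p) (snd (X p) d) - FD (vf_rep d X) (snd d p) (snd (Y p) d)"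
      using d by (simp add: lie_bracket_def)
    also have "\<dots> = FD (snd d \<circ> chart_inv c) (snd c p) (FD (vf_rep c Y) (snd c p) (snd (X p) c))
        - FD (snd d \<circ> chart_inv c) (snd c p) (FD (vf_rep c X) (snd c p) (snd (Y p) c))"
      unfolding main[OF c d X Y] main[OF c d Y X] sym by simp
    also have "\<dots> = FD (snd d \<circ> chart_inv c) (snd c p) (snd (lie_bracket B X Y p) c)"
      unfolding linear_diff[OF transition_linear[OF c(1) d(1) c(2) d(2)], symmetric]
      using c by (simp add: lie_bracket_def)
    finally show ?thesis .
  qed
  moreover have "snd (lie_bracket B X Y p) c = 0" if "c \<notin> B \<or> p \<notin> fst c" for c
    using that by (auto simp: lie_bracket_def)
  ultimately show ?thesis by (rule tangentI[OF fst_lie_bracket, rotated])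
qed

section \<open>Gluing fields and cutting off in a chart\<close>

lemma smooth_vf_cong:
  assumes oD: "openin (mtop B) D" and X: "smooth_vf B D X" and eq: "\<And>p. p \<in> D \<Longrightarrow> Y p = X p"
  shows "smooth_vf B D Y"
  unfolding smooth_vf_def
proof (intro conjI ballI)
  show "Y p \<in> tangent_space B p" if "p \<in> D" for p using smooth_vf_in[OF X that] eq[OF that] by simp
  fix c assume c: "c \<in> B"
  have "vf_rep c Y z = vf_rep c X z" if "z \<in> snd c ` (D \<inter> fst c)" for z
    using eq chart_inv_mem[OF c that] by (simp add: vf_rep_def)
  then show "smooth_on (snd c ` (D \<inter> fst c)) (vf_rep c Y)"
    using smooth_on_cong[OF open_image[OF oD c]] smooth_vf_rep[OF X c] by blast
qed

lemma smooth_vf_Un: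
  assumes D: "openin (mtop B) D" "openin (mtop B) D'" and X: "smooth_vf B D X" "smooth_vf B D' X"
  shows "smooth_vf B (D \<union> D') X"
  unfolding smooth_vf_def
proof (intro conjI ballI)
  show "X p \<in> tangent_space B p" if "p \<in> D \<union> D'" for p
    using that smooth_vf_in[OF X(1)] smooth_vf_in[OF X(2)] by blast
  fix c assume c: "c \<in> B"
  have "snd c ` ((D \<union> D') \<inter> fst c) = snd c ` (D \<inter> fst c) \<union> snd c ` (D' \<inter> fst c)" by blast
  then show "smooth_on (snd c ` ((D \<union> D') \<inter> fst c)) (vf_rep c X)"
    using smooth_on_Un[OF open_image[OF D(1) c] open_image[OF D(2) c]
        smooth_vf_rep[OF X(1) c] smooth_vf_rep[OF X(2) c]] by simp
qed

lemma smooth_vf_tzero: "openin (mtop B) D \<Longrightarrow> smooth_vf B D tzero"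
  unfolding smooth_vf_def by (simp add: tzero_in vf_rep_def)

lemma topspace_chart:
  assumes "x \<in> topspace (mtop B)" shows "\<exists>c\<in>B. x \<in> fst c"
  using assms by (force simp: mtop_def topology_generated_by_topspace)

text \<open>A closed coordinate ball gives a compact set in the manifold, which is closed by the
  Hausdorff property; \<open>N\<close> is its complement. A local field multiplied by
  \<open>f\<close> thus vanishes on the overlap with \<open>N\<close> and extends by zero.\<close>

lemma chart_bump:
  assumes H: "Hausdorff_space (mtop B)" and c: "c \<in> B" and p: "p \<in> fst c"
  obtains f :: "'e \<Rightarrow> real" and N where "smooth_on UNIV f" "f (snd c p) \<noteq> 0" "openin (mtop B) N"
    "topspace (mtop B) \<subseteq> fst c \<union> N" "\<And>q. q \<in> fst c \<inter> N \<Longrightarrow> f (snd c q) = 0"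
proof -
  obtain r where r: "r > 0" "cball (snd c p) r \<subseteq> snd c ` fst c"
    using open_chart_image[OF c] p open_contains_cball by blast
  obtain f :: "'e \<Rightarrow> real" where f: "smooth_on UNIV f" "f (snd c p) \<noteq> 0"
    and f0: "\<And>x. x \<notin> cball (snd c p) r \<Longrightarrow> f x = 0"
    using smooth_bump[OF r(1), of "snd c p"] by blast
  define K where "K = chart_inv c ` cball (snd c p) r"
  have cont: "continuous_map (top_of_set (snd c ` fst c)) (mtop B) (chart_inv c)"
    unfolding continuous_map_def
  proof (intro conjI allI impI)
    show "chart_inv c \<in> topspace (top_of_set (snd c ` fst c)) \<rightarrow> topspace (mtop B)"
      using chart_inv_mem[OF c _ order_refl] openin_subset[OF openin_chart[OF c]] by auto
    fix V assume V: "openin (mtop B) V"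
    have "{x \<in> topspace (top_of_set (snd c ` fst c)). chart_inv c x \<in> V} = snd c ` (V \<inter> fst c)"
      using c by auto
    then show "openin (top_of_set (snd c ` fst c)) {x \<in> topspace (top_of_set (snd c ` fst c)). chart_inv c x \<in> V}"
      using open_image[OF V c] by (simp add: open_subset image_mono)
  qed
  have "compactin (top_of_set (snd c ` fst c)) (cball (snd c p) r)"
    using r(2) by (simp add: compactin_subtopology)
  from image_compactin[OF this cont] have "closedin (mtop B) K"
    unfolding K_def by (rule compactin_imp_closedin[OF H])
  then have N: "openin (mtop B) (topspace (mtop B) - K)" by blast
  have "K \<subseteq> fst c"
    using chart_inv_mem[OF c _ order_refl] r(2) by (auto simp: K_def)
  moreover have "f (snd c q) = 0" if "q \<in> fst c \<inter> (topspace (mtop B) - K)" for q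
  proof (rule f0)
    have "chart_inv c (snd c q) = q" using that c by simp
    then show "snd c q \<notin> cball (snd c p) r" using that unfolding K_def by (metis DiffD2 IntD2 imageI)
  qed
  ultimately show ?thesis using that[OF f N] by blast
qed

end

section \<open>The slit tangent bundle\<close>

context smooth_atlas
begin

lemma mem_slit_chart: "w \<in> fst (slit_chart B c) \<longleftrightarrow> w \<in> slit B \<and> fst w \<in> fst c"
  by (simp add: slit_chart_def)

lemma snd_slit_chart: "snd (slit_chart B c) w = (snd c (fst w), snd w c)"
  by (simp add: slit_chart_def)

lemma slit_tangent: "w \<in> slit B \<Longrightarrow> w \<in> tangent_space B (fst w)"
  unfolding slit_def using fst_tangent by fastforce

lemma slit_nonzero:
  assumes "w \<in> slit B" "c \<in> B" "fst w \<in> fst c" shows "snd w c \<noteq> 0"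
proof
  assume "snd w c = 0"
  then have "w = tzero (fst w)"
    using assms by (intro tangent_eqI[OF slit_tangent tzero_in]) auto
  then show False using assms(1) unfolding slit_def using fst_tangent by fastforce
qed

lemma tvec_of_slit:
  assumes "c \<in> B" "p \<in> fst c" "y \<noteq> 0" shows "tvec_of B c p y \<in> slit B"
proof -
  have "tvec_of B c p y \<noteq> tzero p"
    using assms(3) snd_tvec_of[OF assms(1,2), of y] by auto
  then show ?thesis
    using assms tvec_of_in[OF assms(1,2), of y] by (auto simp: slit_def carrier_of_def)
qed

lemma tvec_of_slit_chart:
  assumes "c \<in> B" "p \<in> fst c" "y \<noteq> 0"
  shows "tvec_of B c p y \<in> fst (slit_chart B c)"
    "snd (slit_chart B c) (tvec_of B c p y) = (snd c p, y)"
  using assms tvec_of_slit by (simp_all add: mem_slit_chart snd_slit_chart)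

lemma image_slit_chart:
  assumes "c \<in> B" "D \<subseteq> fst c"
  shows "snd (slit_chart B c) ` {w \<in> slit B. fst w \<in> D} = snd c ` D \<times> - {0}"
proof (intro equalityI subsetI)
  fix z :: "'e \<times> 'e" assume "z \<in> snd c ` D \<times> - {0}"
  then have "fst z \<in> snd c ` D" "snd z \<noteq> 0" by (simp_all add: mem_Times_iff)
  then obtain p where p: "p \<in> D" "fst z = snd c p" "snd z \<noteq> 0" by blast
  have pc: "p \<in> fst c" using p(1) assms(2) by blast
  show "z \<in> snd (slit_chart B c) ` {w \<in> slit B. fst w \<in> D}"
  proof (rule image_eqI)
    show "z = snd (slit_chart B c) (tvec_of B c p (snd z))"
      using tvec_of_slit_chart(2)[OF assms(1) pc p(3)] p(2) by (simp add: prod_eq_iff)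
    show "tvec_of B c p (snd z) \<in> {w \<in> slit B. fst w \<in> D}"
      using tvec_of_slit[OF assms(1) pc p(3)] p(1) by simp
  qed
next
  fix z assume "z \<in> snd (slit_chart B c) ` {w \<in> slit B. fst w \<in> D}"
  then obtain w where w: "w \<in> slit B" "fst w \<in> D" "z = (snd c (fst w), snd w c)"
    unfolding snd_slit_chart by blast
  then show "z \<in> snd c ` D \<times> - {0}" using slit_nonzero[OF w(1) assms(1)] assms(2) by blast
qed

lemma slit_chart_Int:
  "fst (slit_chart B c) \<inter> fst (slit_chart B d) = {w \<in> slit B. fst w \<in> fst c \<inter> fst d}"
  by (auto simp: mem_slit_chart)

lemma inj_slit_chart: "c \<in> B \<Longrightarrow> inj_on (snd (slit_chart B c)) (fst (slit_chart B c))"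
proof (rule inj_onI)
  fix w w' assume c: "c \<in> B" and w: "w \<in> fst (slit_chart B c)" "w' \<in> fst (slit_chart B c)"
    and eq: "snd (slit_chart B c) w = snd (slit_chart B c) w'"
  have p: "fst w = fst w'"
    using eq w inj_onD[OF chart_inj[OF c]] by (simp add: mem_slit_chart snd_slit_chart)
  have "w' \<in> tangent_space B (fst w)"
    using w slit_tangent[of w'] by (simp add: p mem_slit_chart)
  then show "w = w'"
    using eq w c slit_tangent[of w]
    by (intro tangent_eqI[of w "fst w" w' c]) (simp_all add: mem_slit_chart snd_slit_chart)
qed

lemma chart_inv_slit:
  assumes "c \<in> B" "w \<in> fst (slit_chart B c)"
  shows "chart_inv (slit_chart B c) (snd (slit_chart B c) w) = w"
  unfolding chart_inv_def using inj_slit_chart[OF assms(1)] assms(2) by simp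

lemma slit_transition:
  assumes c: "c \<in> B" and d: "d \<in> B" and z: "z \<in> snd c ` (fst c \<inter> fst d) \<times> - {0}"
  shows "(snd (slit_chart B d) \<circ> chart_inv (slit_chart B c)) z =
     ((snd d \<circ> chart_inv c) (fst z), FD (snd d \<circ> chart_inv c) (fst z) (snd z))"
proof -
  have "z \<in> snd (slit_chart B c) ` {w \<in> slit B. fst w \<in> fst c \<inter> fst d}"
    using z image_slit_chart[OF c, of "fst c \<inter> fst d"] by simp
  then obtain w where w: "w \<in> slit B" "fst w \<in> fst c" "fst w \<in> fst d" "z = snd (slit_chart B c) w"
    by blast
  then have "chart_inv (slit_chart B c) z = w" using chart_inv_slit[OF c] by (simp add: mem_slit_chart)
  then show ?thesis
    using w c d tangent_transition[OF slit_tangent[OF w(1)] c d] by (simp add: snd_slit_chart)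
qed

text \<open>The derivative is block triangular. The first component of \<open>h\<close> transforms
  like a vector on the base, which makes \<open>dpi\<close> well defined; and if it is 0, the second
  transforms in the same way, which makes the vertical lift well defined.\<close>

lemma slit_transition_has_derivative:
  assumes c: "c \<in> B" and d: "d \<in> B" and z: "z \<in> snd c ` (fst c \<inter> fst d) \<times> - {0}"
  defines "t \<equiv> snd d \<circ> chart_inv c"
  shows "((snd (slit_chart B d) \<circ> chart_inv (slit_chart B c)) has_derivative
     (\<lambda>h. (FD t (fst z) (fst h),
       FD (\<lambda>x. FD t x (snd z)) (fst z) (fst h) + FD t (fst z) (snd h)))) (at z)"
proof -
  have o: "open (snd c ` (fst c \<inter> fst d) \<times> - {0::'e})"
    using chart_open[OF c d] by (intro open_Times) auto
  have fz: "fst z \<in> snd c ` (fst c \<inter> fst d)" using z by auto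
  have t: "smooth_on (snd c ` (fst c \<inter> fst d)) t"
    unfolding t_def by (rule transition_smooth[OF c d])
  have f: "(fst has_derivative fst) (at z)" and s: "(snd has_derivative snd) (at z)"
    by (simp_all add: bounded_linear_fst bounded_linear_snd bounded_linear_imp_has_derivative)
  have "((\<lambda>z. (t (fst z), FD t (fst z) (snd z))) has_derivative
     (\<lambda>h. (FD t (fst z) (fst h),
       FD (\<lambda>x. FD t x (snd z)) (fst z) (fst h) + FD t (fst z) (snd h)))) (at z)"
    by (rule has_derivative_Pair[OF has_derivative_compose[OF f smooth_on_has_derivative[OF t fz]]
          has_derivative_FD_compose[OF t fz f s chart_open[OF c d]]])
  then show ?thesis
    by (rule has_derivative_transform_within_open[OF _ o z])
       (simp only: slit_transition[OF c d] t_def)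
qed

lemma smooth_atlas_slit: "smooth_atlas (slit_atlas B)"
proof
  fix k assume "k \<in> slit_atlas B"
  then obtain c where c: "c \<in> B" "k = slit_chart B c" by (auto simp: slit_atlas_def)
  show "inj_on (snd k) (fst k)" using inj_slit_chart c by simp
next
  fix k l assume "k \<in> slit_atlas B" "l \<in> slit_atlas B"
  then obtain c d where c: "c \<in> B" "k = slit_chart B c" and d: "d \<in> B" "l = slit_chart B d"
    by (auto simp: slit_atlas_def)
  let ?D = "fst c \<inter> fst d" and ?t = "snd d \<circ> chart_inv c"
  have im: "snd k ` (fst k \<inter> fst l) = snd c ` ?D \<times> - {0}"
    unfolding c d slit_chart_Int by (rule image_slit_chart[OF c(1)]) simp
  have o: "open (snd c ` ?D \<times> - {0::'e})"
    using chart_open[OF c(1) d(1)] by (intro open_Times) auto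
  then show "open (snd k ` (fst k \<inter> fst l))" unfolding im .
  have f: "smooth_on (snd c ` ?D \<times> - {0::'e}) fst" and s: "smooth_on (snd c ` ?D \<times> - {0::'e}) snd"
    by (rule smooth_on_bounded_linear[OF bounded_linear_fst])
       (rule smooth_on_bounded_linear[OF bounded_linear_snd])
  have "smooth_on (snd c ` ?D \<times> - {0}) (\<lambda>z. (?t (fst z), FD ?t (fst z) (snd z)))"
    by (rule smooth_on_Pair[OF smooth_on_compose[OF f transition_smooth[OF c(1) d(1)] o]
          smooth_on_FD_compose[OF transition_smooth[OF c(1) d(1)] f _ s o] o]) auto
  moreover have "smooth_on (snd c ` ?D \<times> - {0}) (snd l \<circ> chart_inv k) =
     smooth_on (snd c ` ?D \<times> - {0}) (\<lambda>z. (?t (fst z), FD ?t (fst z) (snd z)))"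
    unfolding c d by (rule smooth_on_cong[OF o slit_transition[OF c(1) d(1)]])
  ultimately show "smooth_on (snd k ` (fst k \<inter> fst l)) (snd l \<circ> chart_inv k)" unfolding im by simp
qed

end

section \<open>Projection, vertical lift and vertical endomorphism in induced charts\<close>

locale slit_bundle = smooth_atlas A for A :: "('a, 'e::euclidean_space) atlas"
begin

sublocale slit: smooth_atlas "slit_atlas A"
  by (rule smooth_atlas_slit)

abbreviation "sc \<equiv> slit_chart A"

abbreviation "over D \<equiv> {w \<in> slit A. fst w \<in> D}"

lemma sc_in: "c \<in> A \<Longrightarrow> sc c \<in> slit_atlas A"
  by (simp add: slit_atlas_def)

lemma sc_mem: "w \<in> slit A \<Longrightarrow> fst w \<in> fst c \<Longrightarrow> w \<in> fst (sc c)"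
  by (simp add: mem_slit_chart)

lemma image_over: "c \<in> A \<Longrightarrow> D \<subseteq> fst c \<Longrightarrow> snd (sc c) ` over D = snd c ` D \<times> - {0}"
  by (rule image_slit_chart)

lemma slit_atlasE:
  assumes "k \<in> slit_atlas A" obtains c where "c \<in> A" "k = sc c"
  using assms by (auto simp: slit_atlas_def)

lemma slit_chart_ex:
  assumes "w \<in> slit A" shows "\<exists>c\<in>A. fst w \<in> fst c"
proof -
  obtain p where p: "p \<in> carrier_of A" "w \<in> tangent_space A p" using assms unfolding slit_def by blast
  then show ?thesis using fst_tangent[OF p(2)] unfolding carrier_of_def by blast
qed

lemma openin_over_chart:
  assumes "openin (mtop A) D" "c \<in> A" "D \<subseteq> fst c" shows "openin (mtop (slit_atlas A)) (over D)"
proof (rule slit.openin_chartI[OF sc_in[OF assms(2)]])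
  show "over D \<subseteq> fst (sc c)" using assms(3) by (auto simp: mem_slit_chart)
  have "open (snd c ` D \<times> - {0::'e})"
    using open_image[OF assms(1,2)] assms(3) by (intro open_Times) (auto simp: Int_absorb2)
  then show "open (snd (sc c) ` over D)" using image_over assms by simp
qed

lemma openin_over:
  assumes "openin (mtop A) D" shows "openin (mtop (slit_atlas A)) (over D)"
proof -
  have eq: "over D = (\<Union>c\<in>A. over (D \<inter> fst c))" by (auto dest: slit_chart_ex)
  have "openin (mtop (slit_atlas A)) (over (D \<inter> fst c))" if "c \<in> A" for c
    by (rule openin_over_chart[OF openin_Int[OF assms openin_chart[OF that]] that]) simp
  then show ?thesis by (subst eq) (rule openin_Union, blast)
qed

lemma openin_slit: "openin (mtop (slit_atlas A)) (slit A)"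
proof -
  have eq: "slit A = (\<Union>c\<in>A. fst (sc c))"
    unfolding set_eq_iff UN_iff mem_slit_chart using slit_chart_ex by blast
  show ?thesis by (subst eq) (rule openin_Union, use slit.openin_chart[OF sc_in] in blast)
qed

lemma slit_transition_FD:
  assumes "c \<in> A" "d \<in> A" "w \<in> slit A" "fst w \<in> fst c" "fst w \<in> fst d"
  shows "FD (snd (sc d) \<circ> chart_inv (sc c)) (snd (sc c) w) (a, b) =
     (FD (snd d \<circ> chart_inv c) (snd c (fst w)) a,
      FD (\<lambda>x. FD (snd d \<circ> chart_inv c) x (snd w c)) (snd c (fst w)) a
      + FD (snd d \<circ> chart_inv c) (snd c (fst w)) b)"
proof -
  have "snd (sc c) w \<in> snd c ` (fst c \<inter> fst d) \<times> - {0}"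
    using assms slit_nonzero by (auto simp: snd_slit_chart)
  from FD_eqI[OF slit_transition_has_derivative[OF assms(1,2) this]]
  show ?thesis by (simp add: snd_slit_chart)
qed

text \<open>The tangent map is computed in an arbitrary chart of the slit bundle. After a change to
  the induced chart \<open>sc c\<close> the bundle projection reads \<open>fst\<close>, which is its
  own derivative.\<close>

lemma dpi_props:
  assumes \<xi>: "\<xi> \<in> tangent_space (slit_atlas A) w" and w: "w \<in> slit A"
  shows "dpi A \<xi> \<in> tangent_space A (fst w)"
    and "\<And>c. c \<in> A \<Longrightarrow> fst w \<in> fst c \<Longrightarrow> snd (dpi A \<xi>) c = fst (snd \<xi> (sc c))"
proof -
  have f: "fst \<xi> = w" by (rule slit.fst_tangent[OF \<xi>])
  show *: "snd (dpi A \<xi>) c = fst (snd \<xi> (sc c))" if c: "c \<in> A" "fst w \<in> fst c" for c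
  proof -
    let ?f = "snd c \<circ> fst" and ?k = "chart_at (slit_atlas A) w"
    have k: "?k \<in> slit_atlas A \<and> w \<in> fst ?k"
      by (rule slit.chart_at_props[OF sc_in[OF c(1)] sc_mem[OF w c(2)]])
    have D0: "(fst has_derivative fst) (at (snd (sc c) w))"
      by (simp add: bounded_linear_fst bounded_linear_imp_has_derivative)
    have eq: "(?f \<circ> chart_inv (sc c)) z = fst z" if z: "z \<in> snd (sc c) ` fst (sc c)" for z
    proof -
      obtain v where v: "v \<in> fst (sc c)" "z = snd (sc c) v" using z by blast
      then show ?thesis using chart_inv_slit[OF c(1) v(1)] by (simp add: snd_slit_chart)
    qed
    have D: "((?f \<circ> chart_inv (sc c)) has_derivative fst) (at (snd (sc c) w))"
      by (rule has_derivative_transform_within_open[OF D0 slit.open_chart_image[OF sc_in[OF c(1)]]])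
         (use c w eq sc_mem[OF w] in simp_all)
    have "snd (dpi A \<xi>) c = FD (?f \<circ> chart_inv ?k) (snd ?k w) (snd \<xi> ?k)"
      using c by (simp add: dpi_def tangent_map_def f Let_def)
    also have "\<dots> = FD (?f \<circ> chart_inv (sc c)) (snd (sc c) w) (snd \<xi> (sc c))"
      using D by (intro slit.FD_change_chart[OF \<xi> sc_in[OF c(1)] sc_mem[OF w c(2)]])
        (auto simp: k differentiable_def)
    also have "\<dots> = fst (snd \<xi> (sc c))" unfolding FD_eqI[OF D] ..
    finally show ?thesis .
  qed
  show "dpi A \<xi> \<in> tangent_space A (fst w)"
  proof (rule tangentI)
    show "fst (dpi A \<xi>) = fst w" by (simp add: dpi_def tangent_map_def f)
    show "snd (dpi A \<xi>) c = 0" if "c \<notin> A \<or> fst w \<notin> fst c" for c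
      using that by (auto simp: dpi_def tangent_map_def f)
    show "snd (dpi A \<xi>) d = FD (snd d \<circ> chart_inv c) (snd c (fst w)) (snd (dpi A \<xi>) c)"
      if cd: "c \<in> A" "d \<in> A" "fst w \<in> fst c" "fst w \<in> fst d" for c d
    proof -
      have "snd \<xi> (sc d) = FD (snd (sc d) \<circ> chart_inv (sc c)) (snd (sc c) w) (snd \<xi> (sc c))"
        by (rule slit.tangent_transition[OF \<xi> sc_in sc_in sc_mem sc_mem]) (use cd w in auto)
      then have "fst (snd \<xi> (sc d)) = FD (snd d \<circ> chart_inv c) (snd c (fst w)) (fst (snd \<xi> (sc c)))"
        using slit_transition_FD[OF cd(1,2) w cd(3,4), of "fst (snd \<xi> (sc c))" "snd (snd \<xi> (sc c))"]
        by simp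
      then show ?thesis using * cd by simp
    qed
  qed
qed

text \<open>In an induced chart the curve defining the lift keeps its base point and moves affinely
  in the fibre.\<close>

lemma ilift_props:
  assumes w: "w \<in> slit A" and u: "u \<in> tangent_space A (fst w)"
  shows "\<And>c. c \<in> A \<Longrightarrow> fst w \<in> fst c \<Longrightarrow> snd (ilift A w u) (sc c) = (0, snd u c)"
    and "ilift A w u \<in> tangent_space (slit_atlas A) w"
proof -
  have w0: "w +\<^sub>T 0 *\<^sub>T u = w" by (simp add: prod_eq_iff fun_eq_iff)
  show *: "snd (ilift A w u) (sc c) = (0, snd u c)" if c: "c \<in> A" "fst w \<in> fst c" for c
  proof -
    have "((\<lambda>t. (snd c (fst w), snd w c + t *\<^sub>R snd u c)) has_vector_derivative (0, snd u c)) (at 0)"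
      by (auto simp: has_vector_derivative_def intro!: derivative_eq_intros)
    then have "vector_derivative (\<lambda>t. (snd c (fst w), snd w c + t *\<^sub>R snd u c)) (at 0) = (0, snd u c)"
      by (simp add: vector_derivative_at)
    then show ?thesis
      using c sc_in sc_mem[OF w] by (simp add: ilift_def velocity_def w0 snd_slit_chart o_def)
  qed
  show "ilift A w u \<in> tangent_space (slit_atlas A) w"
  proof (rule slit.tangentI)
    show "fst (ilift A w u) = w" by (simp add: ilift_def velocity_def w0)
    show "snd (ilift A w u) c = 0" if "c \<notin> slit_atlas A \<or> w \<notin> fst c" for c
      using that by (auto simp: ilift_def velocity_def w0)
    fix k l assume k: "k \<in> slit_atlas A" "w \<in> fst k" and l: "l \<in> slit_atlas A" "w \<in> fst l"
    obtain c d where c: "c \<in> A" "k = sc c" "fst w \<in> fst c" and d: "d \<in> A" "l = sc d" "fst w \<in> fst d"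
      using k l by (auto elim!: slit_atlasE simp: mem_slit_chart)
    \<comment> \<open>Only this block of the transition derivative contains second derivatives; it
      is applied to the base component, which is 0 for a vertical vector.\<close>
    have lin: "FD (\<lambda>x. FD (snd d \<circ> chart_inv c) x (snd w c)) (snd c (fst w)) 0 = 0"
      by (rule linear_0[OF FD_linear[OF smooth_on_differentiable[OF smooth_on_FD[OF transition_smooth[OF c(1) d(1)]]]]])
         (use c d in simp)
    show "snd (ilift A w u) l = FD (snd l \<circ> chart_inv k) (snd k w) (snd (ilift A w u) k)"
      using tangent_transition[OF u c(1) d(1) c(3) d(3)] linear_0[OF transition_linear[OF c(1) d(1) c(3) d(3)]]
      unfolding c(2) d(2) *[OF c(1,3)] *[OF d(1,3)] slit_transition_FD[OF c(1) d(1) w c(3) d(3)] lin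
      by simp
  qed
qed

lemma vertical_iff:
  assumes "\<xi> \<in> tangent_space (slit_atlas A) w" "w \<in> slit A" "c \<in> A" "fst w \<in> fst c"
  shows "\<xi> \<in> vertical_space A w \<longleftrightarrow> fst (snd \<xi> (sc c)) = 0"
proof -
  have "dpi A \<xi> = tzero (fst w) \<longleftrightarrow> snd (dpi A \<xi>) c = 0"
    using tangent_eqI[OF dpi_props(1)[OF assms(1,2)] tzero_in assms(3,4)] by (metis snd_tzero)
  then show ?thesis using assms dpi_props(2)[OF assms] by (simp add: vertical_space_def)
qed

lemma vertical_tangent: "\<xi> \<in> vertical_space A w \<Longrightarrow> \<xi> \<in> tangent_space (slit_atlas A) w"
  by (simp add: vertical_space_def)

lemma ilift_vertical:
  assumes w: "w \<in> slit A" and u: "u \<in> tangent_space A (fst w)"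
  shows "ilift A w u \<in> vertical_space A w"
proof -
  obtain c where "c \<in> A" "fst w \<in> fst c" using slit_chart_ex[OF w] by blast
  then show ?thesis using vertical_iff ilift_props[OF w u] w by simp
qed

lemma ilift_inv_props:
  assumes \<xi>: "\<xi> \<in> vertical_space A w" and w: "w \<in> slit A"
  shows "ilift_inv A w \<xi> \<in> tangent_space A (fst w)"
    and "\<And>c. c \<in> A \<Longrightarrow> fst w \<in> fst c \<Longrightarrow> snd (ilift_inv A w \<xi>) c = snd (snd \<xi> (sc c))"
proof -
  obtain c where c: "c \<in> A" "fst w \<in> fst c" using slit_chart_ex[OF w] by blast
  let ?u = "tvec_of A c (fst w) (snd (snd \<xi> (sc c)))"
  have u: "?u \<in> tangent_space A (fst w)" by (rule tvec_of_in[OF c])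
  have "ilift A w ?u = \<xi>"
    using \<xi> vertical_iff[OF vertical_tangent[OF \<xi>] w c] ilift_props[OF w u] c
    by (intro slit.tangent_eqI[OF _ vertical_tangent[OF \<xi>] sc_in[OF c(1)] sc_mem[OF w c(2)]])
       (simp_all add: prod_eq_iff)
  then have im: "\<xi> \<in> ilift A w ` tangent_space A (fst w)" using u by (metis imageI)
  show v: "ilift_inv A w \<xi> \<in> tangent_space A (fst w)"
    unfolding ilift_inv_def by (rule inv_into_into[OF im])
  have "ilift A w (ilift_inv A w \<xi>) = \<xi>"
    unfolding ilift_inv_def by (rule f_inv_into_f[OF im])
  then show "snd (ilift_inv A w \<xi>) c = snd (snd \<xi> (sc c))" if "c \<in> A" "fst w \<in> fst c" for c
    using ilift_props(1)[OF w v that] by simp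
qed

lemma canonical_props:
  assumes "w \<in> slit A"
  shows "canonical_vf A w \<in> vertical_space A w"
    and "\<And>c. c \<in> A \<Longrightarrow> fst w \<in> fst c \<Longrightarrow> snd (canonical_vf A w) (sc c) = (0, snd w c)"
  using ilift_vertical[OF assms slit_tangent[OF assms]] ilift_props(1)[OF assms slit_tangent[OF assms]]
  by (simp_all add: canonical_vf_def)

lemma vendo_props:
  assumes \<xi>: "\<xi> \<in> tangent_space (slit_atlas A) w" and w: "w \<in> slit A"
  shows "vendo A \<xi> \<in> vertical_space A w"
    and "\<And>c. c \<in> A \<Longrightarrow> fst w \<in> fst c \<Longrightarrow> snd (vendo A \<xi>) (sc c) = (0, fst (snd \<xi> (sc c)))"
  using ilift_vertical[OF w dpi_props(1)[OF \<xi> w]] ilift_props(1)[OF w dpi_props(1)[OF \<xi> w]]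
    dpi_props(2)[OF \<xi> w]
  by (simp_all add: vendo_def slit.fst_tangent[OF \<xi>])

lemma vf_rep_sc:
  assumes "c \<in> A" "w \<in> slit A" "fst w \<in> fst c"
  shows "vf_rep (sc c) X (snd (sc c) w) = snd (X w) (sc c)"
  using assms by (simp add: vf_rep_def chart_inv_slit mem_slit_chart)

lemma sc_imageE:
  assumes "z \<in> snd (sc c) ` (D \<inter> fst (sc c))"
  obtains w where "w \<in> D" "w \<in> slit A" "fst w \<in> fst c" "z = snd (sc c) w"
  using assms by (auto simp: mem_slit_chart)

lemma vsmooth_vendo:
  assumes oD: "openin (mtop (slit_atlas A)) D" and D: "D \<subseteq> slit A" and X: "smooth_vf (slit_atlas A) D X"
  shows "vsmooth A D (\<lambda>z. vendo A (X z))"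
  unfolding vsmooth_def smooth_vf_def
proof (intro conjI ballI)
  show v: "vendo A (X w) \<in> vertical_space A w" if "w \<in> D" for w
    using vendo_props(1)[OF slit.smooth_vf_in[OF X that]] that D by blast
  then show "vendo A (X w) \<in> tangent_space (slit_atlas A) w" if "w \<in> D" for w
    using that vertical_tangent by blast
  fix k assume k: "k \<in> slit_atlas A"
  then obtain c where c: "c \<in> A" "k = sc c" by (rule slit_atlasE)
  let ?U = "snd k ` (D \<inter> fst k)"
  have o: "open ?U" by (rule slit.open_image[OF oD k])
  have "smooth_on ?U (\<lambda>z. (0::'e, fst (vf_rep k X z)))"
    by (rule smooth_on_Pair[OF smooth_on_const smooth_on_fst[OF slit.smooth_vf_rep[OF X k] o] o])
  moreover have "vf_rep k (\<lambda>z. vendo A (X z)) z = (0, fst (vf_rep k X z))" if "z \<in> ?U" for z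
  proof -
    obtain w where w: "w \<in> D" "w \<in> slit A" "fst w \<in> fst c" "z = snd (sc c) w"
      using \<open>z \<in> ?U\<close> unfolding c(2) by (rule sc_imageE)
    then show ?thesis
      using vendo_props(2)[OF slit.smooth_vf_in[OF X w(1)] w(2) c(1) w(3)]
      by (simp add: c(2) vf_rep_sc[OF c(1)])
  qed
  ultimately show "smooth_on ?U (vf_rep k (\<lambda>z. vendo A (X z)))"
    using smooth_on_cong[OF o] by (metis (no_types, lifting))
qed

lemma vsmooth_canonical: "vsmooth A (slit A) (canonical_vf A)"
  unfolding vsmooth_def smooth_vf_def
proof (intro conjI ballI)
  show "canonical_vf A w \<in> vertical_space A w" if "w \<in> slit A" for w
    by (rule canonical_props(1)[OF that])
  then show "canonical_vf A w \<in> tangent_space (slit_atlas A) w" if "w \<in> slit A" for w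
    using that vertical_tangent by blast
  fix k assume k: "k \<in> slit_atlas A"
  then obtain c where c: "c \<in> A" "k = sc c" by (rule slit_atlasE)
  let ?U = "snd k ` (slit A \<inter> fst k)"
  have o: "open ?U" by (rule slit.open_image[OF openin_slit k])
  have "smooth_on ?U (\<lambda>z. (0::'e, snd z))"
    by (rule smooth_on_Pair[OF smooth_on_const smooth_on_snd[OF smooth_on_ident o] o])
  moreover have "vf_rep k (canonical_vf A) z = (0, snd z)" if "z \<in> ?U" for z
  proof -
    obtain w where w: "w \<in> slit A" "fst w \<in> fst c" "z = snd (sc c) w"
      using \<open>z \<in> ?U\<close> unfolding c(2) by (rule sc_imageE)
    then show ?thesis
      using canonical_props(2)[OF w(1) c(1) w(2)]
      by (simp add: c(2) vf_rep_sc[OF c(1)]) (simp add: snd_slit_chart)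
  qed
  ultimately show "smooth_on ?U (vf_rep k (canonical_vf A))"
    using smooth_on_cong[OF o] by (metis (no_types, lifting))
qed

lemma vsmooth_chartI:
  assumes c: "c \<in> A" and D: "D \<subseteq> fst (sc c)" "open (snd (sc c) ` D)"
    and X: "\<And>p. p \<in> D \<Longrightarrow> X p \<in> vertical_space A p"
    and sm: "smooth_on (snd (sc c) ` D) (\<lambda>z. snd (vf_rep (sc c) X z))"
  shows "vsmooth A D X"
  unfolding vsmooth_def
proof (intro conjI ballI slit.smooth_vf_chartI[OF sc_in[OF c] D vertical_tangent[OF X]] X)
  have "vf_rep (sc c) X z = (0, snd (vf_rep (sc c) X z))" if "z \<in> snd (sc c) ` D" for z
  proof -
    obtain w where w: "w \<in> D" "z = snd (sc c) w" using \<open>z \<in> snd (sc c) ` D\<close> by blast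
    then have w2: "w \<in> slit A" "fst w \<in> fst c" using D by (auto simp: mem_slit_chart)
    then show ?thesis using vertical_iff[OF vertical_tangent[OF X[OF w(1)]] w2(1) c w2(2)] X[OF w(1)]
      by (simp add: w vf_rep_sc[OF c] prod_eq_iff)
  qed
  moreover have "smooth_on (snd (sc c) ` D) (\<lambda>z. (0::'e, snd (vf_rep (sc c) X z)))"
    by (rule smooth_on_Pair[OF smooth_on_const sm D(2)])
  ultimately show "smooth_on (snd (sc c) ` D) (vf_rep (sc c) X)"
    using smooth_on_cong[OF D(2)] by (metis (no_types, lifting))
qed

lemma vsmooth_subset: "vsmooth A D s \<Longrightarrow> D' \<subseteq> D \<Longrightarrow> vsmooth A D' s"
  unfolding vsmooth_def using slit.smooth_vf_subset by blast

lemma vertical_tdiff: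
  assumes "\<xi> \<in> vertical_space A w" "\<eta> \<in> vertical_space A w" "w \<in> slit A"
  shows "\<xi> -\<^sub>T \<eta> \<in> vertical_space A w"
proof -
  obtain c where c: "c \<in> A" "fst w \<in> fst c" using slit_chart_ex[OF assms(3)] by blast
  have t: "\<xi> \<in> tangent_space (slit_atlas A) w" "\<eta> \<in> tangent_space (slit_atlas A) w"
    using assms vertical_tangent by auto
  show ?thesis
    using vertical_iff[OF slit.tdiff_in[OF t] assms(3) c] vertical_iff[OF t(1) assms(3) c]
      vertical_iff[OF t(2) assms(3) c] assms by simp
qed

section \<open>Vertical fields with prescribed fibre components\<close>

text \<open>With constant \<sigma> these fields supply the local frame of the vertical bundle over
  the chart \<open>c\<close>.\<close>

definition vert :: "('a, 'e) chart \<Rightarrow> (('a, 'e) tvec \<Rightarrow> 'e) \<Rightarrow> ('a, 'e) tfield"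
  where "vert c \<sigma> z = tvec_of (slit_atlas A) (sc c) z (0, \<sigma> z)"

lemma vert_components: "c \<in> A \<Longrightarrow> z \<in> fst (sc c) \<Longrightarrow> snd (vert c \<sigma> z) (sc c) = (0, \<sigma> z)"
  unfolding vert_def by (rule slit.snd_tvec_of[OF sc_in])

lemma vert_vertical: "c \<in> A \<Longrightarrow> z \<in> fst (sc c) \<Longrightarrow> vert c \<sigma> z \<in> vertical_space A z"
  using vertical_iff[of "vert c \<sigma> z" z c] slit.tvec_of_in[OF sc_in, of c z "(0, \<sigma> z)"]
    vert_components[of c z \<sigma>]
  by (simp add: mem_slit_chart vert_def)

lemma vert_eqI:
  assumes "s z \<in> vertical_space A z" "c \<in> A" "z \<in> fst (sc c)" "snd (snd (s z) (sc c)) = \<sigma> z"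
  shows "vert c \<sigma> z = s z"
proof -
  have "fst (snd (s z) (sc c)) = 0"
    using vertical_iff[OF vertical_tangent[OF assms(1)]] assms by (simp add: mem_slit_chart)
  then show ?thesis
    using assms(4) vert_components[OF assms(2,3), of \<sigma>]
    by (intro slit.tangent_eqI[OF vertical_tangent[OF vert_vertical[OF assms(2,3)]]
          vertical_tangent[OF assms(1)] sc_in[OF assms(2)] assms(3)]) (auto intro: prod_eqI)
qed

lemma vsmooth_vert:
  assumes c: "c \<in> A" and oD: "openin (mtop (slit_atlas A)) D" and D: "D \<subseteq> fst (sc c)"
    and sm: "smooth_on (snd (sc c) ` D) (\<sigma> \<circ> chart_inv (sc c))"
  shows "vsmooth A D (vert c \<sigma>)"
proof -
  have o: "open (snd (sc c) ` D)"
    using slit.open_image[OF oD sc_in[OF c]] D by (simp add: Int_absorb2)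
  have eq: "snd (vf_rep (sc c) (vert c \<sigma>) z) = (\<sigma> \<circ> chart_inv (sc c)) z" if "z \<in> snd (sc c) ` D" for z
    using vert_components[OF c subsetD[OF D slit.chart_inv_mem[OF sc_in[OF c] that D]], of \<sigma>]
    by (simp add: vf_rep_def)
  have sm': "smooth_on (snd (sc c) ` D) (\<lambda>z. snd (vf_rep (sc c) (vert c \<sigma>) z))"
    by (rule iffD2[OF smooth_on_cong[OF o eq] sm])
  show ?thesis
    by (rule vsmooth_chartI[OF c D o _ sm']) (rule vert_vertical[OF c subsetD[OF D]])
qed

lemma vsmooth_cong:
  assumes "openin (mtop (slit_atlas A)) D" "vsmooth A D s" "\<And>z. z \<in> D \<Longrightarrow> s' z = s z"
  shows "vsmooth A D s'"
  unfolding vsmooth_def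
proof (intro conjI ballI)
  have "smooth_vf (slit_atlas A) D s" using assms(2) by (simp add: vsmooth_def)
  then show "smooth_vf (slit_atlas A) D s'" by (rule slit.smooth_vf_cong[OF assms(1) _ assms(3)])
  show "s' z \<in> vertical_space A z" if "z \<in> D" for z
    using assms(2) that unfolding vsmooth_def assms(3)[OF that] by blast
qed

end

section \<open>Sprays in coordinates\<close>

locale spray_bundle = slit_bundle A for A :: "('a, 'e::euclidean_space) atlas" +
  fixes S :: "('a, 'e) tfield"
  assumes spray: "spray A S"
begin

text \<open>In the chart of the slit bundle induced by \<open>c\<close> one has \<open>S(x, y) = (y, sp(x, y))\<close>, and
  \<open>(a, b)\<close> is horizontal iff \<open>b = hor(a)\<close>.\<close>

definition sp :: "('a, 'e) chart \<Rightarrow> 'e \<times> 'e \<Rightarrow> 'e"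
  where "sp c z = snd (vf_rep (sc c) S z)"

definition hor :: "('a, 'e) chart \<Rightarrow> 'e \<times> 'e \<Rightarrow> 'e \<Rightarrow> 'e"
  where "hor c z u = (1/2) *\<^sub>R FD (sp c) z (0, u)"

abbreviation "cdom c \<equiv> snd (sc c) ` fst (sc c)"

lemma S_smooth: "smooth_vf (slit_atlas A) (slit A) S"
  using spray by (simp add: spray_def)

lemma open_cdom: "c \<in> A \<Longrightarrow> open (cdom c)"
  by (rule slit.open_chart_image[OF sc_in])

lemma cdom_mem: "w \<in> slit A \<Longrightarrow> fst w \<in> fst c \<Longrightarrow> snd (sc c) w \<in> cdom c"
  by (simp add: sc_mem)

lemma cdomE:
  assumes "z \<in> cdom c"
  obtains w where "w \<in> slit A" "fst w \<in> fst c" "z = snd (sc c) w"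
  using assms mem_slit_chart by blast

lemma S_components:
  assumes w: "w \<in> slit A" and c: "c \<in> A" "fst w \<in> fst c"
  shows "snd (S w) (sc c) = (snd w c, sp c (snd (sc c) w))"
proof -
  have "vendo A (S w) = canonical_vf A w" using spray w by (simp add: spray_def)
  then have "fst (snd (S w) (sc c)) = snd w c"
    using vendo_props(2)[OF slit.smooth_vf_in[OF S_smooth w] w c] canonical_props(2)[OF w c] by simp
  then show ?thesis by (simp add: sp_def vf_rep_sc[OF c(1) w c(2)] prod_eq_iff)
qed

lemma S_rep: "c \<in> A \<Longrightarrow> z \<in> cdom c \<Longrightarrow> vf_rep (sc c) S z = (snd z, sp c z)"
  by (erule cdomE) (simp add: vf_rep_sc S_components, simp add: snd_slit_chart)

lemma sp_smooth:
  assumes "c \<in> A" shows "smooth_on (cdom c) (sp c)"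
proof -
  have "slit A \<inter> fst (sc c) = fst (sc c)" by (auto simp: mem_slit_chart)
  then have "smooth_on (cdom c) (vf_rep (sc c) S)"
    using slit.smooth_vf_rep[OF S_smooth sc_in[OF assms]] by simp
  from smooth_on_snd[OF this open_cdom[OF assms]] show ?thesis by (simp add: sp_def[abs_def])
qed

lemma S_FD:
  assumes c: "c \<in> A" and z: "z \<in> cdom c"
  shows "FD (vf_rep (sc c) S) z h = (snd h, FD (sp c) z h)"
proof -
  have "FD (vf_rep (sc c) S) z = FD (\<lambda>z. (snd z, sp c z)) z"
    by (rule FD_cong[OF open_cdom[OF c] z S_rep[OF c]])
  also have "\<dots> = (\<lambda>h. (snd h, FD (sp c) z h))"
    by (intro FD_eqI has_derivative_Pair smooth_on_has_derivative[OF sp_smooth[OF c] z])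
       (simp add: bounded_linear_snd bounded_linear_imp_has_derivative)
  finally show ?thesis by simp
qed

lemma hor_linear: "c \<in> A \<Longrightarrow> z \<in> cdom c \<Longrightarrow> linear (hor c z)"
proof -
  assume "c \<in> A" "z \<in> cdom c"
  then have "linear (FD (sp c) z)" by (intro FD_linear smooth_on_differentiable[OF sp_smooth])
  then show ?thesis
    using linear_add[of "FD (sp c) z" "(0, _)" "(0, _)"] linear_scale[of "FD (sp c) z" _ "(0, _)"]
    by (intro linearI) (simp_all add: hor_def scaleR_add_right[symmetric])
qed

lemma canonical_FD:
  assumes c: "c \<in> A" and z: "z \<in> cdom c"
  shows "FD (vf_rep (sc c) (canonical_vf A)) z h = (0, snd h)"
proof -
  have "FD (vf_rep (sc c) (canonical_vf A)) z = FD (\<lambda>z. (0, snd z)) z"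
  proof (rule FD_cong[OF open_cdom[OF c] z])
    fix y assume "y \<in> cdom c"
    then obtain w where "w \<in> slit A" "fst w \<in> fst c" "y = snd (sc c) w" by (rule cdomE)
    then show "vf_rep (sc c) (canonical_vf A) y = (0, snd y)"
      by (simp add: vf_rep_sc[OF c] canonical_props(2)[OF _ c]) (simp add: snd_slit_chart)
  qed
  also have "\<dots> = (\<lambda>h. (0, snd h))"
    by (intro FD_eqI has_derivative_Pair has_derivative_const)
       (simp add: bounded_linear_snd bounded_linear_imp_has_derivative)
  finally show ?thesis by simp
qed

text \<open>Euler's relation for the homogeneity \<open>[C, S] = S\<close>.\<close>

lemma hor_position:
  assumes w: "w \<in> slit A" and c: "c \<in> A" "fst w \<in> fst c"
  shows "hor c (snd (sc c) w) (snd w c) = sp c (snd (sc c) w)"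
proof -
  have "lie_bracket (slit_atlas A) (canonical_vf A) S w = S w"
    using spray w by (simp add: spray_def)
  then have "snd (lie_bracket (slit_atlas A) (canonical_vf A) S w) (sc c) = snd (S w) (sc c)" by simp
  then have "FD (sp c) (snd (sc c) w) (0, snd w c) - sp c (snd (sc c) w) = sp c (snd (sc c) w)"
    using sc_in[OF c(1)] sc_mem[OF w c(2)]
    by (simp add: lie_bracket_def S_FD[OF c(1) cdom_mem[OF w c(2)]]
        canonical_FD[OF c(1) cdom_mem[OF w c(2)]] S_components[OF w c] canonical_props(2)[OF w c])
  then have "FD (sp c) (snd (sc c) w) (0, snd w c) = 2 *\<^sub>R sp c (snd (sc c) w)"
    by (simp add: scaleR_2 diff_eq_eq)
  then show ?thesis by (simp add: hor_def)
qed

section \<open>The canonical connection and its horizontal distribution\<close>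

text \<open>For a vector (a, b) the derivative of the extension \<open>Y\<close> along
  \<open>S\<close> occurs in both brackets and cancels, which leaves (a, Ds(0, a) - b). Its fixed
  points satisfy 2b = Ds(0, a), whence the factor 1/2 in \<open>hor\<close>.\<close>

lemma canonical_connection_props:
  assumes \<xi>: "\<xi> \<in> tangent_space (slit_atlas A) w" and w: "w \<in> slit A"
  shows "canonical_connection A S \<xi> \<in> tangent_space (slit_atlas A) w"
    and "\<And>c. c \<in> A \<Longrightarrow> fst w \<in> fst c \<Longrightarrow> snd (canonical_connection A S \<xi>) (sc c)
      = (fst (snd \<xi> (sc c)), 2 *\<^sub>R hor c (snd (sc c) w) (fst (snd \<xi> (sc c))) - snd (snd \<xi> (sc c)))"
proof -
  obtain c0 where c0: "c0 \<in> A" "fst w \<in> fst c0" using slit_chart_ex[OF w] by blast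
  define Y where "Y = local_ext (slit_atlas A) \<xi>"
  obtain D0 where D0: "openin (mtop (slit_atlas A)) D0" "w \<in> D0" "smooth_vf (slit_atlas A) D0 Y" "Y w = \<xi>"
    using slit.local_ext_props[OF \<xi> sc_in[OF c0(1)] sc_mem[OF w c0(2)]] unfolding Y_def .
  define D where "D = D0 \<inter> slit A"
  have oD: "openin (mtop (slit_atlas A)) D" and wD: "w \<in> D" and DS: "D \<subseteq> slit A"
    using D0 w openin_slit by (auto simp: D_def)
  have Y: "smooth_vf (slit_atlas A) D Y"
    by (rule slit.smooth_vf_subset[OF D0(3)]) (simp add: D_def)
  have SD: "smooth_vf (slit_atlas A) D S" by (rule slit.smooth_vf_subset[OF S_smooth DS])
  have vY: "smooth_vf (slit_atlas A) D (\<lambda>z. vendo A (Y z))"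
    using vsmooth_vendo[OF oD DS Y] by (simp add: vsmooth_def)
  have cc: "canonical_connection A S \<xi> = vendo A (lie_bracket (slit_atlas A) S Y w)
        -\<^sub>T lie_bracket (slit_atlas A) S (\<lambda>z. vendo A (Y z)) w"
    by (simp add: canonical_connection_def Y_def Let_def slit.fst_tangent[OF \<xi>])
  have br: "lie_bracket (slit_atlas A) S Y w \<in> tangent_space (slit_atlas A) w"
    by (rule slit.lie_bracket_in[OF oD SD Y wD])
  show "canonical_connection A S \<xi> \<in> tangent_space (slit_atlas A) w"
    unfolding cc
    by (rule slit.tdiff_in[OF vertical_tangent[OF vendo_props(1)[OF br w]] slit.lie_bracket_in[OF oD SD vY wD]])
  fix c assume c: "c \<in> A" "fst w \<in> fst c"
  let ?z = "snd (sc c) w" and ?R = "vf_rep (sc c) Y"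
  have zc: "?z \<in> cdom c" by (rule cdom_mem[OF w c(2)])
  have oU: "open (snd (sc c) ` (D \<inter> fst (sc c)))" by (rule slit.open_image[OF oD sc_in[OF c(1)]])
  have zU: "?z \<in> snd (sc c) ` (D \<inter> fst (sc c))" using wD sc_mem[OF w c(2)] by blast
  have DR: "(?R has_derivative FD ?R ?z) (at ?z)"
    by (rule smooth_on_has_derivative[OF slit.smooth_vf_rep[OF Y sc_in[OF c(1)]] zU])
  have "FD (vf_rep (sc c) (\<lambda>z. vendo A (Y z))) ?z = FD (\<lambda>y. (0, fst (?R y))) ?z"
  proof (rule FD_cong[OF oU zU])
    fix y assume "y \<in> snd (sc c) ` (D \<inter> fst (sc c))"
    then obtain v where v: "v \<in> D" "v \<in> slit A" "fst v \<in> fst c" "y = snd (sc c) v" by (rule sc_imageE)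
    then show "vf_rep (sc c) (\<lambda>z. vendo A (Y z)) y = (0, fst (?R y))"
      using vendo_props(2)[OF slit.smooth_vf_in[OF Y v(1)] v(2) c(1) v(3)]
      by (simp add: vf_rep_sc[OF c(1)])
  qed
  also have "\<dots> = (\<lambda>h. (0, fst (FD ?R ?z h)))"
    by (intro FD_eqI has_derivative_Pair has_derivative_const has_derivative_fst DR)
  finally have V: "FD (vf_rep (sc c) (\<lambda>z. vendo A (Y z))) ?z = (\<lambda>h. (0, fst (FD ?R ?z h)))" .
  show "snd (canonical_connection A S \<xi>) (sc c)
      = (fst (snd \<xi> (sc c)), 2 *\<^sub>R hor c ?z (fst (snd \<xi> (sc c))) - snd (snd \<xi> (sc c)))"
    using sc_in[OF c(1)] sc_mem[OF w c(2)] vendo_props(2)[OF br w c] vendo_props(2)[OF \<xi> w c]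
    unfolding cc by (simp add: lie_bracket_def V S_FD[OF c(1) zc] D0(4) hor_def)
qed

lemma horizontal_iff:
  assumes \<xi>: "\<xi> \<in> tangent_space (slit_atlas A) w" and w: "w \<in> slit A" and c: "c \<in> A" "fst w \<in> fst c"
  shows "\<xi> \<in> horizontal_space A S w \<longleftrightarrow> snd (snd \<xi> (sc c)) = hor c (snd (sc c) w) (fst (snd \<xi> (sc c)))"
proof -
  have "canonical_connection A S \<xi> = \<xi> \<longleftrightarrow> snd (canonical_connection A S \<xi>) (sc c) = snd \<xi> (sc c)"
    using slit.tangent_eqI[OF canonical_connection_props(1)[OF \<xi> w] \<xi> sc_in[OF c(1)] sc_mem[OF w c(2)]]
    by auto
  also have "\<dots> \<longleftrightarrow> 2 *\<^sub>R hor c (snd (sc c) w) (fst (snd \<xi> (sc c))) = 2 *\<^sub>R snd (snd \<xi> (sc c))"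
    unfolding canonical_connection_props(2)[OF \<xi> w c] by (auto simp: prod_eq_iff scaleR_2 diff_eq_eq)
  finally show ?thesis using \<xi> by (auto simp: horizontal_space_def)
qed

lemma horizontal_tangent: "\<xi> \<in> horizontal_space A S w \<Longrightarrow> \<xi> \<in> tangent_space (slit_atlas A) w"
  by (simp add: horizontal_space_def)

lemma vertical_part_props:
  assumes \<xi>: "\<xi> \<in> tangent_space (slit_atlas A) w" and w: "w \<in> slit A"
  shows "vertical_part A S \<xi> \<in> vertical_space A w"
    and "\<And>c. c \<in> A \<Longrightarrow> fst w \<in> fst c \<Longrightarrow> snd (vertical_part A S \<xi>) (sc c)
      = (0, snd (snd \<xi> (sc c)) - hor c (snd (sc c) w) (fst (snd \<xi> (sc c))))"
proof -
  \<comment> \<open>This holds in every chart around the point. Existence and uniqueness are then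
    settled in one chart, and the components of the resulting vector follow in all of them.\<close>
  have char: "(\<eta> \<in> vertical_space A (fst \<xi>) \<and> \<xi> -\<^sub>T \<eta> \<in> horizontal_space A S (fst \<xi>)) \<longleftrightarrow>
     \<eta> \<in> tangent_space (slit_atlas A) w \<and>
     snd \<eta> (sc c) = (0, snd (snd \<xi> (sc c)) - hor c (snd (sc c) w) (fst (snd \<xi> (sc c))))"
    if c: "c \<in> A" "fst w \<in> fst c" for \<eta> c
  proof (cases "\<eta> \<in> tangent_space (slit_atlas A) w")
    case True
    show ?thesis
      using vertical_iff[OF True w c] horizontal_iff[OF slit.tdiff_in[OF \<xi> True] w c] True
      by (auto simp: slit.fst_tangent[OF \<xi>] prod_eq_iff algebra_simps)
  next
    case False then show ?thesis using vertical_tangent[of \<eta> w] by (auto simp: slit.fst_tangent[OF \<xi>])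
  qed
  obtain c0 where c0: "c0 \<in> A" "fst w \<in> fst c0" using slit_chart_ex[OF w] by blast
  let ?\<eta> = "tvec_of (slit_atlas A) (sc c0) w
     (0, snd (snd \<xi> (sc c0)) - hor c0 (snd (sc c0) w) (fst (snd \<xi> (sc c0))))"
  have "\<exists>!\<eta>. \<eta> \<in> vertical_space A (fst \<xi>) \<and> \<xi> -\<^sub>T \<eta> \<in> horizontal_space A S (fst \<xi>)"
    unfolding char[OF c0]
  proof (rule ex1I[of _ ?\<eta>])
    show "?\<eta> \<in> tangent_space (slit_atlas A) w \<and> snd ?\<eta> (sc c0) =
       (0, snd (snd \<xi> (sc c0)) - hor c0 (snd (sc c0) w) (fst (snd \<xi> (sc c0))))"
      using slit.tvec_of_in[OF sc_in[OF c0(1)] sc_mem[OF w c0(2)]]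
        slit.snd_tvec_of[OF sc_in[OF c0(1)] sc_mem[OF w c0(2)]] by simp
    then show "\<eta> = ?\<eta>" if "\<eta> \<in> tangent_space (slit_atlas A) w \<and> snd \<eta> (sc c0) =
       (0, snd (snd \<xi> (sc c0)) - hor c0 (snd (sc c0) w) (fst (snd \<xi> (sc c0))))" for \<eta>
      using that slit.tangent_eqI[OF _ _ sc_in[OF c0(1)] sc_mem[OF w c0(2)]] by metis
  qed
  from theI'[OF this] have the: "vertical_part A S \<xi> \<in> vertical_space A (fst \<xi>) \<and>
      \<xi> -\<^sub>T vertical_part A S \<xi> \<in> horizontal_space A S (fst \<xi>)"
    unfolding vertical_part_def .
  then show "vertical_part A S \<xi> \<in> vertical_space A w" by (simp add: slit.fst_tangent[OF \<xi>])
  show "snd (vertical_part A S \<xi>) (sc c)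
      = (0, snd (snd \<xi> (sc c)) - hor c (snd (sc c) w) (fst (snd \<xi> (sc c))))"
    if "c \<in> A" "fst w \<in> fst c" for c
    using the char[OF that] by blast
qed

lemma hlift_props:
  assumes w: "w \<in> slit A" and u: "u \<in> tangent_space A (fst w)"
  shows "hlift A S w u \<in> tangent_space (slit_atlas A) w"
    and "\<And>c. c \<in> A \<Longrightarrow> fst w \<in> fst c \<Longrightarrow>
      snd (hlift A S w u) (sc c) = (snd u c, hor c (snd (sc c) w) (snd u c))"
proof -
  obtain c0 where c0: "c0 \<in> A" "fst w \<in> fst c0" using slit_chart_ex[OF w] by blast
  let ?\<xi> = "tvec_of (slit_atlas A) (sc c0) w (snd u c0, hor c0 (snd (sc c0) w) (snd u c0))"
  have \<xi>: "?\<xi> \<in> tangent_space (slit_atlas A) w"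
    by (rule slit.tvec_of_in[OF sc_in[OF c0(1)] sc_mem[OF w c0(2)]])
  have sx: "snd ?\<xi> (sc c0) = (snd u c0, hor c0 (snd (sc c0) w) (snd u c0))"
    by (rule slit.snd_tvec_of[OF sc_in[OF c0(1)] sc_mem[OF w c0(2)]])
  have "?\<xi> \<in> horizontal_space A S w" using horizontal_iff[OF \<xi> w c0] sx by simp
  moreover have "u = dpi A ?\<xi>"
    using dpi_props(2)[OF \<xi> w c0] sx
    by (intro tangent_eqI[OF u dpi_props(1)[OF \<xi> w] c0]) simp
  ultimately have im: "u \<in> dpi A ` horizontal_space A S w" by (rule rev_image_eqI)
  have h: "hlift A S w u \<in> horizontal_space A S w"
    unfolding hlift_def by (rule inv_into_into[OF im])
  then show t: "hlift A S w u \<in> tangent_space (slit_atlas A) w" by (rule horizontal_tangent)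
  have d: "dpi A (hlift A S w u) = u"
    unfolding hlift_def by (rule f_inv_into_f[OF im])
  show "snd (hlift A S w u) (sc c) = (snd u c, hor c (snd (sc c) w) (snd u c))"
    if "c \<in> A" "fst w \<in> fst c" for c
    using horizontal_iff[OF t w that] h dpi_props(2)[OF t w that] d by (simp add: prod_eq_iff)
qed

text \<open>\<open>S w\<close> projects to \<open>w\<close> and is horizontal by Euler's relation.
  Hence D^W along \<open>W\<close> is \<open>nabla\<close> in the direction \<open>S\<close>, where
  the torsion condition gives information.\<close>

lemma hlift_self: "w \<in> slit A \<Longrightarrow> hlift A S w w = S w"
proof -
  assume w: "w \<in> slit A"
  obtain c where c: "c \<in> A" "fst w \<in> fst c" using slit_chart_ex[OF w] by blast
  show ?thesis
    using hlift_props[OF w slit_tangent[OF w]] S_components[OF w c] hor_position[OF w c] c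
    by (intro slit.tangent_eqI[OF _ slit.smooth_vf_in[OF S_smooth w] sc_in[OF c(1)] sc_mem[OF w c(2)]])
       simp_all
qed

text \<open>Since the connection is a lift, this says that the canonical field is parallel along the
  spray, which removes one term of the curvature.\<close>

lemma vertical_part_S:
  assumes w: "w \<in> slit A" and c: "c \<in> A" "fst w \<in> fst c"
  shows "snd (vertical_part A S (S w)) (sc c) = 0"
  using vertical_part_props(2)[OF slit.smooth_vf_in[OF S_smooth w] w c] S_components[OF w c]
    hor_position[OF w c] by (simp add: zero_prod_def)

text \<open>The summand with factor 1/2 is the derivative of \<open>hor\<close> in its base variable
  with the vector frozen, the origin of the DG term in the curvature.\<close>

lemma hor_has_derivative:
  assumes c: "c \<in> A" and g: "g x \<in> cdom c" "(g has_derivative g') (at x)"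
    and X: "(X has_derivative X') (at x)"
  shows "((\<lambda>x. hor c (g x) (X x)) has_derivative
    (\<lambda>h. (1/2) *\<^sub>R FD (\<lambda>y. FD (sp c) y (0, X x)) (g x) (g' h) + hor c (g x) (X' h))) (at x)"
proof -
  have "((\<lambda>x. FD (sp c) (g x) (0, X x)) has_derivative
     (\<lambda>h. FD (\<lambda>y. FD (sp c) y (0, X x)) (g x) (g' h) + FD (sp c) (g x) (0, X' h))) (at x)"
    by (rule has_derivative_FD_compose[OF sp_smooth[OF c] g
          has_derivative_Pair[OF has_derivative_const X] open_cdom[OF c]])
  from has_derivative_scaleR_right[OF this, of "1/2"]
  show ?thesis by (simp add: hor_def scaleR_add_right)
qed

end

section \<open>Lifted connections in coordinates\<close>

locale lifted_connection = spray_bundle A S for A :: "('a, 'e::euclidean_space) atlas" and S +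
  fixes nabla :: "('a, 'e) vconn"
  assumes lift: "lift_of A S nabla"
begin

sublocale vertical_linear_connection A nabla
  using lift by (simp add: lift_of_def)

lemma nabla_canonical:
  "w \<in> slit A \<Longrightarrow> \<xi> \<in> tangent_space (slit_atlas A) w \<Longrightarrow> nabla \<xi> (canonical_vf A) = vertical_part A S \<xi>"
  using lift by (simp add: lift_of_def)

text \<open>Christoffel symbols: the fibre components of the derivative of a constant frame
  field.\<close>

definition nabla_const :: "('a, 'e) chart \<Rightarrow> ('a, 'e) ttvec \<Rightarrow> 'e \<Rightarrow> 'e"
  where "nabla_const c \<xi> b = snd (snd (nabla \<xi> (vert c (\<lambda>_. b))) (sc c))"

text \<open>The connection form with respect to the frame of constant vertical fields.\<close>

definition conn :: "('a, 'e) chart \<Rightarrow> ('a, 'e) ttvec \<Rightarrow> 'e \<Rightarrow> 'e"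
  where "conn c \<xi> v = (\<Sum>b\<in>Basis. (v \<bullet> b) *\<^sub>R nabla_const c \<xi> b)"

lemma conn_linear: "linear (conn c \<xi>)"
  unfolding conn_def
  by (rule linearI) (simp_all add: inner_add_left scaleR_add_left sum.distrib scaleR_sum_right)

text \<open>The Leibniz rule for a combination of frame fields. The axioms treat one product and a
  sum of two sections at a time, so the finite sum is built up by induction.\<close>

lemma nabla_vert_sum:
  assumes c: "c \<in> A" and oD: "openin (mtop (slit_atlas A)) D" and D: "D \<subseteq> fst (sc c)" and w: "w \<in> D"
    and \<xi>: "\<xi> \<in> tangent_space (slit_atlas A) w"
    and F: "finite F"
    and sm: "\<And>b. b \<in> F \<Longrightarrow> smooth_on (snd (sc c) ` D) (f b \<circ> chart_inv (sc c))"
  shows "snd (snd (nabla \<xi> (vert c (\<lambda>z. \<Sum>b\<in>F. f b z *\<^sub>R b))) (sc c)) =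
    (\<Sum>b\<in>F. dir_deriv (slit_atlas A) \<xi> (f b) *\<^sub>R b + f b w *\<^sub>R nabla_const c \<xi> b)"
  using F sm
proof (induction F)
  have vc: "vsmooth A D (vert c (\<lambda>_. b))" for b
    by (rule vsmooth_vert[OF c oD D]) (simp add: o_def)
  have wc: "w \<in> fst (sc c)" using w D by blast
  have o: "open (snd (sc c) ` D)"
    using slit.open_image[OF oD sc_in[OF c]] D by (simp add: Int_absorb2)
  {
    case empty
    have "smooth_fun (slit_atlas A) D (\<lambda>_. 0)"
      by (rule slit.smooth_fun_chartI[OF sc_in[OF c] D o]) (simp add: o_def)
    \<comment> \<open>That the zero section has derivative 0 follows from the Leibniz rule with
      coefficient 0 and section 0: each of the two resulting summands contains a zero
      factor.\<close>
    note L = nabla_Leibniz[OF oD w vc this \<xi>, of 0]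
    have "nabla \<xi> (vert c (\<lambda>z. \<Sum>b\<in>{}. f b z *\<^sub>R b)) = nabla \<xi> (\<lambda>z. 0 *\<^sub>T vert c (\<lambda>_. 0) z)"
    proof (rule nabla_cong[OF oD w _ \<xi>, symmetric])
      show "vsmooth A D (vert c (\<lambda>z. \<Sum>b\<in>{}. f b z *\<^sub>R b))" using vc[of 0] by simp
      fix z assume "z \<in> D"
      then have "z \<in> fst (sc c)" using D by blast
      then have v: "vert c (\<lambda>_. 0) z \<in> tangent_space (slit_atlas A) z" "snd (vert c (\<lambda>_. 0) z) (sc c) = (0, 0)"
        using vertical_tangent[OF vert_vertical[OF c]] vert_components[OF c, of z] by auto
      show "0 *\<^sub>T vert c (\<lambda>_. 0) z = vert c (\<lambda>z. \<Sum>b\<in>{}. f b z *\<^sub>R b) z"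
        using v by (intro slit.tangent_eqI[OF slit.tscale_in[OF v(1)] _ sc_in[OF c] \<open>z \<in> fst (sc c)\<close>])
          (simp_all add: zero_prod_def)
    qed
    moreover have "snd (snd (nabla \<xi> (\<lambda>z. 0 *\<^sub>T vert c (\<lambda>_. 0) z)) (sc c)) = 0"
      by (subst L) (simp add: vert_components[OF c wc])
    ultimately show ?case by (simp only: sum.empty)
  next
    case (insert b F)
    let ?t = "vert c (\<lambda>z. \<Sum>b\<in>F. f b z *\<^sub>R b)"
    have sb: "smooth_on (snd (sc c) ` D) (f b \<circ> chart_inv (sc c))" by (rule insert.prems) simp
    have fb: "smooth_fun (slit_atlas A) D (f b)"
      by (rule slit.smooth_fun_chartI[OF sc_in[OF c] D o sb])
    have v1: "vsmooth A D (vert c (\<lambda>z. f b z *\<^sub>R b))"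
      using smooth_on_scaleR[OF sb smooth_on_const[of _ b] o] by (intro vsmooth_vert[OF c oD D]) (simp add: o_def)
    have eq1: "f b z *\<^sub>T vert c (\<lambda>_. b) z = vert c (\<lambda>z. f b z *\<^sub>R b) z" if "z \<in> D" for z
    proof -
      have z: "z \<in> fst (sc c)" using that D by blast
      show ?thesis
        by (rule slit.tangent_eqI[OF slit.tscale_in[OF vertical_tangent[OF vert_vertical[OF c z]]]
              vertical_tangent[OF vert_vertical[OF c z]] sc_in[OF c] z])
           (simp add: vert_components[OF c z])
    qed
    have v2: "vsmooth A D (\<lambda>z. f b z *\<^sub>T vert c (\<lambda>_. b) z)" by (rule vsmooth_cong[OF oD v1 eq1])
    have "smooth_on (snd (sc c) ` D) (\<lambda>x. \<Sum>b\<in>F. (f b \<circ> chart_inv (sc c)) x *\<^sub>R b)"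
      by (rule smooth_on_sum[OF smooth_on_scaleR[OF insert.prems smooth_on_const o] o]) simp
    then have v3: "vsmooth A D ?t" by (intro vsmooth_vert[OF c oD D]) (simp add: o_def)
    have "smooth_on (snd (sc c) ` D) (\<lambda>x. \<Sum>b\<in>insert b F. (f b \<circ> chart_inv (sc c)) x *\<^sub>R b)"
      by (rule smooth_on_sum[OF smooth_on_scaleR[OF insert.prems smooth_on_const o] o])
    then have v4: "vsmooth A D (vert c (\<lambda>z. \<Sum>b\<in>insert b F. f b z *\<^sub>R b))"
      by (intro vsmooth_vert[OF c oD D]) (simp add: o_def)
    have "nabla \<xi> (vert c (\<lambda>z. \<Sum>b\<in>insert b F. f b z *\<^sub>R b)) =
       nabla \<xi> (\<lambda>z. f b z *\<^sub>T vert c (\<lambda>_. b) z +\<^sub>T ?t z)"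
    proof (rule nabla_cong[OF oD w v4 \<xi>, symmetric])
      fix z assume "z \<in> D"
      then have z: "z \<in> fst (sc c)" using D by blast
      show "f b z *\<^sub>T vert c (\<lambda>_. b) z +\<^sub>T ?t z = vert c (\<lambda>z. \<Sum>b\<in>insert b F. f b z *\<^sub>R b) z"
        by (rule slit.tangent_eqI[OF slit.tadd_in[OF slit.tscale_in[OF vertical_tangent[OF vert_vertical[OF c z]]]
              vertical_tangent[OF vert_vertical[OF c z]]] vertical_tangent[OF vert_vertical[OF c z]] sc_in[OF c] z])
           (use insert.hyps in \<open>simp add: vert_components[OF c z]\<close>)
    qed
    then show ?case
      using nabla_add[OF oD w v2 v3 \<xi>] nabla_Leibniz[OF oD w vc fb \<xi>, of b] insert
        vert_components[OF c wc, of "\<lambda>_. b"]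
      by (simp add: nabla_const_def)
  }
qed

text \<open>After restriction to the chart domain the section is the combination of constant frame
  fields whose coefficients are its own fibre components. Differentiating these coefficients gives
  the \<open>FD\<close> term, and differentiating the frame gives \<open>conn\<close>.\<close>

lemma nabla_components:
  assumes c: "c \<in> A" "fst w \<in> fst c" and oD: "openin (mtop (slit_atlas A)) D" and w: "w \<in> slit A" "w \<in> D"
    and s: "vsmooth A D s" and \<xi>: "\<xi> \<in> tangent_space (slit_atlas A) w"
  shows "snd (nabla \<xi> s) (sc c) = (0, FD (\<lambda>z. snd (vf_rep (sc c) s z)) (snd (sc c) w) (snd \<xi> (sc c))
      + conn c \<xi> (snd (snd (s w) (sc c))))"
proof -
  let ?z = "snd (sc c) w"
  define D' where "D' = D \<inter> fst (sc c)"
  have oD': "openin (mtop (slit_atlas A)) D'"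
    unfolding D'_def by (rule openin_Int[OF oD slit.openin_chart[OF sc_in[OF c(1)]]])
  have D': "D' \<subseteq> fst (sc c)" "w \<in> D'" using w sc_mem[OF w(1) c(2)] by (auto simp: D'_def)
  have s': "vsmooth A D' s" by (rule vsmooth_subset[OF s]) (simp add: D'_def)
  define f where "f b z = snd (snd (s z) (sc c)) \<bullet> b" for b z
  have eqf: "f b \<circ> chart_inv (sc c) = (\<lambda>x. snd (vf_rep (sc c) s x) \<bullet> b)" for b
    by (simp add: f_def vf_rep_def fun_eq_iff)
  have o: "open (snd (sc c) ` D')"
    using slit.open_image[OF oD' sc_in[OF c(1)]] D'(1) by (simp add: Int_absorb2)
  have sm: "smooth_on (snd (sc c) ` D') (\<lambda>x. snd (vf_rep (sc c) s x))"
    using slit.smooth_vf_rep[of D' s "sc c", OF _ sc_in[OF c(1)]] s' D'(1)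
    by (intro smooth_on_snd o) (simp add: vsmooth_def Int_absorb2)
  have zD': "?z \<in> snd (sc c) ` D'" using D'(2) by simp
  have smf: "smooth_on (snd (sc c) ` D') (f b \<circ> chart_inv (sc c))" for b
    unfolding eqf by (rule smooth_on_inner[OF sm o])
  have "vert c (\<lambda>z. \<Sum>b\<in>Basis. f b z *\<^sub>R b) z = s z" if "z \<in> D'" for z
    using that s' D'(1) by (intro vert_eqI[OF _ c(1)]) (auto simp: vsmooth_def f_def euclidean_representation)
  then have "nabla \<xi> (vert c (\<lambda>z. \<Sum>b\<in>Basis. f b z *\<^sub>R b)) = nabla \<xi> s"
    by (rule nabla_cong[OF oD' D'(2) s' \<xi>])
  then have "snd (snd (nabla \<xi> s) (sc c)) =
     (\<Sum>b\<in>Basis. dir_deriv (slit_atlas A) \<xi> (f b) *\<^sub>R b + f b w *\<^sub>R nabla_const c \<xi> b)"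
    using nabla_vert_sum[OF c(1) oD' D' \<xi> finite_Basis, of f] smf by simp
  moreover have "dir_deriv (slit_atlas A) \<xi> (f b) = FD (\<lambda>z. snd (vf_rep (sc c) s z)) ?z (snd \<xi> (sc c)) \<bullet> b" for b
  proof -
    have D: "((f b \<circ> chart_inv (sc c)) has_derivative
        (\<lambda>h. FD (\<lambda>z. snd (vf_rep (sc c) s z)) ?z h \<bullet> b)) (at ?z)"
      unfolding eqf by (intro has_derivative_inner_left smooth_on_has_derivative[OF sm zD'])
    show ?thesis
      using slit.dir_deriv_chart[OF \<xi> sc_in[OF c(1)] sc_mem[OF w(1) c(2)], of "f b"] D FD_eqI[OF D]
      unfolding differentiable_def by auto
  qed
  ultimately have "snd (snd (nabla \<xi> s) (sc c)) = FD (\<lambda>z. snd (vf_rep (sc c) s z)) ?z (snd \<xi> (sc c))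
      + conn c \<xi> (snd (snd (s w) (sc c)))"
    by (simp add: sum.distrib euclidean_representation conn_def f_def)
  moreover have "fst (snd (nabla \<xi> s) (sc c)) = 0"
    using vertical_iff[OF vertical_tangent w(1) c] nabla_vertical[OF oD w(2) s \<xi>] by blast
  ultimately show ?thesis by (simp add: prod_eq_iff)
qed

text \<open>The canonical field has fibre component \<open>y\<close>, whose derivative along \<xi>
  is the fibre component of \<xi>. Subtracting it from the vertical part required of a lift leaves
  only the \<open>hor\<close> term.\<close>

lemma conn_position:
  assumes w: "w \<in> slit A" and c: "c \<in> A" "fst w \<in> fst c" and \<xi>: "\<xi> \<in> tangent_space (slit_atlas A) w"
  shows "conn c \<xi> (snd w c) = - hor c (snd (sc c) w) (fst (snd \<xi> (sc c)))"
proof -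
  have z: "snd (sc c) w \<in> cdom c" by (rule cdom_mem[OF w c(2)])
  have "FD (\<lambda>z. snd (vf_rep (sc c) (canonical_vf A) z)) (snd (sc c) w) = FD snd (snd (sc c) w)"
  proof (rule FD_cong[OF open_cdom[OF c(1)] z])
    fix y assume "y \<in> cdom c"
    then obtain v where v: "v \<in> slit A" "fst v \<in> fst c" "y = snd (sc c) v" by (rule cdomE)
    then show "snd (vf_rep (sc c) (canonical_vf A) y) = snd y"
      by (simp add: vf_rep_sc[OF c(1)] canonical_props(2)[OF v(1) c(1) v(2)]) (simp add: snd_slit_chart)
  qed
  also have "\<dots> = snd"
    by (rule FD_eqI) (simp add: bounded_linear_snd bounded_linear_imp_has_derivative)
  finally show ?thesis
    using nabla_components[OF c openin_slit w w vsmooth_canonical \<xi>] nabla_canonical[OF w \<xi>]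
      vertical_part_props(2)[OF \<xi> w c] canonical_props(2)[OF w c]
    by simp
qed

lemma vendo_FD:
  assumes c: "c \<in> A" and oD: "openin (mtop (slit_atlas A)) D" and D: "D \<subseteq> slit A"
    and Y: "smooth_vf (slit_atlas A) D Y" and w: "w \<in> D" "fst w \<in> fst c"
  shows "FD (\<lambda>z. snd (vf_rep (sc c) (\<lambda>z. vendo A (Y z)) z)) (snd (sc c) w) h
    = fst (FD (vf_rep (sc c) Y) (snd (sc c) w) h)"
proof -
  have ws: "w \<in> slit A" using w D by blast
  have o: "open (snd (sc c) ` (D \<inter> fst (sc c)))" by (rule slit.open_image[OF oD sc_in[OF c]])
  have z: "snd (sc c) w \<in> snd (sc c) ` (D \<inter> fst (sc c))" using w sc_mem[OF ws w(2)] by blast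
  have "FD (\<lambda>z. snd (vf_rep (sc c) (\<lambda>z. vendo A (Y z)) z)) (snd (sc c) w)
      = FD (\<lambda>z. fst (vf_rep (sc c) Y z)) (snd (sc c) w)"
  proof (rule FD_cong[OF o z])
    fix y assume "y \<in> snd (sc c) ` (D \<inter> fst (sc c))"
    then obtain v where v: "v \<in> D" "v \<in> slit A" "fst v \<in> fst c" "y = snd (sc c) v" by (rule sc_imageE)
    then show "snd (vf_rep (sc c) (\<lambda>z. vendo A (Y z)) y) = fst (vf_rep (sc c) Y y)"
      using vendo_props(2)[OF slit.smooth_vf_in[OF Y v(1)] v(2) c v(3)]
      by (simp add: vf_rep_sc[OF c])
  qed
  also have "\<dots> = (\<lambda>h. fst (FD (vf_rep (sc c) Y) (snd (sc c) w) h))"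
    by (intro FD_eqI has_derivative_fst smooth_on_has_derivative[OF slit.smooth_vf_rep[OF Y sc_in[OF c]] z])
  finally show ?thesis by simp
qed

text \<open>The torsion condition is only imposed on global fields, so a bump function is needed to extend
  the tangent vector \<open>u\<close>.\<close>

lemma conn_spray:
  assumes H: "Hausdorff_space (mtop A)"
    and torsion: "\<And>Y w. smooth_vf (slit_atlas A) (slit A) Y \<Longrightarrow> w \<in> slit A \<Longrightarrow>
                    torsion A nabla S Y w = tzero w"
    and w: "w \<in> slit A" and c: "c \<in> A" "fst w \<in> fst c"
  shows "conn c (S w) u = - hor c (snd (sc c) w) u"
proof -
  obtain f :: "'e \<Rightarrow> real" and N where f: "smooth_on UNIV f" "f (snd c (fst w)) \<noteq> 0"
    and N: "openin (mtop A) N" "topspace (mtop A) \<subseteq> fst c \<union> N"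
    and fN: "\<And>q. q \<in> fst c \<inter> N \<Longrightarrow> f (snd c q) = 0"
    using chart_bump[OF H c] by blast
  \<comment> \<open>The cut-off multiple of \<open>u\<close> serves as base component and the fibre
    component is 0, so that \<open>Y\<close> contributes no fibre term to the bracket with
    \<open>S\<close>.\<close>
  define Y where "Y z = (if z \<in> fst (sc c)
      then tvec_of (slit_atlas A) (sc c) z (f (snd c (fst z)) *\<^sub>R u, 0) else tzero z)" for z
  let ?z = "snd (sc c) w" and ?y = "f (snd c (fst w)) *\<^sub>R u"
  have wc: "w \<in> fst (sc c)" by (rule sc_mem[OF w c(2)])
  have Ycomp: "snd (Y z) (sc c) = (f (snd c (fst z)) *\<^sub>R u, 0)" if "z \<in> fst (sc c)" for z
    using slit.snd_tvec_of[OF sc_in[OF c(1)] that] that by (simp add: Y_def)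
  have Yin: "Y z \<in> tangent_space (slit_atlas A) z" if "z \<in> fst (sc c)" for z
    using slit.tvec_of_in[OF sc_in[OF c(1)] that] that by (simp add: Y_def)
  have Y1: "smooth_vf (slit_atlas A) (fst (sc c)) Y"
  proof (rule slit.smooth_vf_chartI[OF sc_in[OF c(1)] order_refl open_cdom[OF c(1)] Yin])
    have "smooth_on (cdom c) (\<lambda>z. f (fst z))"
      by (rule smooth_on_compose[OF smooth_on_bounded_linear[OF bounded_linear_fst] f(1) open_cdom[OF c(1)]]) simp
    then have "smooth_on (cdom c) (\<lambda>z. (f (fst z) *\<^sub>R u, 0::'e))"
      by (intro smooth_on_Pair[OF smooth_on_scaleR[OF _ smooth_on_const open_cdom[OF c(1)]]
            smooth_on_const open_cdom[OF c(1)]])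
    moreover have "vf_rep (sc c) Y z = (f (fst z) *\<^sub>R u, 0)" if z: "z \<in> cdom c" for z
    proof -
      obtain v where v: "v \<in> slit A" "fst v \<in> fst c" "z = snd (sc c) v" using z by (rule cdomE)
      then show ?thesis
        using Ycomp[OF sc_mem[OF v(1,2)]] by (simp add: vf_rep_sc[OF c(1)]) (simp add: snd_slit_chart)
    qed
    ultimately show "smooth_on (cdom c) (vf_rep (sc c) Y)"
      using smooth_on_cong[OF open_cdom[OF c(1)]] by (metis (no_types, lifting))
  qed
  have Y2: "smooth_vf (slit_atlas A) (over N) Y"
  proof (rule slit.smooth_vf_cong[OF openin_over[OF N(1)] slit.smooth_vf_tzero[OF openin_over[OF N(1)]]])
    fix z assume z: "z \<in> over N"
    show "Y z = tzero z"
    proof (cases "z \<in> fst (sc c)")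
      case True
      then have "f (snd c (fst z)) = 0" using z fN by (simp add: mem_slit_chart)
      then show ?thesis using Ycomp[OF True]
        by (intro slit.tangent_eqI[OF Yin[OF True] slit.tzero_in sc_in[OF c(1)] True]) (simp add: zero_prod_def)
    qed (simp add: Y_def)
  qed
  have "smooth_vf (slit_atlas A) (fst (sc c) \<union> over N) Y"
    by (rule slit.smooth_vf_Un[OF slit.openin_chart[OF sc_in[OF c(1)]] openin_over[OF N(1)] Y1 Y2])
  moreover have "slit A \<subseteq> fst (sc c) \<union> over N"
  proof
    fix z assume z: "z \<in> slit A"
    then obtain d where "d \<in> A" "fst z \<in> fst d" using slit_chart_ex by blast
    then have "fst z \<in> topspace (mtop A)" using openin_subset[OF openin_chart] by blast
    then show "z \<in> fst (sc c) \<union> over N" using N(2) z by (auto simp: mem_slit_chart)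
  qed
  ultimately have Y: "smooth_vf (slit_atlas A) (slit A) Y" by (rule slit.smooth_vf_subset)
  have Sw: "S w \<in> tangent_space (slit_atlas A) w" by (rule slit.smooth_vf_in[OF S_smooth w])
  have br: "lie_bracket (slit_atlas A) S Y w \<in> tangent_space (slit_atlas A) w"
    by (rule slit.lie_bracket_in[OF openin_slit S_smooth Y w])
  have 1: "snd (nabla (S w) (\<lambda>z. vendo A (Y z))) (sc c)
     = (0, fst (FD (vf_rep (sc c) Y) ?z (snd (S w) (sc c))) + conn c (S w) ?y)"
    using nabla_components[OF c openin_slit w w vsmooth_vendo[OF openin_slit order_refl Y] Sw]
      vendo_FD[OF c(1) openin_slit order_refl Y w c(2)] vendo_props(2)[OF Yin[OF wc] w c] Ycomp[OF wc]
    by simp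
  \<comment> \<open>As \<open>S\<close> is a spray, \<open>vendo\<close> maps it to the canonical
    field, so the lift condition evaluates this term of the torsion.\<close>
  have "nabla (Y w) (\<lambda>z. vendo A (S z)) = nabla (Y w) (canonical_vf A)"
    by (rule nabla_cong[OF openin_slit w vsmooth_canonical Yin[OF wc]]) (use spray in \<open>simp add: spray_def\<close>)
  then have 2: "snd (nabla (Y w) (\<lambda>z. vendo A (S z))) (sc c) = (0, - hor c ?z ?y)"
    using nabla_canonical[OF w Yin[OF wc]] vertical_part_props(2)[OF Yin[OF wc] w c] Ycomp[OF wc] by simp
  have 3: "snd (vendo A (lie_bracket (slit_atlas A) S Y w)) (sc c)
     = (0, fst (FD (vf_rep (sc c) Y) ?z (snd (S w) (sc c))))"
    using vendo_props(2)[OF br w c] sc_in[OF c(1)] wc Ycomp[OF wc]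
    by (simp add: lie_bracket_def S_FD[OF c(1) cdom_mem[OF w c(2)]])
  \<comment> \<open>The derivative of \<open>Y\<close> along \<open>S\<close> occurs in
    \<open>1\<close> and in \<open>3\<close> and cancels; the nonzero factor \<open>f\<close> at the
    base point is then divided out.\<close>
  have "snd (torsion A nabla S Y w) (sc c) = 0" using torsion[OF Y w] by simp
  then have "conn c (S w) ?y + hor c ?z ?y = 0"
    by (simp add: torsion_def 1 2 3 zero_prod_def)
  then have "f (snd c (fst w)) *\<^sub>R (conn c (S w) u + hor c ?z u) = 0"
    by (simp add: linear_scale[OF conn_linear] linear_scale[OF hor_linear[OF c(1) cdom_mem[OF w c(2)]]]
        scaleR_add_right)
  then show ?thesis using f(2) by (simp add: add_eq_0_iff2)
qed

section \<open>The affine connections and the curvature endomorphism\<close>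

text \<open>The fibre components of a vertical lift do not depend on the fibre variable. The
  derivative term therefore sees only the base part \<open>u\<close> of the horizontal direction and
  is the ordinary derivative of \<open>V\<close>.\<close>

lemma dir_affine_props:
  assumes oD: "openin (mtop A) D" and V: "smooth_vf A D V" and w: "w \<in> slit A" "fst w \<in> D"
    and u: "u \<in> tangent_space A (fst w)"
  shows "dir_affine A S nabla w u V \<in> tangent_space A (fst w)"
    and "\<And>c. c \<in> A \<Longrightarrow> fst w \<in> fst c \<Longrightarrow> snd (dir_affine A S nabla w u V) c =
       FD (vf_rep c V) (snd c (fst w)) (snd u c) + conn c (hlift A S w u) (snd (V (fst w)) c)"
proof -
  have wo: "w \<in> over D" using w by simp
  have rep: "vf_rep (sc c) (vlift A V) (snd (sc c) v) = (0, vf_rep c V (fst (snd (sc c) v)))"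
    if v: "v \<in> over D" "fst v \<in> fst c" and c: "c \<in> A" for v c
  proof -
    have vs: "v \<in> slit A" and Vv: "V (fst v) \<in> tangent_space A (fst v)"
      using v smooth_vf_in[OF V] by auto
    have "vf_rep (sc c) (vlift A V) (snd (sc c) v) = (0, snd (V (fst v)) c)"
      unfolding vf_rep_sc[OF c vs v(2)] vlift_def by (rule ilift_props(1)[OF vs Vv c v(2)])
    also have "snd (V (fst v)) c = vf_rep c V (fst (snd (sc c) v))"
      using v(2) c by (simp add: vf_rep_def snd_slit_chart)
    finally show ?thesis .
  qed
  have sV: "vsmooth A (over D) (vlift A V)"
    unfolding vsmooth_def smooth_vf_def
  proof (intro conjI ballI)
    show v: "vlift A V z \<in> vertical_space A z" if "z \<in> over D" for z
      unfolding vlift_def using that by (intro ilift_vertical smooth_vf_in[OF V]) auto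
    then show "vlift A V z \<in> tangent_space (slit_atlas A) z" if "z \<in> over D" for z
      using that vertical_tangent by blast
    fix k assume k: "k \<in> slit_atlas A"
    then obtain c where c: "c \<in> A" "k = sc c" by (rule slit_atlasE)
    let ?U = "snd k ` (over D \<inter> fst k)"
    have o: "open ?U" by (rule slit.open_image[OF openin_over[OF oD] k])
    have sub: "fst ` ?U \<subseteq> snd c ` (D \<inter> fst c)"
      unfolding c(2) by (auto simp: mem_slit_chart snd_slit_chart)
    have "smooth_on ?U (\<lambda>z. (0::'e, vf_rep c V (fst z)))"
      by (rule smooth_on_Pair[OF smooth_on_const smooth_on_compose[OF smooth_on_bounded_linear[OF bounded_linear_fst]
              smooth_vf_rep[OF V c(1)] o sub] o])
    moreover have "vf_rep k (vlift A V) z = (0, vf_rep c V (fst z))" if z: "z \<in> ?U" for z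
    proof -
      obtain v where v: "v \<in> over D" "v \<in> slit A" "fst v \<in> fst c" "z = snd (sc c) v"
        using z unfolding c(2) by (rule sc_imageE)
      show ?thesis unfolding v(4) c(2) by (rule rep[OF v(1,3) c(1)])
    qed
    ultimately show "smooth_on ?U (vf_rep k (vlift A V))"
      using smooth_on_cong[OF o] by (metis (no_types, lifting))
  qed
  have h: "hlift A S w u \<in> tangent_space (slit_atlas A) w" by (rule hlift_props(1)[OF w(1) u])
  have v: "nabla (hlift A S w u) (vlift A V) \<in> vertical_space A w"
    by (rule nabla_vertical[OF openin_over[OF oD] wo sV h])
  show "dir_affine A S nabla w u V \<in> tangent_space A (fst w)"
    unfolding dir_affine_def by (rule ilift_inv_props(1)[OF v w(1)])
  fix c assume c: "c \<in> A" "fst w \<in> fst c"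
  let ?z = "snd (sc c) w" and ?U = "snd (sc c) ` (over D \<inter> fst (sc c))"
  have o: "open ?U" by (rule slit.open_image[OF openin_over[OF oD] sc_in[OF c(1)]])
  have z: "?z \<in> ?U" using wo sc_mem[OF w(1) c(2)] by blast
  have fz: "fst ?z = snd c (fst w)" by (simp add: snd_slit_chart)
  have "FD (\<lambda>z. snd (vf_rep (sc c) (vlift A V) z)) ?z = FD (\<lambda>z. vf_rep c V (fst z)) ?z"
  proof (rule FD_cong[OF o z])
    fix y assume "y \<in> ?U"
    then obtain v where v: "v \<in> over D" "v \<in> slit A" "fst v \<in> fst c" "y = snd (sc c) v"
      by (rule sc_imageE)
    show "snd (vf_rep (sc c) (vlift A V) y) = vf_rep c V (fst y)"
      unfolding v(4) rep[OF v(1,3) c(1)] by simp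
  qed
  also have "\<dots> = (\<lambda>h. FD (vf_rep c V) (snd c (fst w)) (fst h))"
  proof (rule FD_eqI[OF has_derivative_compose[where f = fst and f' = fst and g = "vf_rep c V"]])
    show "(fst has_derivative fst) (at ?z)"
      by (simp add: bounded_linear_fst bounded_linear_imp_has_derivative)
    have "snd c (fst w) \<in> snd c ` (D \<inter> fst c)" using w(2) c(2) by simp
    then show "(vf_rep c V has_derivative FD (vf_rep c V) (snd c (fst w))) (at (fst ?z))"
      unfolding fz by (rule smooth_on_has_derivative[OF smooth_vf_rep[OF V c(1)]])
  qed
  finally have F: "FD (\<lambda>z. snd (vf_rep (sc c) (vlift A V) z)) ?z = (\<lambda>h. FD (vf_rep c V) (snd c (fst w)) (fst h))" .
  show "snd (dir_affine A S nabla w u V) c =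
       FD (vf_rep c V) (snd c (fst w)) (snd u c) + conn c (hlift A S w u) (snd (V (fst w)) c)"
    using ilift_inv_props(2)[OF v w(1) c] nabla_components[OF c openin_over[OF oD] w(1) wo sV h]
      hlift_props(2)[OF w(1) u c] ilift_props(1)[OF w(1) smooth_vf_in[OF V w(2)] c]
    unfolding dir_affine_def F by (simp add: vlift_def)
qed

text \<open>All three derivatives in the curvature act on the canonical field, so the inner ones are
  vertical parts and are known explicitly. The extension \<open>X\<close> enters through its
  derivative \<open>?E\<close> along \<open>S\<close>, which drops out in the end.\<close>

lemma curvature_endo_props:
  assumes w: "w \<in> slit A" and u: "u \<in> tangent_space A (fst w)"
  shows "curvature_endo A S nabla w u \<in> tangent_space A (fst w)"
    and "\<And>c. c \<in> A \<Longrightarrow> fst w \<in> fst c \<Longrightarrow> snd (curvature_endo A S nabla w u) c =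
      (1/2) *\<^sub>R FD (\<lambda>y. FD (sp c) y (0, snd u c)) (snd (sc c) w) (snd w c, sp c (snd (sc c) w))
      - FD (sp c) (snd (sc c) w) (snd u c, hor c (snd (sc c) w) (snd u c))
      + hor c (snd (sc c) w) (hor c (snd (sc c) w) (snd u c))"
proof -
  obtain c0 where c0: "c0 \<in> A" "fst w \<in> fst c0" using slit_chart_ex[OF w] by blast
  have h: "hlift A S w u \<in> tangent_space (slit_atlas A) w" by (rule hlift_props(1)[OF w u])
  define X where "X = local_ext (slit_atlas A) (hlift A S w u)"
  obtain D0 where D0: "openin (mtop (slit_atlas A)) D0" "w \<in> D0" "smooth_vf (slit_atlas A) D0 X"
    "X w = hlift A S w u"
    using slit.local_ext_props[OF h sc_in[OF c0(1)] sc_mem[OF w c0(2)]] unfolding X_def .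
  define D where "D = D0 \<inter> slit A"
  have oD: "openin (mtop (slit_atlas A)) D" and wD: "w \<in> D" and DS: "D \<subseteq> slit A"
    using D0 w openin_slit by (auto simp: D_def)
  have X: "smooth_vf (slit_atlas A) D X"
    by (rule slit.smooth_vf_subset[OF D0(3)]) (simp add: D_def)
  have SD: "smooth_vf (slit_atlas A) D S" by (rule slit.smooth_vf_subset[OF S_smooth DS])
  have CD: "vsmooth A D (canonical_vf A)" by (rule vsmooth_subset[OF vsmooth_canonical DS])
  have br: "lie_bracket (slit_atlas A) S X w \<in> tangent_space (slit_atlas A) w"
    by (rule slit.lie_bracket_in[OF oD SD X wD])
  have Sw: "S w \<in> tangent_space (slit_atlas A) w" by (rule slit.smooth_vf_in[OF S_smooth w])
  have Xw: "X w \<in> tangent_space (slit_atlas A) w" by (rule slit.smooth_vf_in[OF X wD])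
  have sX: "vsmooth A D (\<lambda>z. nabla (X z) (canonical_vf A))" by (rule nabla_smooth[OF oD X CD])
  have sS: "vsmooth A D (\<lambda>z. nabla (S z) (canonical_vf A))" by (rule nabla_smooth[OF oD SD CD])
  have v: "curvature A nabla S X (canonical_vf A) w \<in> vertical_space A w"
    unfolding curvature_def
    by (intro vertical_tdiff w nabla_vertical[OF oD wD CD br] nabla_vertical[OF oD wD sX Sw]
        nabla_vertical[OF oD wD sS Xw])
  have ce: "curvature_endo A S nabla w u = ilift_inv A w (curvature A nabla S X (canonical_vf A) w)"
    by (simp add: curvature_endo_def X_def)
  show "curvature_endo A S nabla w u \<in> tangent_space A (fst w)"
    unfolding ce by (rule ilift_inv_props(1)[OF v w])
  fix c assume c: "c \<in> A" "fst w \<in> fst c"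
  let ?z = "snd (sc c) w" and ?R = "vf_rep (sc c) X" and ?U = "snd (sc c) ` (D \<inter> fst (sc c))"
  let ?\<sigma> = "(snd w c, sp c ?z)" and ?u = "snd u c"
  let ?E = "FD ?R ?z ?\<sigma>"
  have zc: "?z \<in> cdom c" by (rule cdom_mem[OF w c(2)])
  have o: "open ?U" by (rule slit.open_image[OF oD sc_in[OF c(1)]])
  have zU: "?z \<in> ?U" using wD sc_mem[OF w c(2)] by blast
  have DR: "(?R has_derivative FD ?R ?z) (at ?z)"
    by (rule smooth_on_has_derivative[OF slit.smooth_vf_rep[OF X sc_in[OF c(1)]] zU])
  have Xc: "snd (X w) (sc c) = (?u, hor c ?z ?u)" unfolding D0(4) by (rule hlift_props(2)[OF w u c])
  have Rz: "?R ?z = (?u, hor c ?z ?u)" using Xc by (simp add: vf_rep_sc[OF c(1) w c(2)])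
  note Sc = S_components[OF w c]
  have lin: "linear (hor c ?z)" by (rule hor_linear[OF c(1) zc])

  have brc: "snd (lie_bracket (slit_atlas A) S X w) (sc c) =
     (fst ?E - hor c ?z ?u, snd ?E - FD (sp c) ?z (?u, hor c ?z ?u))"
    using sc_in[OF c(1)] sc_mem[OF w c(2)]
    by (simp add: lie_bracket_def Sc Xc S_FD[OF c(1) zc] prod_eq_iff)
  have 1: "snd (nabla (lie_bracket (slit_atlas A) S X w) (canonical_vf A)) (sc c) =
     (0, snd ?E - FD (sp c) ?z (?u, hor c ?z ?u) - (hor c ?z (fst ?E) - hor c ?z (hor c ?z ?u)))"
    unfolding nabla_canonical[OF w br] vertical_part_props(2)[OF br w c] brc
    by (simp add: linear_diff[OF lin])

  have "FD (\<lambda>z. snd (vf_rep (sc c) (\<lambda>z. nabla (X z) (canonical_vf A)) z)) ?z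
      = FD (\<lambda>z. snd (?R z) - hor c z (fst (?R z))) ?z"
  proof (rule FD_cong[OF o zU])
    fix y assume "y \<in> ?U"
    then obtain v where v: "v \<in> D" "v \<in> slit A" "fst v \<in> fst c" "y = snd (sc c) v"
      by (rule sc_imageE)
    have Xv: "X v \<in> tangent_space (slit_atlas A) v" by (rule slit.smooth_vf_in[OF X v(1)])
    show "snd (vf_rep (sc c) (\<lambda>z. nabla (X z) (canonical_vf A)) y) = snd (?R y) - hor c y (fst (?R y))"
      unfolding v(4) vf_rep_sc[OF c(1) v(2,3)] nabla_canonical[OF v(2) Xv]
        vertical_part_props(2)[OF Xv v(2) c(1) v(3)] by simp
  qed
  also have "\<dots> = (\<lambda>h. snd (FD ?R ?z h) -
      ((1/2) *\<^sub>R FD (\<lambda>y. FD (sp c) y (0, fst (?R ?z))) ?z h + hor c ?z (fst (FD ?R ?z h))))"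
    by (rule FD_eqI[OF has_derivative_diff[OF has_derivative_snd[OF DR]
            hor_has_derivative[OF c(1) zc has_derivative_ident has_derivative_fst[OF DR]]]])
  finally have F: "FD (\<lambda>z. snd (vf_rep (sc c) (\<lambda>z. nabla (X z) (canonical_vf A)) z)) ?z ?\<sigma> = snd ?E -
      ((1/2) *\<^sub>R FD (\<lambda>y. FD (sp c) y (0, ?u)) ?z ?\<sigma> + hor c ?z (fst ?E))"
    by (simp add: Rz)
  \<comment> \<open>\<open>X w\<close> is horizontal, so the inner derivative vanishes at
    \<open>w\<close> and the connection form of the outer one is applied to 0.\<close>
  have "snd (snd (nabla (X w) (canonical_vf A)) (sc c)) = 0"
    unfolding nabla_canonical[OF w Xw] vertical_part_props(2)[OF Xw w c] Xc by simp
  then have 2: "snd (nabla (S w) (\<lambda>z. nabla (X z) (canonical_vf A))) (sc c) = (0, snd ?E -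
      ((1/2) *\<^sub>R FD (\<lambda>y. FD (sp c) y (0, ?u)) ?z ?\<sigma> + hor c ?z (fst ?E)))"
    using nabla_components[OF c oD w wD sX Sw] F by (simp add: Sc linear_0[OF conn_linear])

  \<comment> \<open>Here the inner derivative vanishes not only at \<open>w\<close> but on all of
    \<open>D\<close>, since \<open>S\<close> is horizontal everywhere.\<close>
  have "FD (\<lambda>z. snd (vf_rep (sc c) (\<lambda>z. nabla (S z) (canonical_vf A)) z)) ?z = FD (\<lambda>z. 0) ?z"
  proof (rule FD_cong[OF o zU])
    fix y assume "y \<in> ?U"
    then obtain v where v: "v \<in> D" "v \<in> slit A" "fst v \<in> fst c" "y = snd (sc c) v"
      by (rule sc_imageE)
    have Sv: "S v \<in> tangent_space (slit_atlas A) v" by (rule slit.smooth_vf_in[OF SD v(1)])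
    show "snd (vf_rep (sc c) (\<lambda>z. nabla (S z) (canonical_vf A)) y) = 0"
      unfolding v(4) vf_rep_sc[OF c(1) v(2,3)] nabla_canonical[OF v(2) Sv]
        vertical_part_S[OF v(2) c(1) v(3)] by simp
  qed
  moreover have "snd (nabla (S w) (canonical_vf A)) (sc c) = 0"
    unfolding nabla_canonical[OF w Sw] by (rule vertical_part_S[OF w c])
  ultimately have 3: "snd (nabla (X w) (\<lambda>z. nabla (S z) (canonical_vf A))) (sc c) = (0, 0)"
    using nabla_components[OF c oD w wD sS Xw] by (simp add: linear_0[OF conn_linear])

  have "snd (curvature_endo A S nabla w u) c = snd (snd (curvature A nabla S X (canonical_vf A) w) (sc c))"
    unfolding ce by (rule ilift_inv_props(2)[OF v w c])
  \<comment> \<open>Both components of \<open>?E\<close> cancel between \<open>1\<close> and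
    \<open>2\<close>, so the result is independent of the chosen extension.\<close>
  also have "\<dots> = (1/2) *\<^sub>R FD (\<lambda>y. FD (sp c) y (0, ?u)) ?z ?\<sigma>
      - FD (sp c) ?z (?u, hor c ?z ?u) + hor c ?z (hor c ?z ?u)"
    unfolding curvature_def snd_tdiff 1 2 3 by simp
  finally show "snd (curvature_endo A S nabla w u) c =
      (1/2) *\<^sub>R FD (\<lambda>y. FD (sp c) y (0, ?u)) ?z ?\<sigma>
      - FD (sp c) ?z (?u, hor c ?z ?u) + hor c ?z (hor c ?z ?u)" .
qed

section \<open>The geodesic condition for an integral curve\<close>

text \<open>The velocity of the curve is \<open>W\<close> along it, so in coordinates it is (x,
  W(x)), with derivative (w, DW(w)) at time 0. Being an integral curve of \<open>S\<close> makes
  this equal to (w, s).\<close>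

lemma geodesic_equation:
  assumes Op: "openin (mtop A) Op" and W: "smooth_vf A Op W"
    and Wn: "\<And>x. x \<in> Op \<Longrightarrow> W x \<in> slit A"
    and J: "open J" "(0::real) \<in> J"
    and curve: "integral_curve A Op W J \<gamma>" and geo: "geodesic A S J \<gamma>"
    and c: "c \<in> A" "\<gamma> 0 \<in> fst c"
  shows "FD (vf_rep c W) (snd c (\<gamma> 0)) (snd (W (\<gamma> 0)) c) = sp c (snd (sc c) (W (\<gamma> 0)))"
proof -
  have sc\<gamma>: "smooth_curve A J \<gamma>" and vel: "\<And>t. t \<in> J \<Longrightarrow> velocity A \<gamma> t = W (\<gamma> t)"
    and inOp: "\<And>t. t \<in> J \<Longrightarrow> \<gamma> t \<in> Op"
    using curve by (auto simp: integral_curve_def)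
  let ?N = "{t \<in> J. \<gamma> t \<in> fst c}"
  have "openin (top_of_set J) {t \<in> topspace (top_of_set J). \<gamma> t \<in> fst c}"
    using sc\<gamma> openin_chart[OF c(1)] unfolding smooth_curve_def continuous_map_def by blast
  then have oN: "open ?N" using J(1) by (simp add: openin_open_eq)
  have N0: "0 \<in> ?N" using J(2) c(2) by simp
  let ?x = "snd c \<circ> \<gamma>" and ?w = "snd (W (\<gamma> 0)) c"
  have "?x differentiable at 0"
    using sc\<gamma> c(1) N0 unfolding smooth_curve_def by (intro smooth_on_differentiable[of ?N]) auto
  then have "(?x has_vector_derivative vector_derivative ?x (at 0)) (at 0)"
    by (simp add: vector_derivative_works)
  moreover have "vector_derivative ?x (at 0) = ?w"
    using arg_cong[OF vel[OF J(2)], of "\<lambda>v. snd v c"] c by (simp add: velocity_def)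
  ultimately have Dx: "(?x has_derivative (\<lambda>t. t *\<^sub>R ?w)) (at 0)"
    by (simp add: has_vector_derivative_def)
  have "snd c (\<gamma> 0) \<in> snd c ` (Op \<inter> fst c)" using inOp[OF J(2)] c(2) by blast
  from smooth_on_has_derivative[OF smooth_vf_rep[OF W c(1)] this]
  have DW: "(vf_rep c W has_derivative FD (vf_rep c W) (snd c (\<gamma> 0))) (at (?x 0))" by simp
  have "((\<lambda>t. (?x t, vf_rep c W (?x t))) has_derivative
     (\<lambda>t. (t *\<^sub>R ?w, FD (vf_rep c W) (snd c (\<gamma> 0)) (t *\<^sub>R ?w)))) (at 0)"
    by (rule has_derivative_Pair[OF Dx has_derivative_compose[OF Dx DW]])
  \<comment> \<open>The identity holds for all \<open>t\<close> in an open set around 0, so it may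
    be differentiated; this is where the integral curve property at nearby times enters.\<close>
  moreover have "(?x t, vf_rep c W (?x t)) = (snd (sc c) \<circ> velocity A \<gamma>) t" if "t \<in> ?N" for t
    using that c(1) vel fst_tangent[OF smooth_vf_in[OF W inOp]] by (simp add: vf_rep_def snd_slit_chart)
  ultimately have "((snd (sc c) \<circ> velocity A \<gamma>) has_derivative
     (\<lambda>t. (t *\<^sub>R ?w, FD (vf_rep c W) (snd c (\<gamma> 0)) (t *\<^sub>R ?w)))) (at 0)"
    using has_derivative_transform_within_open[OF _ oN N0] by blast
  then have "((snd (sc c) \<circ> velocity A \<gamma>) has_vector_derivative
      (?w, FD (vf_rep c W) (snd c (\<gamma> 0)) ?w)) (at 0)"
    using linear_scale[OF has_derivative_linear[OF DW]] by (simp add: has_vector_derivative_def)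
  then have vd: "vector_derivative (snd (sc c) \<circ> velocity A \<gamma>) (at 0) = (?w, FD (vf_rep c W) (snd c (\<gamma> 0)) ?w)"
    by (rule vector_derivative_at)
  have w: "W (\<gamma> 0) \<in> slit A" "fst (W (\<gamma> 0)) = \<gamma> 0"
    using Wn[OF inOp[OF J(2)]] fst_tangent[OF smooth_vf_in[OF W inOp[OF J(2)]]] by auto
  have "velocity (slit_atlas A) (velocity A \<gamma>) 0 = S (W (\<gamma> 0))"
    using geo J(2) vel[OF J(2)] by (simp add: geodesic_def integral_curve_def)
  then have "snd (velocity (slit_atlas A) (velocity A \<gamma>) 0) (sc c) = (?w, sp c (snd (sc c) (W (\<gamma> 0))))"
    using S_components[OF w(1) c(1)] w(2) c(2) by simp
  then show ?thesis
    using sc_in[OF c(1)] sc_mem[OF w(1), of c] w(2) c(2) vd vel[OF J(2)] by (simp add: velocity_def)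
qed

section \<open>Comparison of the two curvatures\<close>

text \<open>The curve itself is no longer present: of the geodesic property only its first-order
  consequence at \<open>p\<close> is assumed.\<close>

lemma curvature_of_affine_connection:
  assumes H: "Hausdorff_space (mtop A)"
    and torsion: "\<And>Y w. smooth_vf (slit_atlas A) (slit A) Y \<Longrightarrow> w \<in> slit A \<Longrightarrow>
                    torsion A nabla S Y w = tzero w"
    and Op: "openin (mtop A) Op" and W: "smooth_vf A Op W" and U: "smooth_vf A Op U"
    and Wn: "\<And>x. x \<in> Op \<Longrightarrow> W x \<in> slit A" and p: "p \<in> Op"
    and geo: "\<And>c. c \<in> A \<Longrightarrow> p \<in> fst c \<Longrightarrow>
      FD (vf_rep c W) (snd c p) (snd (W p) c) = sp c (snd (sc c) (W p))"
  shows "affine_conn A S nabla W U (affine_conn A S nabla W W W) p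
    -\<^sub>T affine_conn A S nabla W W (affine_conn A S nabla W U W) p
    +\<^sub>T affine_conn A S nabla W (lie_bracket A W U) W p
    = curvature_endo A S nabla (W p) (U p)"
proof -
  obtain c where c: "c \<in> A" "p \<in> fst c" using topspace_chart openin_subset[OF Op] p by blast
  define D where "D = Op \<inter> fst c"
  have oD: "openin (mtop A) D" unfolding D_def by (rule openin_Int[OF Op openin_chart[OF c(1)]])
  have Dc: "D \<subseteq> fst c" and DO: "D \<subseteq> Op" and pD: "p \<in> D" using p c by (auto simp: D_def)
  have WD: "smooth_vf A D W" and UD: "smooth_vf A D U"
    using smooth_vf_subset[OF _ DO] W U by auto
  have o: "open (snd c ` D)" using open_image[OF oD c(1)] Dc by (simp add: Int_absorb2)
  define x W' U' where "x = snd c p" and "W' = vf_rep c W" and "U' = vf_rep c U"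
  define \<phi> where "\<phi> y = (y, W' y)" for y
  have smW: "smooth_on (snd c ` D) W'" and smU: "smooth_on (snd c ` D) U'"
    using smooth_vf_rep[OF WD c(1)] smooth_vf_rep[OF UD c(1)] Dc by (auto simp: W'_def U'_def Int_absorb2)
  have sm\<phi>: "smooth_on (snd c ` D) \<phi>"
    unfolding \<phi>_def[abs_def] by (rule smooth_on_Pair[OF smooth_on_ident smW o])
  have xD: "x \<in> snd c ` D" using pD by (simp add: x_def)
  have at: "W q \<in> slit A" "fst (W q) = q" "U q \<in> tangent_space A q" "W q \<in> tangent_space A q"
      "snd (W q) c = W' (snd c q)" "snd (U q) c = U' (snd c q)" "snd (sc c) (W q) = \<phi> (snd c q)"
      "\<phi> (snd c q) \<in> cdom c" if q: "q \<in> D" for q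
  proof -
    show w: "W q \<in> slit A" "fst (W q) = q" "U q \<in> tangent_space A q" "W q \<in> tangent_space A q"
      using q Wn DO smooth_vf_in[OF WD q] smooth_vf_in[OF UD q] fst_tangent[OF smooth_vf_in[OF WD q]] by auto
    have "q \<in> fst c" using q Dc by blast
    then show "snd (W q) c = W' (snd c q)" "snd (U q) c = U' (snd c q)" and e: "snd (sc c) (W q) = \<phi> (snd c q)"
      using c(1) w(2) by (simp_all add: W'_def U'_def \<phi>_def vf_rep_def snd_slit_chart)
    show "\<phi> (snd c q) \<in> cdom c"
      using cdom_mem[OF w(1), of c] \<open>q \<in> fst c\<close> by (simp add: w(2) e)
  qed
  have \<phi>im: "\<phi> ` snd c ` D \<subseteq> cdom c" using at(8) by blast
  have hor_sm: "smooth_on (snd c ` D) (\<lambda>y. hor c (\<phi> y) (U' y))"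
    unfolding hor_def
    by (rule smooth_on_scaleR[OF smooth_on_const smooth_on_FD_compose[OF sp_smooth[OF c(1)] sm\<phi> \<phi>im
            smooth_on_Pair[OF smooth_on_const smU o] o] o])

  \<comment> \<open>The torsion condition, at all points of \<open>D\<close>: the horizontal lift of
    \<open>W\<close> at \<open>W\<close> is \<open>S\<close>.\<close>
  have conn_W: "conn c (hlift A S (W q) (W q)) v = - hor c (\<phi> (snd c q)) v" if q: "q \<in> D" for q v
    using conn_spray[OF H torsion at(1)[OF q] c(1), of v] hlift_self[OF at(1)[OF q]] at(2,7)[OF q] q Dc by auto
  \<comment> \<open>The lift condition, in an arbitrary horizontal direction: the vector
    differentiated is the position \<open>W q\<close> itself.\<close>
  have conn_U: "conn c (hlift A S (W q) u) (snd (W q) c) = - hor c (\<phi> (snd c q)) (snd u c)"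
    if q: "q \<in> D" and u: "u \<in> tangent_space A q" for q u
  proof -
    have qc: "fst (W q) \<in> fst c" using q Dc at(2)[OF q] by auto
    have u': "u \<in> tangent_space A (fst (W q))" using u at(2)[OF q] by simp
    show ?thesis
      using conn_position[OF at(1)[OF q] c(1) qc hlift_props(1)[OF at(1)[OF q] u']]
        hlift_props(2)[OF at(1)[OF q] u' c(1) qc] at(7)[OF q] by simp
  qed
  have aff: "affine_conn A S nabla W Y V q \<in> tangent_space A q"
    "snd (affine_conn A S nabla W Y V q) c = FD (vf_rep c V) (snd c q) (snd (Y q) c)
       + conn c (hlift A S (W q) (Y q)) (snd (V q) c)"
    if q: "q \<in> D" and V: "smooth_vf A D V" and Y: "Y q \<in> tangent_space A q" for q V Y
  proof -
    have q': "fst (W q) \<in> D" "fst (W q) \<in> fst c" "Y q \<in> tangent_space A (fst (W q))"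
      using q Dc at(2)[OF q] Y by auto
    show "affine_conn A S nabla W Y V q \<in> tangent_space A q"
      using dir_affine_props(1)[OF oD V at(1)[OF q] q'(1,3)] at(2)[OF q] by (simp add: affine_conn_def)
    show "snd (affine_conn A S nabla W Y V q) c = FD (vf_rep c V) (snd c q) (snd (Y q) c)
       + conn c (hlift A S (W q) (Y q)) (snd (V q) c)"
      using dir_affine_props(2)[OF oD V at(1)[OF q] q'(1,3) c(1) q'(2)] at(2)[OF q]
      by (simp add: affine_conn_def)
  qed
  define Z Q where "Z = affine_conn A S nabla W W W" and "Q = affine_conn A S nabla W U W"
  have hor\<phi>: "hor c (\<phi> (snd c q)) (W' (snd c q)) = sp c (\<phi> (snd c q))" if q: "q \<in> D" for q
    using hor_position[OF at(1)[OF q] c(1)] at(2,5,7)[OF q] q Dc by auto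
  have Zq: "Z q \<in> tangent_space A q"
    "snd (Z q) c = FD W' (snd c q) (W' (snd c q)) - sp c (\<phi> (snd c q))" if q: "q \<in> D" for q
    using aff[where Y = W, OF q WD at(4)[OF q]] conn_W[OF q] hor\<phi>[OF q] at(5)[OF q] by (simp_all add: Z_def W'_def)
  have Qq: "Q q \<in> tangent_space A q"
    "snd (Q q) c = FD W' (snd c q) (U' (snd c q)) - hor c (\<phi> (snd c q)) (U' (snd c q))" if q: "q \<in> D" for q
    using aff[where Y = U, OF q WD at(3)[OF q]] conn_U[OF q at(3)[OF q]] at(6)[OF q] by (simp_all add: Q_def W'_def)
  have Zrep: "vf_rep c Z y = FD W' y (W' y) - sp c (\<phi> y)" if y: "y \<in> snd c ` D" for y
    using Zq(2)[OF chart_inv_mem[OF c(1) y Dc]] chart_inv_right[OF c(1) y Dc] by (simp add: vf_rep_def)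
  have Qrep: "vf_rep c Q y = FD W' y (U' y) - hor c (\<phi> y) (U' y)" if y: "y \<in> snd c ` D" for y
    using Qq(2)[OF chart_inv_mem[OF c(1) y Dc]] chart_inv_right[OF c(1) y Dc] by (simp add: vf_rep_def)
  \<comment> \<open>The outer derivative can be taken only of a smooth field. The formulas
    \<open>Zrep\<close> and \<open>Qrep\<close> contain no values of the connection form, so
    smoothness follows from that of \<open>W\<close>, \<open>U\<close> and the spray.\<close>
  have ZD: "smooth_vf A D Z"
  proof (rule smooth_vf_chartI[OF c(1) Dc o Zq(1)])
    have "smooth_on (snd c ` D) (\<lambda>y. FD W' y (W' y) - sp c (\<phi> y))"
      by (rule smooth_on_diff[OF smooth_on_FD_compose[OF smW smooth_on_ident _ smW o]
            smooth_on_compose[OF sm\<phi> sp_smooth[OF c(1)] o \<phi>im] o]) simp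
    then show "smooth_on (snd c ` D) (vf_rep c Z)" by (rule iffD2[OF smooth_on_cong[OF o Zrep], rotated])
  qed
  have QD: "smooth_vf A D Q"
  proof (rule smooth_vf_chartI[OF c(1) Dc o Qq(1)])
    have "smooth_on (snd c ` D) (\<lambda>y. FD W' y (U' y) - hor c (\<phi> y) (U' y))"
      by (rule smooth_on_diff[OF smooth_on_FD_compose[OF smW smooth_on_ident _ smU o] hor_sm o]) simp
    then show "smooth_on (snd c ` D) (vf_rep c Q)" by (rule iffD2[OF smooth_on_cong[OF o Qrep], rotated])
  qed

  let ?z = "\<phi> x" and ?w = "W' x" and ?u = "U' x"
  let ?DW = "FD W' x" and ?DU = "FD U' x" and ?G = "hor c (\<phi> x)"
  have xp: "snd c p = x" by (simp add: x_def)
  note atp = at[OF pD, unfolded xp]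
  have zc: "?z \<in> cdom c" by (rule atp(8))
  have linG: "linear ?G" by (rule hor_linear[OF c(1) zc])
  have DW: "(W' has_derivative ?DW) (at x)" and DU: "(U' has_derivative ?DU) (at x)"
    using smooth_on_has_derivative[OF smW xD] smooth_on_has_derivative[OF smU xD] by auto
  have linW: "linear ?DW" by (rule has_derivative_linear[OF DW])
  have D\<phi>: "(\<phi> has_derivative (\<lambda>h. (h, ?DW h))) (at x)"
    unfolding \<phi>_def[abs_def] by (rule has_derivative_Pair[OF has_derivative_ident DW])
  have geo': "?DW ?w = sp c ?z" using geo[OF c] by (simp add: xp atp W'_def[symmetric])
  have Dsp: "(sp c has_derivative FD (sp c) ?z) (at ?z)"
    by (rule smooth_on_has_derivative[OF sp_smooth[OF c(1)] zc])
  have DWV: "((\<lambda>y. FD W' y (V y)) has_derivative (\<lambda>h. FD (\<lambda>y. FD W' y (V x)) x h + ?DW (V' h))) (at x)"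
    if "(V has_derivative V') (at x)" for V V'
    by (rule has_derivative_FD_compose[OF smW xD has_derivative_ident that o])

  have "FD (vf_rep c Z) x = FD (\<lambda>y. FD W' y (W' y) - sp c (\<phi> y)) x"
    by (rule FD_cong[OF o xD Zrep])
  also have "\<dots> = (\<lambda>h. FD (\<lambda>y. FD W' y ?w) x h + ?DW (?DW h) - FD (sp c) ?z (h, ?DW h))"
    by (rule FD_eqI[OF has_derivative_diff[OF DWV[OF DW] has_derivative_compose[OF D\<phi> Dsp]]])
  finally have FZ: "FD (vf_rep c Z) x ?u =
    FD (\<lambda>y. FD W' y ?w) x ?u + ?DW (?DW ?u) - FD (sp c) ?z (?u, ?DW ?u)" by simp
  have "FD (vf_rep c Q) x = FD (\<lambda>y. FD W' y (U' y) - hor c (\<phi> y) (U' y)) x"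
    by (rule FD_cong[OF o xD Qrep])
  also have "\<dots> = (\<lambda>h. FD (\<lambda>y. FD W' y ?u) x h + ?DW (?DU h)
      - ((1/2) *\<^sub>R FD (\<lambda>y. FD (sp c) y (0, ?u)) ?z (h, ?DW h) + ?G (?DU h)))"
    by (rule FD_eqI[OF has_derivative_diff[OF DWV[OF DU] hor_has_derivative[OF c(1) zc D\<phi> DU]]])
  finally have FQ: "FD (vf_rep c Q) x ?w = FD (\<lambda>y. FD W' y ?u) x ?w + ?DW (?DU ?w)
      - ((1/2) *\<^sub>R FD (\<lambda>y. FD (sp c) y (0, ?u)) ?z (?w, sp c ?z) + ?G (?DU ?w))" by (simp add: geo')
  have sym: "FD (\<lambda>y. FD W' y ?w) x ?u = FD (\<lambda>y. FD W' y ?u) x ?w"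
    by (rule second_derivative_symmetric[OF smW o xD])
  \<comment> \<open>Inverts the definition of \<open>hor\<close>: a fibre increment contributes
    twice its \<open>hor\<close> value.\<close>
  have split: "FD (sp c) ?z (h, k) = FD (sp c) ?z (h, 0) + 2 *\<^sub>R ?G k" for h k
    using linear_add[OF has_derivative_linear[OF Dsp], of "(h, 0)" "(0, k)"] by (simp add: hor_def)

  have br: "lie_bracket A W U p \<in> tangent_space A p" by (rule lie_bracket_in[OF oD WD UD pD])
  have brc: "snd (lie_bracket A W U p) c = ?DU ?w - ?DW ?u"
    using c by (simp add: lie_bracket_def xp atp W'_def[symmetric] U'_def[symmetric])
  \<comment> \<open>The use of the geodesic equation that removes the unknown values of the
    connection form: in \<open>T1\<close> the form is applied to this zero vector.\<close>
  have Zp: "snd (Z p) c = 0" using Zq(2)[OF pD] by (simp add: xp geo')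
  have T1: "snd (affine_conn A S nabla W U Z p) c = FD (vf_rep c Z) x ?u"
    using aff(2)[where Y = U, OF pD ZD atp(3)] by (simp add: xp atp Zp linear_0[OF conn_linear])
  have T2: "snd (affine_conn A S nabla W W Q p) c = FD (vf_rep c Q) x ?w - ?G (?DW ?u - ?G ?u)"
    using aff(2)[where Y = W, OF pD QD atp(4)] conn_W[OF pD] Qq(2)[OF pD] by (simp add: xp atp)
  have T3: "snd (affine_conn A S nabla W (lie_bracket A W U) W p) c =
      ?DW (?DU ?w - ?DW ?u) - ?G (?DU ?w - ?DW ?u)"
    using aff(2)[where Y = "lie_bracket A W U", OF pD WD br] conn_U[OF pD br] by (simp add: xp atp brc W'_def[symmetric])
  have R: "curvature_endo A S nabla (W p) (U p) \<in> tangent_space A p"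
    "snd (curvature_endo A S nabla (W p) (U p)) c =
      (1/2) *\<^sub>R FD (\<lambda>y. FD (sp c) y (0, ?u)) ?z (?w, sp c ?z)
      - FD (sp c) ?z (?u, ?G ?u) + ?G (?G ?u)"
    using curvature_endo_props[OF atp(1), of "U p"] c by (simp_all add: atp)
  \<comment> \<open>The terms with second derivatives of \<open>W\<close>, with \<open>?DU\<close>
    and with \<open>?DW\<close> applied twice cancel directly. The two copies of
    \<open>?G (?DW ?u)\<close> left over cancel against the one in \<open>split\<close>, and the
    same splitting on the curvature side turns its \<open>?G (?G ?u)\<close> into the negative found
    here.\<close>
  have "snd (affine_conn A S nabla W U Z p -\<^sub>T affine_conn A S nabla W W Q p
      +\<^sub>T affine_conn A S nabla W (lie_bracket A W U) W p) c
    = snd (curvature_endo A S nabla (W p) (U p)) c"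
    unfolding snd_tadd snd_tdiff T1 T2 T3 R FZ FQ sym split[of ?u "?DW ?u"] split[of ?u "?G ?u"]
      linear_diff[OF linW] linear_diff[OF linG]
    by (simp add: scaleR_2)
  then show ?thesis
    unfolding Z_def[symmetric] Q_def[symmetric]
    by (intro tangent_eqI[OF tadd_in[OF tdiff_in[OF aff(1)[where Y = U, OF pD ZD atp(3)] aff(1)[where Y = W, OF pD QD atp(4)]]
            aff(1)[where Y = "lie_bracket A W U", OF pD WD br]] R(1) c])
qed

end

theorem proposition2p21:
  fixes A :: "('a, 'e::euclidean_space) atlas"
    and S :: "('a, 'e) tfield"
    and nabla :: "('a, 'e) vconn"
    and Op :: "'a set"
    and W :: "'a \<Rightarrow> ('a, 'e) tvec"
    and \<gamma> :: "real \<Rightarrow> 'a"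
    and J :: "real set"
    and x\<^sub>0 :: 'a
  assumes manifold: "smooth_manifold A"
    and spray: "spray A S"
    and lift: "lift_of A S nabla"
    and torsion: "\<And>Y w. smooth_vf (slit_atlas A) (slit A) Y \<Longrightarrow> w \<in> slit A \<Longrightarrow>
                    torsion A nabla S Y w = tzero w"
    and Op: "openin (mtop A) Op"
    and W: "smooth_vf A Op W"
    and W_nonnull: "\<And>x. x \<in> Op \<Longrightarrow> W x \<noteq> tzero x"
    and x0: "x\<^sub>0 \<in> Op"
    and J: "open J" "is_interval J" "0 \<in> J"
    and curve: "integral_curve A Op W J \<gamma>" "\<gamma> 0 = x\<^sub>0"
    and geodesic: "geodesic A S J \<gamma>"
  shows "\<forall>U. smooth_vf A Op U \<longrightarrow>
    affine_conn A S nabla W U (affine_conn A S nabla W W W) x\<^sub>0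
    -\<^sub>T affine_conn A S nabla W W (affine_conn A S nabla W U W) x\<^sub>0
    +\<^sub>T affine_conn A S nabla W (lie_bracket A W U) W x\<^sub>0
    = curvature_endo A S nabla (W x\<^sub>0) (U x\<^sub>0)"
proof (intro allI impI)
  fix U assume U: "smooth_vf A Op U"
  interpret M: smooth_manifold A by (rule manifold)
  interpret lifted_connection A S nabla
    by unfold_locales (simp_all add: M.chart_inj M.chart_open M.transition_smooth spray lift)
  \<comment> \<open>Points of \<open>Op\<close> are covered by charts because \<open>Op\<close> is
    open, so a nonzero \<open>W x\<close> does lie in the slit bundle.\<close>
  have Wn: "W x \<in> slit A" if x: "x \<in> Op" for x
  proof -
    obtain d where "d \<in> A" "x \<in> fst d" using topspace_chart openin_subset[OF Op] x by blast
    then show ?thesis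
      using smooth_vf_in[OF W x] W_nonnull[OF x] by (auto simp: slit_def carrier_of_def)
  qed
  show "affine_conn A S nabla W U (affine_conn A S nabla W W W) x\<^sub>0
    -\<^sub>T affine_conn A S nabla W W (affine_conn A S nabla W U W) x\<^sub>0
    +\<^sub>T affine_conn A S nabla W (lie_bracket A W U) W x\<^sub>0
    = curvature_endo A S nabla (W x\<^sub>0) (U x\<^sub>0)"
    using geodesic_equation[OF Op W Wn J(1,3) curve(1) geodesic] curve(2)
    by (intro curvature_of_affine_connection[OF M.Hausdorff torsion Op W U Wn x0]) auto
qed

end
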